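(* Let $m,n\ge 0$ be fixed integers with $m+n\ge 2$, put $l=m+n$, and let $F_k=I_{m,n}(f_k)$, $k\ge 1$, be a sequence of $(m,n)$-th complex Wiener-Itô multiple integrals with kernels $f_k\in\mathfrak{H}^{\odot m}\otimes\mathfrak{H}^{\odot n}$. Let $h_k\in\mathfrak{H}^{\odot n}\otimes\mathfrak{H}^{\odot m}$ be the kernel of $\overline{F_k}$, i.e. $\overline{F_k}=I_{n,m}(h_k)$. Then the following two statements are equivalent: (iii) As $k\to\infty$, $\|f_k\otimes_{i,j}f_k\|_{\mathfrak{H}^{\otimes(2(l-i-j))}}\to 0$ and $\|f_k\otimes_{i,j}h_k\|_{\mathfrak{H}^{\otimes(2(l-i-j))}}\to 0$ for any $i,j$ with $0<i+j\le l-1$. (iv) As $k\to\infty$, $\|f_k\tilde{\otimes}_{i,j}f_k\|_{\mathfrak{H}^{\otimes(2(l-i-j))}}\to 0$ and $\|f_k\tilde{\otimes}_{i,j}h_k\|_{\mathfrak{H}^{\otimes(2(l-i-j))}}\to 0$ for any $i,j$ with $0<i+j\le l-1$. (In both statements, for each of the two contractions, $i,j\ge 0$ range over the indices for which that contraction is defined: $0\le i,j\le \min(m,n)$ for the contractions of $f_k$ with $f_k$, and $0\le i\le m$, $0\le j\le n$ for the contractions of $f_k$ with $h_k$.)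
   Context: $\mathfrak{H}$ is a complex separable Hilbert space, the complexification of a real separable Hilbert space $\mathfrak{H}_{\mathbb{R}}$, so that complex conjugation is defined on $\mathfrak{H}$; $\langle\cdot,\cdot\rangle_{\mathfrak H}$ is linear in the first variable. $Z=\{Z(h):h\in\mathfrak{H}\}$ is a complex isonormal Gaussian process over $\mathfrak{H}$: $Z(h)=\frac{1}{\sqrt2}(X_{\mathbb C}(h)+\mathrm{i}Y_{\mathbb C}(h))$, where $X,Y$ are independent real isonormal Gaussian processes over $\mathfrak{H}_{\mathbb{R}}$ and $X_{\mathbb C},Y_{\mathbb C}$ are their complex-linear extensions to $\mathfrak H$. Thus $E[Z(g)\overline{Z(h)}]=\langle g,h\rangle_{\mathfrak H}$ and $E[Z(g)Z(h)]=0$. $\mathfrak{H}^{\odot m}$ is the $m$-th symmetric tensor power, viewed as a closed subspace of $\mathfrak{H}^{\otimes m}$ ($\mathfrak H^{\odot 0}=\mathbb C$). The complex Hermite polynomials are $J_{m,n}(z,\rho)=\sum_{k=0}^{\min(m,n)}(-1)^k k!\binom{m}{k}\binom{n}{k}z^{m-k}\bar z^{\,n-k}\rho^k$. The complex Wiener-Itô multiple integral $I_{m,n}:\mathfrak{H}^{\odot m}\otimes\mathfrak{H}^{\odot n}\to L^2(\Omega,\sigma(Z))$ is the unique continuous complex-linear map with $I_{m,n}(h^{\otimes m}\otimes\bar h^{\otimes n})=J_{m,n}(Z(h),\|h\|^2)$ for all $h\in\mathfrak{H}$; it satisfies $E[|I_{m,n}(f)|^2]=m!\,n!\,\|f\|^2$.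 Fix an orthonormal basis $(e_k)$ of $\mathfrak{H}_{\mathbb{R}}$ (hence of $\mathfrak H$) and write the coordinates of $f\in\mathfrak{H}^{\otimes a}\otimes\mathfrak{H}^{\otimes b}$ as $f(k_1,\dots,k_a;l_1,\dots,l_b)$ (the first $a$ are "first-type" indices, the last $b$ "second-type"). If $F=I_{m,n}(f)$, then $\bar F=I_{n,m}(h)$ with $h(k_1,\dots,k_n;l_1,\dots,l_m)=\overline{f(l_1,\dots,l_m;k_1,\dots,k_n)}$. For $f\in\mathfrak{H}^{\odot a}\otimes\mathfrak{H}^{\odot b}$, $g\in\mathfrak{H}^{\odot c}\otimes\mathfrak{H}^{\odot d}$, $0\le i\le\min(a,d)$, $0\le j\le\min(b,c)$, the contraction $f\otimes_{i,j}g\in\mathfrak{H}^{\otimes(a+c-i-j)}\otimes\mathfrak{H}^{\otimes(b+d-i-j)}$ pairs $i$ first-type indices of $f$ with $i$ second-type indices of $g$ and $j$ second-type indices of $f$ with $j$ first-type indices of $g$: $$(f\otimes_{i,j}g)(k,k';l,l')=\sum_{u,v}f(k,u;l,v)\,g(k',v;l',u),$$ where $u$ runs over $i$-tuples and $v$ over $j$-tuples of basis indices, and $k,k',l,l'$ are tuples of lengths $a-i,\,c-j,\,b-j,\,d-i$. This does not depend on the choice of $(e_k)$. The symmetrized contraction $f\tilde\otimes_{i,j}g\in\mathfrak{H}^{\odot(a+c-i-j)}\otimes\mathfrak{H}^{\odot(b+d-i-j)}$ is obtained from $f\otimes_{i,j}g$ by averaging over all permutations of the $a+c-i-j$ first-type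 indices and, separately, over all permutations of the $b+d-i-j$ second-type indices. *)

theory Defs
  imports "HOL-Probability.Probability" "HOL-Combinatorics.Permutations"
begin

section \<open>The complexified Hilbert space\<close>

text \<open>
  A real separable Hilbert space is a type of sort \<open>{real_inner, polish_space}\<close>.  Its
  complexification consists of the pairs \<open>(u, v)\<close>, read as \<open>u + \<i>v\<close>; the library's norm on
  products, \<open>norm (u, v) = sqrt ((norm u)\<^sup>2 + (norm v)\<^sup>2)\<close>, is the norm of the complexification.
\<close>

type_synonym 'h complexified = "'h \<times> 'h"

text \<open>The basis is indexed by a set, so that finite-dimensional (also trivial) spaces are covered.\<close>

definition orthonormal_basis :: "('k \<Rightarrow> 'h::real_inner) \<Rightarrow> 'k set \<Rightarrow> bool" where
  "orthonormal_basis e K \<longleftrightarrow>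
     (\<forall>i\<in>K. \<forall>j\<in>K. e i \<bullet> e j = (if i = j then 1 else 0)) \<and> closure (span (e ` K)) = UNIV"

text \<open>The coordinate \<open>\<langle>h, e k\<rangle>\<close> of an element of the complexification.\<close>

definition coord :: "('k \<Rightarrow> 'h::real_inner) \<Rightarrow> 'h complexified \<Rightarrow> 'k \<Rightarrow> complex" where
  "coord e h k = Complex (fst h \<bullet> e k) (snd h \<bullet> e k)"


section \<open>Tensors in coordinates\<close>

text \<open>
  With respect to an orthonormal basis indexed by \<open>K\<close>, the Hilbert space tensor product of the
  \<open>a\<close>-th and the \<open>b\<close>-th tensor power is the space of square-summable families indexed by pairs
  of an \<open>a\<close>-tuple (first-type indices) and a \<open>b\<close>-tuple (second-type indices) from \<open>K\<close>.
  Such families are extended by zero to all pairs of lists.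
\<close>

type_synonym 'k tensor = "'k list \<Rightarrow> 'k list \<Rightarrow> complex"

definition tuples :: "'k set \<Rightarrow> nat \<Rightarrow> 'k list set" where
  "tuples K r = {xs. set xs \<subseteq> K \<and> length xs = r}"

definition tensor_space :: "'k set \<Rightarrow> nat \<Rightarrow> nat \<Rightarrow> 'k tensor set" where
  "tensor_space K a b =
     {f. (\<forall>ks ls. ks \<notin> tuples K a \<or> ls \<notin> tuples K b \<longrightarrow> f ks ls = 0) \<and>
         (\<lambda>(ks, ls). (cmod (f ks ls))\<^sup>2) summable_on (tuples K a \<times> tuples K b)}"

definition tensor_norm :: "'k set \<Rightarrow> nat \<Rightarrow> nat \<Rightarrow> 'k tensor \<Rightarrow> real" where
  "tensor_norm K a b f =
     sqrt (\<Sum>\<^sub>\<infinity>(ks, ls)\<in>tuples K a \<times> tuples K b. (cmod (f ks ls))\<^sup>2)"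

text \<open>The subspace of tensors that are symmetric in each of the two groups of indices.\<close>

definition sym_tensor_space :: "'k set \<Rightarrow> nat \<Rightarrow> nat \<Rightarrow> 'k tensor set" where
  "sym_tensor_space K a b =
     {f \<in> tensor_space K a b.
        \<forall>\<sigma> \<tau> ks ls. \<sigma> permutes {..<a} \<longrightarrow> \<tau> permutes {..<b} \<longrightarrow>
          ks \<in> tuples K a \<longrightarrow> ls \<in> tuples K b \<longrightarrow>
          f (permute_list \<sigma> ks) (permute_list \<tau> ls) = f ks ls}"

definition symmetrize :: "nat \<Rightarrow> nat \<Rightarrow> 'k tensor \<Rightarrow> 'k tensor" where
  "symmetrize a b f = (\<lambda>ks ls.
     (\<Sum>\<sigma> | \<sigma> permutes {..<a}. \<Sum>\<tau> | \<tau> permutes {..<b}.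
        f (permute_list \<sigma> ks) (permute_list \<tau> ls)) / (fact a * fact b))"

text \<open>
  The tensor \<open>h \<otimes> \<dots> \<otimes> h \<otimes> \<bar>h \<otimes> \<dots> \<otimes> \<bar>h\<close> with \<open>m\<close> factors \<open>h\<close> and \<open>n\<close> factors \<open>\<bar>h\<close>.
\<close>

definition power_tensor ::
    "('k \<Rightarrow> 'h::real_inner) \<Rightarrow> 'k set \<Rightarrow> nat \<Rightarrow> nat \<Rightarrow> 'h complexified \<Rightarrow> 'k tensor" where
  "power_tensor e K m n h = (\<lambda>ks ls.
     if ks \<in> tuples K m \<and> ls \<in> tuples K n
     then (\<Prod>k\<leftarrow>ks. coord e h k) * (\<Prod>l\<leftarrow>ls. cnj (coord e h l)) else 0)"

text \<open>
  The contraction of \<open>f\<close> (of type \<open>(a, b)\<close>) with \<open>g\<close> (of type \<open>(c, d)\<close>), meant for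
  \<open>i \<le> min a d\<close> and \<open>j \<le> min b c\<close>.  The free indices of \<open>f\<close> precede those of \<open>g\<close> in both groups.
\<close>

definition contraction ::
    "'k set \<Rightarrow> nat \<Rightarrow> nat \<Rightarrow> nat \<Rightarrow> nat \<Rightarrow> nat \<Rightarrow> nat \<Rightarrow> 'k tensor \<Rightarrow> 'k tensor \<Rightarrow> 'k tensor" where
  "contraction K a b c d i j f g = (\<lambda>ks ls.
     if ks \<in> tuples K ((a - i) + (c - j)) \<and> ls \<in> tuples K ((b - j) + (d - i))
     then \<Sum>\<^sub>\<infinity>(u, v)\<in>tuples K i \<times> tuples K j.
            f (take (a - i) ks @ u) (take (b - j) ls @ v) *
            g (drop (a - i) ks @ v) (drop (b - j) ls @ u)
     else 0)"

definition sym_contraction ::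
    "'k set \<Rightarrow> nat \<Rightarrow> nat \<Rightarrow> nat \<Rightarrow> nat \<Rightarrow> nat \<Rightarrow> nat \<Rightarrow> 'k tensor \<Rightarrow> 'k tensor \<Rightarrow> 'k tensor" where
  "sym_contraction K a b c d i j f g =
     symmetrize ((a - i) + (c - j)) ((b - j) + (d - i)) (contraction K a b c d i j f g)"

definition contraction_norm ::
    "'k set \<Rightarrow> nat \<Rightarrow> nat \<Rightarrow> nat \<Rightarrow> nat \<Rightarrow> nat \<Rightarrow> nat \<Rightarrow> 'k tensor \<Rightarrow> 'k tensor \<Rightarrow> real" where
  "contraction_norm K a b c d i j f g =
     tensor_norm K ((a - i) + (c - j)) ((b - j) + (d - i)) (contraction K a b c d i j f g)"

definition sym_contraction_norm ::
    "'k set \<Rightarrow> nat \<Rightarrow> nat \<Rightarrow> nat \<Rightarrow> nat \<Rightarrow> nat \<Rightarrow> nat \<Rightarrow> 'k tensor \<Rightarrow> 'k tensor \<Rightarrow> real" where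
  "sym_contraction_norm K a b c d i j f g =
     tensor_norm K ((a - i) + (c - j)) ((b - j) + (d - i)) (sym_contraction K a b c d i j f g)"


section \<open>Isonormal Gaussian processes\<close>

text \<open>The degenerate law, concentrated at zero, counts as centered Gaussian.\<close>

definition centered_gaussian :: "'w measure \<Rightarrow> ('w \<Rightarrow> real) \<Rightarrow> bool" where
  "centered_gaussian M Y \<longleftrightarrow> Y \<in> borel_measurable M \<and>
     ((AE \<omega> in M. Y \<omega> = 0) \<or> (\<exists>\<sigma>>0. distributed M lborel Y (normal_density 0 \<sigma>)))"

text \<open>A centered jointly Gaussian family whose covariance is the inner product.\<close>

definition real_isonormal :: "'w measure \<Rightarrow> ('h::real_inner \<Rightarrow> 'w \<Rightarrow> real) \<Rightarrow> bool" where
  "real_isonormal M X \<longleftrightarrow>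
     (\<forall>S c. finite S \<longrightarrow> centered_gaussian M (\<lambda>\<omega>. \<Sum>h\<in>S. c h * X h \<omega>)) \<and>
     (\<forall>g h. (\<integral>\<omega>. X g \<omega> * X h \<omega> \<partial>M) = g \<bullet> h)"

definition complex_extension ::
    "('h \<Rightarrow> 'w \<Rightarrow> real) \<Rightarrow> 'h complexified \<Rightarrow> 'w \<Rightarrow> complex" where
  "complex_extension X h \<omega> = complex_of_real (X (fst h) \<omega>) + \<i> * complex_of_real (X (snd h) \<omega>)"

definition complex_isonormal ::
    "'w measure \<Rightarrow> ('h::real_inner complexified \<Rightarrow> 'w \<Rightarrow> complex) \<Rightarrow> bool" where
  "complex_isonormal M Z \<longleftrightarrow>
     (\<exists>X Y. real_isonormal M X \<and> real_isonormal M Y \<and>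
        prob_space.indep_var M
          (Pi\<^sub>M UNIV (\<lambda>_. borel)) (\<lambda>\<omega> h. X h \<omega>) (Pi\<^sub>M UNIV (\<lambda>_. borel)) (\<lambda>\<omega> h. Y h \<omega>) \<and>
        (\<forall>h. \<forall>\<omega>\<in>space M. Z h \<omega> =
           (complex_extension X h \<omega> + \<i> * complex_extension Y h \<omega>) / complex_of_real (sqrt 2)))"

text \<open>The measurable space carrying the \<open>\<sigma>\<close>-algebra generated by the process.\<close>

definition generated_by :: "'w measure \<Rightarrow> ('i \<Rightarrow> 'w \<Rightarrow> complex) \<Rightarrow> 'w measure" where
  "generated_by M Z = vimage_algebra (space M) (\<lambda>\<omega> h. Z h \<omega>) (Pi\<^sub>M UNIV (\<lambda>_. borel))"


section \<open>Complex multiple Wiener-Ito integrals\<close>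

definition complex_hermite :: "nat \<Rightarrow> nat \<Rightarrow> complex \<Rightarrow> real \<Rightarrow> complex" where
  "complex_hermite m n z \<rho> =
     (\<Sum>k\<le>min m n. (-1) ^ k * fact k * of_nat (m choose k) * of_nat (n choose k) *
        z ^ (m - k) * cnj z ^ (n - k) * complex_of_real \<rho> ^ k)"

text \<open>
  \<open>I\<close> is the continuous complex-linear map \<open>I\<^sub>m\<^sub>,\<^sub>n\<close> into \<open>L\<^sup>2(\<Omega>, \<sigma>(Z))\<close>.  Elements of \<open>L\<^sup>2\<close> are given by
  representatives, so identities between them are almost sure; continuity of a linear map is
  expressed by boundedness.
\<close>

definition wiener_ito_integral ::
    "'w measure \<Rightarrow> ('h::real_inner complexified \<Rightarrow> 'w \<Rightarrow> complex) \<Rightarrow> ('k \<Rightarrow> 'h) \<Rightarrow> 'k set \<Rightarrow>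
     nat \<Rightarrow> nat \<Rightarrow> ('k tensor \<Rightarrow> 'w \<Rightarrow> complex) \<Rightarrow> bool" where
  "wiener_ito_integral M Z e K m n I \<longleftrightarrow>
     (\<forall>f\<in>sym_tensor_space K m n. I f \<in> borel_measurable (generated_by M Z) \<and>
        integrable M (\<lambda>\<omega>. (cmod (I f \<omega>))\<^sup>2)) \<and>
     (\<forall>f\<in>sym_tensor_space K m n. \<forall>g\<in>sym_tensor_space K m n.
        AE \<omega> in M. I (\<lambda>ks ls. f ks ls + g ks ls) \<omega> = I f \<omega> + I g \<omega>) \<and>
     (\<forall>f\<in>sym_tensor_space K m n. \<forall>c. AE \<omega> in M. I (\<lambda>ks ls. c * f ks ls) \<omega> = c * I f \<omega>) \<and>
     (\<exists>C. \<forall>f\<in>sym_tensor_space K m n.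
        (\<integral>\<omega>. (cmod (I f \<omega>))\<^sup>2 \<partial>M) \<le> C * (tensor_norm K m n f)\<^sup>2) \<and>
     (\<forall>h. AE \<omega> in M. I (power_tensor e K m n h) \<omega> = complex_hermite m n (Z h \<omega>) ((norm h)\<^sup>2))"

end

theory Submission
  imports Defs
begin

text \<open>
Write \<open>f\<^sup>*\<close> for the tensor obtained from \<open>f\<close> by exchanging the two groups of indices and conjugating. The
argument has an analytic part, which identifies the kernel of the conjugate of \<open>I\<^sub>m\<^sub>,\<^sub>n(f)\<close> as \<open>f\<^sup>*\<close>, and a purely
algebraic part about the contractions of \<open>f\<close> with \<open>f\<close> and with \<open>f\<^sup>*\<close>.

Symmetrization is an average of isometries, so it does not increase norms, and this gives one implication. For the
other one the norms of the contractions have to be bounded by those of the symmetrized contractions, uniformly in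
\<open>f\<close>; since the norms of the kernels may be unbounded, an exact identity is needed. The fourth absolute moment of
\<open>I\<^sub>m\<^sub>,\<^sub>n(f)\<close> is a sum over configurations: directed multigraphs without loops on four vertices, two of them labelled by
\<open>f\<close> and two by \<open>f\<^sup>*\<close>, with prescribed in- and out-degrees. Each vertex has total degree \<open>l = m + n\<close>, which forces
opposite pairs of vertices to be joined by equally many edges. So there are three numbers \<open>e\<^sub>1\<^sub>2\<close>, \<open>e\<^sub>1\<^sub>3\<close>, \<open>e\<^sub>1\<^sub>4\<close> with sum
\<open>l\<close>. Grouping the configurations by \<open>e\<^sub>1\<^sub>2 = r\<close> turns their sum into inner products of the symmetrized contractions
\<open>f \<otimes>\<^sub>i\<^sub>,\<^sub>j f\<close> with \<open>i + j = r\<close>; grouping by \<open>e\<^sub>1\<^sub>3\<close> or \<open>e\<^sub>1\<^sub>4\<close> gives those of \<open>f\<close> with \<open>f\<^sup>*\<close>. Now weight a configuration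
with \<open>\<gamma>(e\<^sub>1\<^sub>2) + \<gamma>(e\<^sub>1\<^sub>3) + \<gamma>(e\<^sub>1\<^sub>4)\<close>, where \<open>\<gamma>(r) = 3r - l\<close> for \<open>0 < r < l\<close> and \<open>\<gamma> = 0\<close> otherwise. This weight vanishes
unless exactly one of the three numbers is zero, and then it is \<open>l\<close>. In that case the graph is a four-cycle, and its
value is the squared norm of a contraction without symmetrization, with a positive coefficient. Hence a positive
combination of the squared norms of all contractions equals a combination of inner products of symmetrized ones with
\<open>0 < i + j < l\<close>. Cauchy--Schwarz then gives \<open>contraction_norm_inequality\<close>.

The identity is an identity of multilinear expressions in the kernels. A symmetric tensor with finite support is a
linear combination of tensors \<open>x \<otimes> \<dots> \<otimes> x \<otimes> x\<^sup>* \<otimes> \<dots> \<otimes> x\<^sup>*\<close> (polarization, \<open>sym_tensor_eq_sum_of_powers\<close>), so it is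
enough to verify it on those, where the value of a configuration is a monomial in the pairwise inner products
(\<open>config_identity\<close>). Contractions are continuous, so truncation extends the inequality to all kernels.

For the analytic part, the functional \<open>f \<mapsto> E[I\<^sub>m\<^sub>,\<^sub>n(f) exp(\<i> Re Z(w))]\<close> is linear and bounded. On powers it is computed
by Gaussian integration by parts (\<open>expectation_complex_hermite_iexp\<close>): up to an explicit nonzero factor it is the inner
product with the power of \<open>w\<close>. By polarization and density this holds for all \<open>f\<close>. Consequently these expectations
determine the kernel, and comparing them for \<open>I\<^sub>n\<^sub>,\<^sub>m(h)\<close> and the conjugate of \<open>I\<^sub>m\<^sub>,\<^sub>n(f)\<close> gives \<open>h = f\<^sup>*\<close>
(\<open>kernel_of_conjugate\<close>).
\<close>

section \<open>Square-summable families\<close>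

text \<open>
For nonnegative families, summability and boundedness of the finite partial sums agree, so estimates can be proved
with the finite norm \<^const>\<open>L2_set\<close> and transferred by \<open>square_summable_boundI\<close>.
\<close>

definition square_summable :: "'i set \<Rightarrow> ('i \<Rightarrow> complex) \<Rightarrow> bool" where
  "square_summable S f \<longleftrightarrow> (\<lambda>x. (cmod (f x))\<^sup>2) summable_on S"

definition l2_norm :: "'i set \<Rightarrow> ('i \<Rightarrow> complex) \<Rightarrow> real" where
  "l2_norm S f = sqrt (\<Sum>\<^sub>\<infinity>x\<in>S. (cmod (f x))\<^sup>2)"

lemma l2_norm_nonneg [simp]: "0 \<le> l2_norm S f"
  by (simp add: l2_norm_def infsum_nonneg)

lemma l2_norm_squared: "(l2_norm S f)\<^sup>2 = (\<Sum>\<^sub>\<infinity>x\<in>S. (cmod (f x))\<^sup>2)"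
  by (simp add: l2_norm_def infsum_nonneg)

lemma L2_set_le_l2_norm:
  assumes "square_summable S f" "finite A" "A \<subseteq> S"
  shows "L2_set (\<lambda>x. cmod (f x)) A \<le> l2_norm S f"
  unfolding L2_set_def l2_norm_def
  using assms by (auto simp: square_summable_def intro!: finite_sum_le_infsum)

lemma square_summable_boundI:
  assumes "\<And>A. finite A \<Longrightarrow> A \<subseteq> S \<Longrightarrow> L2_set (\<lambda>x. cmod (f x)) A \<le> B" "0 \<le> B"
  shows "square_summable S f \<and> l2_norm S f \<le> B"
proof
  have le: "(\<Sum>x\<in>A. (cmod (f x))\<^sup>2) \<le> B\<^sup>2" if "finite A" "A \<subseteq> S" for A
    using assms(1)[OF that] by (auto simp: L2_set_def intro: sqrt_le_D)
  show sum: "square_summable S f"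
    unfolding square_summable_def
    by (rule nonneg_bdd_above_summable_on) (use le in \<open>auto intro!: bdd_aboveI2[where M="B\<^sup>2"]\<close>)
  have "(\<Sum>\<^sub>\<infinity>x\<in>S. (cmod (f x))\<^sup>2) \<le> B\<^sup>2"
    by (rule infsum_le_finite_sums) (use le sum in \<open>auto simp: square_summable_def\<close>)
  then show "l2_norm S f \<le> B"
    unfolding l2_norm_def using assms(2) by (simp add: real_le_lsqrt infsum_nonneg)
qed

lemma l2_triangle:
  assumes "square_summable S f" "square_summable S g"
  shows "square_summable S (\<lambda>x. f x + g x) \<and> l2_norm S (\<lambda>x. f x + g x) \<le> l2_norm S f + l2_norm S g"
proof (rule square_summable_boundI)
  fix A assume A: "finite A" "A \<subseteq> S"
  have "L2_set (\<lambda>x. cmod (f x + g x)) A \<le> L2_set (\<lambda>x. cmod (f x) + cmod (g x)) A"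
    by (intro L2_set_mono) (auto simp: norm_triangle_ineq)
  also have "\<dots> \<le> L2_set (\<lambda>x. cmod (f x)) A + L2_set (\<lambda>x. cmod (g x)) A"
    by (rule L2_set_triangle_ineq)
  also have "\<dots> \<le> l2_norm S f + l2_norm S g"
    using L2_set_le_l2_norm[OF assms(1) A] L2_set_le_l2_norm[OF assms(2) A] by simp
  finally show "L2_set (\<lambda>x. cmod (f x + g x)) A \<le> l2_norm S f + l2_norm S g" .
qed simp

lemma l2_scale:
  assumes "square_summable S f"
  shows "square_summable S (\<lambda>x. c * f x) \<and> l2_norm S (\<lambda>x. c * f x) = cmod c * l2_norm S f"
  using assms unfolding square_summable_def l2_norm_def
  by (auto simp: norm_mult power_mult_distrib infsum_cmult_right' real_sqrt_mult
      intro!: summable_on_cmult_right)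

lemma l2_Cauchy_Schwarz:
  assumes "square_summable S f" "square_summable S g"
  shows "(\<lambda>x. norm (f x * g x)) summable_on S"
    and "cmod (\<Sum>\<^sub>\<infinity>x\<in>S. f x * g x) \<le> l2_norm S f * l2_norm S g"
proof -
  show *: "(\<lambda>x. norm (f x * g x)) summable_on S"
    by (rule abs_summable_product)
      (use assms in \<open>auto simp: square_summable_def norm_mult power2_eq_square\<close>)
  have "cmod (\<Sum>\<^sub>\<infinity>x\<in>S. f x * g x) \<le> (\<Sum>\<^sub>\<infinity>x\<in>S. cmod (f x * g x))"
    by (rule norm_infsum_bound) (rule *)
  also have "\<dots> \<le> l2_norm S f * l2_norm S g"
  proof (rule infsum_le_finite_sums[OF *])
    fix A assume A: "finite A" "A \<subseteq> S"
    have "(\<Sum>x\<in>A. cmod (f x * g x)) = (\<Sum>x\<in>A. \<bar>cmod (f x)\<bar> * \<bar>cmod (g x)\<bar>)"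
      by (simp add: norm_mult)
    also have "\<dots> \<le> L2_set (\<lambda>x. cmod (f x)) A * L2_set (\<lambda>x. cmod (g x)) A"
      by (rule L2_set_mult_ineq)
    also have "\<dots> \<le> l2_norm S f * l2_norm S g"
      by (intro mult_mono L2_set_le_l2_norm assms A) auto
    finally show "(\<Sum>x\<in>A. cmod (f x * g x)) \<le> l2_norm S f * l2_norm S g" .
  qed
  finally show "cmod (\<Sum>\<^sub>\<infinity>x\<in>S. f x * g x) \<le> l2_norm S f * l2_norm S g" .
qed

lemma square_summable_section:
  assumes "square_summable (P \<times> U) F"
  shows "p \<in> P \<Longrightarrow> square_summable U (\<lambda>u. F (p, u))"
    and "(\<lambda>p. (l2_norm U (\<lambda>u. F (p, u)))\<^sup>2) summable_on P"
    and "(\<Sum>\<^sub>\<infinity>p\<in>P. (l2_norm U (\<lambda>u. F (p, u)))\<^sup>2) = (l2_norm (P \<times> U) F)\<^sup>2"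
proof -
  have s: "(\<lambda>(p, u). (cmod (F (p, u)))\<^sup>2) summable_on P \<times> U"
    using assms by (simp add: square_summable_def case_prod_unfold)
  show "(\<lambda>p. (l2_norm U (\<lambda>u. F (p, u)))\<^sup>2) summable_on P"
    using summable_on_Sigma_banach[OF s] by (simp add: l2_norm_squared)
  show "(\<Sum>\<^sub>\<infinity>p\<in>P. (l2_norm U (\<lambda>u. F (p, u)))\<^sup>2) = (l2_norm (P \<times> U) F)\<^sup>2"
    using infsum_Sigma'_banach[OF s] by (simp add: l2_norm_squared case_prod_unfold)
  assume p: "p \<in> P"
  have "(\<lambda>x. (cmod (F x))\<^sup>2) summable_on Pair p ` U"
    by (rule summable_on_subset_banach[of _ "P \<times> U"])
      (use p assms in \<open>auto simp: square_summable_def\<close>)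
  then show "square_summable U (\<lambda>u. F (p, u))"
    by (subst (asm) summable_on_reindex) (auto simp: square_summable_def o_def inj_on_def)
qed

text \<open>
Summing over a shared variable is the composition of Hilbert--Schmidt kernels: Cauchy--Schwarz in the shared variable
bounds each entry by a product of section norms, whose squares sum to the product of the squared norms.
\<close>

lemma l2_composition:
  assumes F: "square_summable (P \<times> U) F" and G: "square_summable (Q \<times> U) G"
  shows "square_summable (P \<times> Q) (\<lambda>(p, q). \<Sum>\<^sub>\<infinity>u\<in>U. F (p, u) * G (q, u)) \<and>
         l2_norm (P \<times> Q) (\<lambda>(p, q). \<Sum>\<^sub>\<infinity>u\<in>U. F (p, u) * G (q, u))
           \<le> l2_norm (P \<times> U) F * l2_norm (Q \<times> U) G"
proof (rule square_summable_boundI)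
  fix A assume A: "finite A" "A \<subseteq> P \<times> Q"
  define F2 where "F2 = (\<lambda>p. (l2_norm U (\<lambda>u. F (p, u)))\<^sup>2)"
  define G2 where "G2 = (\<lambda>q. (l2_norm U (\<lambda>u. G (q, u)))\<^sup>2)"
  have "(\<Sum>x\<in>A. (cmod (case x of (p, q) \<Rightarrow> \<Sum>\<^sub>\<infinity>u\<in>U. F (p, u) * G (q, u)))\<^sup>2)
      \<le> (\<Sum>x\<in>A. F2 (fst x) * G2 (snd x))"
  proof (rule sum_mono)
    fix x assume "x \<in> A"
    then obtain p q where x: "x = (p, q)" "p \<in> P" "q \<in> Q" using A by auto
    show "(cmod (case x of (p, q) \<Rightarrow> \<Sum>\<^sub>\<infinity>u\<in>U. F (p, u) * G (q, u)))\<^sup>2 \<le> F2 (fst x) * G2 (snd x)"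
      using power_mono[OF l2_Cauchy_Schwarz(2)[OF square_summable_section(1)[OF F x(2)]
            square_summable_section(1)[OF G x(3)]], of 2]
      by (simp add: x F2_def G2_def power_mult_distrib)
  qed
  also have "\<dots> \<le> (\<Sum>x\<in>fst ` A \<times> snd ` A. F2 (fst x) * G2 (snd x))"
    by (rule sum_mono2) (use A in \<open>force simp: F2_def G2_def\<close>)+
  also have "\<dots> = (\<Sum>p\<in>fst ` A. F2 p) * (\<Sum>q\<in>snd ` A. G2 q)"
    by (simp add: sum_product sum.cartesian_product case_prod_unfold)
  also have "\<dots> \<le> (l2_norm (P \<times> U) F)\<^sup>2 * (l2_norm (Q \<times> U) G)\<^sup>2"
  proof (intro mult_mono sum_nonneg)
    show "sum F2 (fst ` A) \<le> (l2_norm (P \<times> U) F)\<^sup>2"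
      unfolding square_summable_section(3)[OF F, symmetric] F2_def
      by (rule finite_sum_le_infsum) (use A square_summable_section(2)[OF F] in auto)
    show "sum G2 (snd ` A) \<le> (l2_norm (Q \<times> U) G)\<^sup>2"
      unfolding square_summable_section(3)[OF G, symmetric] G2_def
      by (rule finite_sum_le_infsum) (use A square_summable_section(2)[OF G] in auto)
  qed (auto simp: F2_def G2_def)
  also have "\<dots> = (l2_norm (P \<times> U) F * l2_norm (Q \<times> U) G)\<^sup>2"
    by (simp add: power_mult_distrib)
  finally show "L2_set (\<lambda>x. cmod (case x of (p, q) \<Rightarrow> \<Sum>\<^sub>\<infinity>u\<in>U. F (p, u) * G (q, u))) A
      \<le> l2_norm (P \<times> U) F * l2_norm (Q \<times> U) G"
    unfolding L2_set_def by (intro real_le_lsqrt) auto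
qed simp

lemma l2_reindex_bij:
  assumes "bij_betw \<phi> S T"
  shows "square_summable S (\<lambda>x. f (\<phi> x)) \<longleftrightarrow> square_summable T f"
    and "l2_norm S (\<lambda>x. f (\<phi> x)) = l2_norm T f"
  using summable_on_reindex_bij_betw[OF assms, of "\<lambda>x. (cmod (f x))\<^sup>2"]
    infsum_reindex_bij_betw[OF assms, of "\<lambda>x. (cmod (f x))\<^sup>2"]
  by (auto simp: square_summable_def l2_norm_def)

lemma l2_cong:
  assumes "\<And>x. x \<in> S \<Longrightarrow> f x = g x"
  shows "square_summable S f \<longleftrightarrow> square_summable S g" "l2_norm S f = l2_norm S g"
  using assms by (auto simp: square_summable_def l2_norm_def intro!: summable_on_cong infsum_cong
      arg_cong[of _ _ sqrt])

lemma square_summable_finite: "finite S \<Longrightarrow> square_summable S f"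
  by (simp add: square_summable_def)

text \<open>
The squared norm outside \<open>A\<close> is a tail of a convergent sum.
\<close>

lemma l2_restriction_tendsto:
  assumes "square_summable S f"
  shows "((\<lambda>A. l2_norm S (\<lambda>x. if x \<in> A then 0 else f x)) \<longlongrightarrow> 0) (finite_subsets_at_top S)"
proof -
  let ?g = "\<lambda>x. (cmod (f x))\<^sup>2"
  have s: "?g summable_on S" using assms by (simp add: square_summable_def)
  have eq: "(l2_norm S (\<lambda>x. if x \<in> A then 0 else f x))\<^sup>2 = infsum ?g S - sum ?g A"
    if "finite A" "A \<subseteq> S" for A
  proof -
    have "(l2_norm S (\<lambda>x. if x \<in> A then 0 else f x))\<^sup>2 = infsum ?g (S - A)"
      unfolding l2_norm_squared by (rule infsum_cong_neutral) auto
    also have "\<dots> = infsum ?g S - sum ?g A"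
      using infsum_Diff[of ?g S A] s that by (simp add: summable_on_subset_banach)
    finally show ?thesis .
  qed
  have "((\<lambda>A. infsum ?g S - sum ?g A) \<longlongrightarrow> infsum ?g S - infsum ?g S) (finite_subsets_at_top S)"
    by (intro tendsto_intros infsum_tendsto s)
  then have "((\<lambda>A. infsum ?g S - sum ?g A) \<longlongrightarrow> 0) (finite_subsets_at_top S)" by simp
  then have "((\<lambda>A. (l2_norm S (\<lambda>x. if x \<in> A then 0 else f x))\<^sup>2) \<longlongrightarrow> 0) (finite_subsets_at_top S)"
    by (rule Lim_transform_eventually) (auto intro!: eventually_finite_subsets_at_top_weakI simp: eq)
  then have "((\<lambda>A. sqrt ((l2_norm S (\<lambda>x. if x \<in> A then 0 else f x))\<^sup>2)) \<longlongrightarrow> sqrt 0) (finite_subsets_at_top S)"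
    by (rule tendsto_real_sqrt)
  then show ?thesis by simp
qed

section \<open>Norms of tensors, contractions and symmetrizations\<close>

abbreviation index_pairs :: "'k set \<Rightarrow> nat \<Rightarrow> nat \<Rightarrow> ('k list \<times> 'k list) set" where
  "index_pairs K a b \<equiv> tuples K a \<times> tuples K b"

lemma l2_mono:
  assumes "square_summable S g" "\<And>x. x \<in> S \<Longrightarrow> cmod (f x) \<le> cmod (g x)"
  shows "square_summable S f \<and> l2_norm S f \<le> l2_norm S g"
proof (rule square_summable_boundI)
  fix A assume A: "finite A" "A \<subseteq> S"
  have "L2_set (\<lambda>x. cmod (f x)) A \<le> L2_set (\<lambda>x. cmod (g x)) A"
    by (intro L2_set_mono) (use A assms in auto)
  also have "\<dots> \<le> l2_norm S g" by (rule L2_set_le_l2_norm[OF assms(1) A])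
  finally show "L2_set (\<lambda>x. cmod (f x)) A \<le> l2_norm S g" .
qed simp

lemma l2_sum:
  assumes "finite I" "\<And>i. i \<in> I \<Longrightarrow> square_summable S (f i)"
  shows "square_summable S (\<lambda>x. \<Sum>i\<in>I. f i x) \<and> l2_norm S (\<lambda>x. \<Sum>i\<in>I. f i x) \<le> (\<Sum>i\<in>I. l2_norm S (f i))"
  using assms
proof (induction I)
  case empty
  then show ?case by (simp add: square_summable_def l2_norm_def)
next
  case (insert i I)
  then show ?case using l2_triangle[of S "f i" "\<lambda>x. \<Sum>i\<in>I. f i x"] by auto
qed

lemma tensor_norm_eq_l2_norm: "tensor_norm K a b f = l2_norm (index_pairs K a b) (case_prod f)"
  by (simp add: tensor_norm_def l2_norm_def case_prod_unfold)

lemma tensor_space_iff: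
  "f \<in> tensor_space K a b \<longleftrightarrow>
     (\<forall>ks ls. ks \<notin> tuples K a \<or> ls \<notin> tuples K b \<longrightarrow> f ks ls = 0) \<and>
     square_summable (index_pairs K a b) (case_prod f)"
  by (simp add: tensor_space_def square_summable_def case_prod_unfold)

lemma tensor_add:
  assumes "f \<in> tensor_space K a b" "g \<in> tensor_space K a b"
  shows "(\<lambda>ks ls. f ks ls + g ks ls) \<in> tensor_space K a b"
    and "tensor_norm K a b (\<lambda>ks ls. f ks ls + g ks ls) \<le> tensor_norm K a b f + tensor_norm K a b g"
  using l2_triangle[of "index_pairs K a b" "case_prod f" "case_prod g"] assms
  by (auto simp: tensor_space_iff tensor_norm_eq_l2_norm case_prod_unfold)

lemma tensor_scale:
  assumes "f \<in> tensor_space K a b"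
  shows "(\<lambda>ks ls. c * f ks ls) \<in> tensor_space K a b"
    and "tensor_norm K a b (\<lambda>ks ls. c * f ks ls) = cmod c * tensor_norm K a b f"
  using l2_scale[of "index_pairs K a b" "case_prod f" c] assms
  by (auto simp: tensor_space_iff tensor_norm_eq_l2_norm case_prod_unfold)

lemma tensor_norm_nonneg [simp]: "0 \<le> tensor_norm K a b f"
  by (simp add: tensor_norm_eq_l2_norm)

lemma append_in_tuples: "xs \<in> tuples K p \<Longrightarrow> ys \<in> tuples K q \<Longrightarrow> xs @ ys \<in> tuples K (p + q)"
  by (auto simp: tuples_def)

lemma take_drop_in_tuples:
  assumes "xs \<in> tuples K (p + q)"
  shows "take p xs \<in> tuples K p" "drop p xs \<in> tuples K q"
  using assms set_take_subset[of p xs] set_drop_subset[of p xs] by (auto simp: tuples_def)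

lemma bij_betw_take_drop:
  "bij_betw (\<lambda>xs. (take p xs, drop p xs)) (tuples K (p + q)) (tuples K p \<times> tuples K q)"
  by (rule bij_betwI[where g="\<lambda>(xs, ys). xs @ ys"])
    (auto simp: append_in_tuples take_drop_in_tuples, auto simp: tuples_def)

text \<open>
Both ways in which the contracted indices are appended to the free ones: in the first tensor of a contraction the
tuples \<open>u\<close> and \<open>v\<close> extend the first and the second group, in the second tensor they are exchanged.
\<close>

lemma bij_betw_append_pairs:
  assumes "i \<le> a" "j \<le> b"
  shows "bij_betw (\<lambda>((k, l), (u, v)). (k @ u, l @ v))
           (index_pairs K (a - i) (b - j) \<times> index_pairs K i j) (index_pairs K a b)"
    and "bij_betw (\<lambda>((k, l), (u, v)). (k @ v, l @ u))
           (index_pairs K (a - i) (b - j) \<times> index_pairs K j i) (index_pairs K a b)"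
proof -
  have a: "a = (a - i) + i" and b: "b = (b - j) + j" using assms by auto
  show "bij_betw (\<lambda>((k, l), (u, v)). (k @ u, l @ v))
           (index_pairs K (a - i) (b - j) \<times> index_pairs K i j) (index_pairs K a b)"
    by (rule bij_betwI[where
          g="\<lambda>(x, y). ((take (a - i) x, take (b - j) y), (drop (a - i) x, drop (b - j) y))"])
      (use assms in \<open>auto simp: tuples_def dest: in_set_takeD in_set_dropD\<close>)
  show "bij_betw (\<lambda>((k, l), (u, v)). (k @ v, l @ u))
           (index_pairs K (a - i) (b - j) \<times> index_pairs K j i) (index_pairs K a b)"
    by (rule bij_betwI[where
          g="\<lambda>(x, y). ((take (a - i) x, take (b - j) y), (drop (b - j) y, drop (a - i) x))"])
      (use assms in \<open>auto simp: tuples_def dest: in_set_takeD in_set_dropD\<close>)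
qed

lemma bij_betw_split_pairs:
  "bij_betw (\<lambda>(x, y). ((take p x, take q y), (drop p x, drop q y)))
     (index_pairs K (p + p') (q + q')) (index_pairs K p q \<times> index_pairs K p' q')"
  by (rule bij_betwI[where g="\<lambda>((k, l), (k', l')). (k @ k', l @ l')"])
    (auto simp: tuples_def dest: in_set_takeD in_set_dropD)

context
  fixes K :: "'k set" and a b c d i j :: nat
  assumes ij: "i \<le> a" "i \<le> d" "j \<le> b" "j \<le> c"
begin

lemma contraction_sections:
  assumes "f \<in> tensor_space K a b" "g \<in> tensor_space K c d"
  shows "square_summable (index_pairs K (a - i) (b - j) \<times> index_pairs K i j)
           (\<lambda>((k, l), (u, v)). f (k @ u) (l @ v))"
    and "square_summable (index_pairs K (c - j) (d - i) \<times> index_pairs K i j)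
           (\<lambda>((k, l), (u, v)). g (k @ v) (l @ u))"
    and "l2_norm (index_pairs K (a - i) (b - j) \<times> index_pairs K i j)
           (\<lambda>((k, l), (u, v)). f (k @ u) (l @ v)) = tensor_norm K a b f"
    and "l2_norm (index_pairs K (c - j) (d - i) \<times> index_pairs K i j)
           (\<lambda>((k, l), (u, v)). g (k @ v) (l @ u)) = tensor_norm K c d g"
  using l2_reindex_bij[OF bij_betw_append_pairs(1)[OF ij(1,3), of K], of "case_prod f"]
    l2_reindex_bij[OF bij_betw_append_pairs(2)[OF ij(4,2), of K], of "case_prod g"] assms
  by (auto simp: tensor_space_iff tensor_norm_eq_l2_norm case_prod_unfold)

lemma contraction_summable:
  assumes "f \<in> tensor_space K a b" "g \<in> tensor_space K c d"
    and "k \<in> tuples K (a - i)" "l \<in> tuples K (b - j)" "k' \<in> tuples K (c - j)" "l' \<in> tuples K (d - i)"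
  shows "(\<lambda>(u, v). f (k @ u) (l @ v) * g (k' @ v) (l' @ u)) summable_on index_pairs K i j"
proof -
  have "square_summable (index_pairs K i j) (\<lambda>(u, v). f (k @ u) (l @ v))"
    using square_summable_section(1)[OF contraction_sections(1)[OF assms(1,2)], of "(k, l)"] assms
    by (simp add: case_prod_unfold)
  moreover have "square_summable (index_pairs K i j) (\<lambda>(u, v). g (k' @ v) (l' @ u))"
    using square_summable_section(1)[OF contraction_sections(2)[OF assms(1,2)], of "(k', l')"] assms
    by (simp add: case_prod_unfold)
  ultimately show ?thesis
    using abs_summable_summable[OF l2_Cauchy_Schwarz(1)] by (fastforce simp: case_prod_unfold)
qed

text \<open>
After the indices are split into free and contracted ones, a contraction is a composition of Hilbert--Schmidt kernels.
\<close>

lemma contraction_bounded: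
  assumes "f \<in> tensor_space K a b" "g \<in> tensor_space K c d"
  shows "contraction K a b c d i j f g \<in> tensor_space K ((a - i) + (c - j)) ((b - j) + (d - i))"
    and "contraction_norm K a b c d i j f g \<le> tensor_norm K a b f * tensor_norm K c d g"
proof -
  let ?F = "\<lambda>((k, l), (u, v)). f (k @ u) (l @ v)" and ?G = "\<lambda>((k, l), (u, v)). g (k @ v) (l @ u)"
  let ?H = "\<lambda>(p, q). \<Sum>\<^sub>\<infinity>u\<in>index_pairs K i j. ?F (p, u) * ?G (q, u)"
  let ?\<psi> = "\<lambda>(x, y). ((take (a - i) x, take (b - j) y), (drop (a - i) x, drop (b - j) y))"
  let ?S = "index_pairs K ((a - i) + (c - j)) ((b - j) + (d - i))"
  have eq: "case_prod (contraction K a b c d i j f g) x = ?H (?\<psi> x)" if "x \<in> ?S" for x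
    using that by (auto simp: contraction_def case_prod_unfold)
  note H = l2_composition[OF contraction_sections(1,2)[OF assms], unfolded contraction_sections(3,4)[OF assms]]
  note r = l2_reindex_bij[OF bij_betw_split_pairs[of "a - i" "b - j" K "c - j" "d - i"], of ?H]
  have "square_summable ?S (\<lambda>x. ?H (?\<psi> x))"
    by (rule r(1)[THEN iffD2]) (rule H[THEN conjunct1])
  moreover have "square_summable ?S (case_prod (contraction K a b c d i j f g))
      \<longleftrightarrow> square_summable ?S (\<lambda>x. ?H (?\<psi> x))"
    by (rule l2_cong(1)[OF eq])
  ultimately have "square_summable ?S (case_prod (contraction K a b c d i j f g))"
    by (simp only:)
  then show "contraction K a b c d i j f g \<in> tensor_space K ((a - i) + (c - j)) ((b - j) + (d - i))"
    unfolding tensor_space_iff by (auto simp: contraction_def)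
  show "contraction_norm K a b c d i j f g \<le> tensor_norm K a b f * tensor_norm K c d g"
  proof -
    have "contraction_norm K a b c d i j f g = l2_norm ?S (\<lambda>x. ?H (?\<psi> x))"
      unfolding contraction_norm_def tensor_norm_eq_l2_norm[of K "(a - i) + (c - j)"]
      by (rule l2_cong(2)[OF eq])
    also have "\<dots> \<le> tensor_norm K a b f * tensor_norm K c d g"
      unfolding r(2) by (rule H[THEN conjunct2])
    finally show ?thesis .
  qed
qed

lemma contraction_add_left:
  assumes "f \<in> tensor_space K a b" "f' \<in> tensor_space K a b" "g \<in> tensor_space K c d"
  shows "contraction K a b c d i j (\<lambda>ks ls. f ks ls + f' ks ls) g =
         (\<lambda>ks ls. contraction K a b c d i j f g ks ls + contraction K a b c d i j f' g ks ls)"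
proof (intro ext)
  fix ks ls
  show "contraction K a b c d i j (\<lambda>ks ls. f ks ls + f' ks ls) g ks ls =
      contraction K a b c d i j f g ks ls + contraction K a b c d i j f' g ks ls"
  proof (cases "ks \<in> tuples K ((a - i) + (c - j)) \<and> ls \<in> tuples K ((b - j) + (d - i))")
    case True
    then have t: "take (a - i) ks \<in> tuples K (a - i)" "take (b - j) ls \<in> tuples K (b - j)"
      "drop (a - i) ks \<in> tuples K (c - j)" "drop (b - j) ls \<in> tuples K (d - i)"
      by (auto simp: take_drop_in_tuples)
    show ?thesis
      using True contraction_summable[OF assms(1,3) t] contraction_summable[OF assms(2,3) t]
      by (simp add: contraction_def case_prod_unfold distrib_right infsum_add)
  qed (auto simp: contraction_def)
qed

lemma contraction_add_right:
  assumes "f \<in> tensor_space K a b" "g \<in> tensor_space K c d" "g' \<in> tensor_space K c d"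
  shows "contraction K a b c d i j f (\<lambda>ks ls. g ks ls + g' ks ls) =
         (\<lambda>ks ls. contraction K a b c d i j f g ks ls + contraction K a b c d i j f g' ks ls)"
proof (intro ext)
  fix ks ls
  show "contraction K a b c d i j f (\<lambda>ks ls. g ks ls + g' ks ls) ks ls =
      contraction K a b c d i j f g ks ls + contraction K a b c d i j f g' ks ls"
  proof (cases "ks \<in> tuples K ((a - i) + (c - j)) \<and> ls \<in> tuples K ((b - j) + (d - i))")
    case True
    then have t: "take (a - i) ks \<in> tuples K (a - i)" "take (b - j) ls \<in> tuples K (b - j)"
      "drop (a - i) ks \<in> tuples K (c - j)" "drop (b - j) ls \<in> tuples K (d - i)"
      by (auto simp: take_drop_in_tuples)
    show ?thesis
      using True contraction_summable[OF assms(1,2) t] contraction_summable[OF assms(1,3) t]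
      by (simp add: contraction_def case_prod_unfold distrib_left infsum_add)
  qed (auto simp: contraction_def)
qed

end

lemma permute_list_in_tuples:
  assumes "\<sigma> permutes {..<r}"
  shows "permute_list \<sigma> xs \<in> tuples K r \<longleftrightarrow> xs \<in> tuples K r"
  using assms by (cases "length xs = r") (auto simp: tuples_def)

lemma bij_betw_permute_list:
  assumes "\<sigma> permutes {..<r}"
  shows "bij_betw (permute_list \<sigma>) (tuples K r) (tuples K r)"
proof (rule bij_betwI[where g="permute_list (inv \<sigma>)"])
  have "permute_list (inv \<sigma>) (permute_list \<sigma> xs) = xs \<and> permute_list \<sigma> (permute_list (inv \<sigma>) xs) = xs"
    if "length xs = r" for xs :: "'a list"
    using permute_list_compose[of "inv \<sigma>" xs \<sigma>] permute_list_compose[of \<sigma> xs "inv \<sigma>"] that assms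
    by (simp add: permutes_inv permutes_inv_o)
  then show "\<And>x. x \<in> tuples K r \<Longrightarrow> permute_list (inv \<sigma>) (permute_list \<sigma> x) = x"
    "\<And>x. x \<in> tuples K r \<Longrightarrow> permute_list \<sigma> (permute_list (inv \<sigma>) x) = x"
    by (auto simp: tuples_def)
qed (use assms permutes_inv[OF assms] in \<open>auto simp: permute_list_in_tuples\<close>)

text \<open>
Permuting indices is an isometry, and symmetrization is an average of such isometries.
\<close>

lemma symmetrize_bounded:
  assumes "f \<in> tensor_space K a b"
  shows "symmetrize a b f \<in> tensor_space K a b"
    and "tensor_norm K a b (symmetrize a b f) \<le> tensor_norm K a b f"
proof -
  let ?I = "{\<sigma>. \<sigma> permutes {..<a}} \<times> {\<tau>. \<tau> permutes {..<b}}"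
  let ?g = "\<lambda>(\<sigma>, \<tau>) (ks, ls). f (permute_list \<sigma> ks) (permute_list \<tau> ls)"
  have I: "finite ?I" "card ?I = fact a * fact b"
    by (auto simp: finite_permutations card_permutations)
  have g: "square_summable (index_pairs K a b) (?g x)" "l2_norm (index_pairs K a b) (?g x) = tensor_norm K a b f"
    if x': "x \<in> ?I" for x
  proof -
    obtain \<sigma> \<tau> where x: "x = (\<sigma>, \<tau>)" "\<sigma> permutes {..<a}" "\<tau> permutes {..<b}" using x' by auto
    have "bij_betw (map_prod (permute_list \<sigma>) (permute_list \<tau>)) (index_pairs K a b) (index_pairs K a b)"
      by (rule bij_betw_map_prod) (simp_all add: bij_betw_permute_list x)
    from l2_reindex_bij[OF this, of "case_prod f"] assms
    show "square_summable (index_pairs K a b) (?g x)" "l2_norm (index_pairs K a b) (?g x) = tensor_norm K a b f"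
      by (auto simp: x tensor_space_iff tensor_norm_eq_l2_norm case_prod_unfold)
  qed
  have eq: "case_prod (symmetrize a b f) = (\<lambda>y. (1 / (fact a * fact b)) * (\<Sum>x\<in>?I. ?g x y))"
    by (simp add: fun_eq_iff symmetrize_def sum.cartesian_product case_prod_unfold)
  have s: "square_summable (index_pairs K a b) (\<lambda>y. \<Sum>x\<in>?I. ?g x y) \<and>
      l2_norm (index_pairs K a b) (\<lambda>y. \<Sum>x\<in>?I. ?g x y) \<le> (\<Sum>x\<in>?I. l2_norm (index_pairs K a b) (?g x))"
    by (rule l2_sum) (use I g in auto)
  have "(\<Sum>x\<in>?I. l2_norm (index_pairs K a b) (?g x)) = fact a * fact b * tensor_norm K a b f"
    by (simp add: g I)
  with s have s: "square_summable (index_pairs K a b) (\<lambda>y. \<Sum>x\<in>?I. ?g x y)"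
      "l2_norm (index_pairs K a b) (\<lambda>y. \<Sum>x\<in>?I. ?g x y) \<le> fact a * fact b * tensor_norm K a b f" by auto
  let ?c = "1 / (fact a * fact b) :: complex"
  have c: "cmod ?c = 1 / (fact a * fact b)" by (simp add: norm_divide norm_mult)
  have "cmod ?c * l2_norm (index_pairs K a b) (\<lambda>y. \<Sum>x\<in>?I. ?g x y)
      \<le> cmod ?c * (fact a * fact b * tensor_norm K a b f)"
    by (rule mult_left_mono[OF s(2)]) simp
  also have "\<dots> = tensor_norm K a b f" by (simp add: c)
  finally have "square_summable (index_pairs K a b) (case_prod (symmetrize a b f)) \<and>
      l2_norm (index_pairs K a b) (case_prod (symmetrize a b f)) \<le> tensor_norm K a b f"
    unfolding eq using l2_scale[OF s(1), of ?c] by (metis (no_types, lifting))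
  then show "symmetrize a b f \<in> tensor_space K a b"
    "tensor_norm K a b (symmetrize a b f) \<le> tensor_norm K a b f"
    using assms
    by (auto simp: tensor_space_iff tensor_norm_eq_l2_norm symmetrize_def permute_list_in_tuples intro!: sum.neutral)
qed

lemma symmetrize_add:
  "symmetrize a b (\<lambda>ks ls. f ks ls + g ks ls) = (\<lambda>ks ls. symmetrize a b f ks ls + symmetrize a b g ks ls)"
  by (simp add: symmetrize_def fun_eq_iff sum.distrib add_divide_distrib)

section \<open>Truncation to finitely many basis indices\<close>

definition restrict_tensor :: "'k set \<Rightarrow> 'k tensor \<Rightarrow> 'k tensor" where
  "restrict_tensor L f = (\<lambda>ks ls. if set ks \<subseteq> L \<and> set ls \<subseteq> L then f ks ls else 0)"

lemma tensor_norm_mono: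
  assumes "g \<in> tensor_space K a b" "\<And>ks ls. cmod (f ks ls) \<le> cmod (g ks ls)"
  shows "f \<in> tensor_space K a b" "tensor_norm K a b f \<le> tensor_norm K a b g"
proof -
  have "f ks ls = 0" if "g ks ls = 0" for ks ls
    using assms(2)[of ks ls] that by simp
  then show "f \<in> tensor_space K a b" "tensor_norm K a b f \<le> tensor_norm K a b g"
    using l2_mono[of "index_pairs K a b" "case_prod g" "case_prod f"] assms
    by (auto simp: tensor_space_iff tensor_norm_eq_l2_norm)
qed

text \<open>
A finite set of index pairs that carries most of the norm involves only finitely many basis indices.
\<close>

lemma restrict_tensor_remainder_tendsto:
  assumes f: "f \<in> tensor_space K a b"
  shows "((\<lambda>L. tensor_norm K a b (\<lambda>ks ls. f ks ls - restrict_tensor L f ks ls)) \<longlongrightarrow> 0)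
           (finite_subsets_at_top K)"
proof (rule tendstoI)
  fix \<epsilon> :: real assume \<epsilon>: "\<epsilon> > 0"
  let ?S = "index_pairs K a b"
  have sq: "square_summable ?S (case_prod f)" using f by (simp add: tensor_space_iff)
  have "eventually (\<lambda>A. l2_norm ?S (\<lambda>x. if x \<in> A then 0 else case_prod f x) < \<epsilon>) (finite_subsets_at_top ?S)"
    using l2_restriction_tendsto[OF sq] \<epsilon> by (auto dest: order_tendstoD(2))
  then obtain A where A: "finite A" "A \<subseteq> ?S"
    and lt: "l2_norm ?S (\<lambda>x. if x \<in> A then 0 else case_prod f x) < \<epsilon>"
    unfolding eventually_finite_subsets_at_top by blast
  \<comment> \<open>All indices that occur in \<open>A\<close>.\<close>
  define L0 where "L0 = (\<Union>(ks, ls)\<in>A. set ks \<union> set ls)"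
  have L0: "finite L0" "L0 \<subseteq> K" using A by (auto simp: L0_def tuples_def)
  have "tensor_norm K a b (\<lambda>ks ls. f ks ls - restrict_tensor L f ks ls) < \<epsilon>" if "L0 \<subseteq> L" for L
  proof -
    have "square_summable ?S (\<lambda>x. if x \<in> A then 0 else case_prod f x)"
      using l2_mono[OF sq, of "\<lambda>x. if x \<in> A then 0 else case_prod f x"] by auto
    moreover have "cmod (case_prod (\<lambda>ks ls. f ks ls - restrict_tensor L f ks ls) x)
        \<le> cmod (if x \<in> A then 0 else case_prod f x)" for x
      using that by (cases x) (fastforce simp: restrict_tensor_def L0_def)
    ultimately have "l2_norm ?S (case_prod (\<lambda>ks ls. f ks ls - restrict_tensor L f ks ls))
        \<le> l2_norm ?S (\<lambda>x. if x \<in> A then 0 else case_prod f x)"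
      by (intro l2_mono[THEN conjunct2])
    with lt show ?thesis by (simp add: tensor_norm_eq_l2_norm)
  qed
  then show "eventually (\<lambda>L. dist (tensor_norm K a b (\<lambda>ks ls. f ks ls - restrict_tensor L f ks ls)) 0 < \<epsilon>)
      (finite_subsets_at_top K)"
    unfolding eventually_finite_subsets_at_top using L0 by (auto intro!: exI[of _ L0])
qed

lemma tensor_norm_reverse_triangle:
  assumes "A \<in> tensor_space K a b" "B \<in> tensor_space K a b" "R \<in> tensor_space K a b"
    and "A = (\<lambda>ks ls. B ks ls + R ks ls)"
  shows "\<bar>tensor_norm K a b A - tensor_norm K a b B\<bar> \<le> tensor_norm K a b R"
proof -
  have B: "B = (\<lambda>ks ls. A ks ls + (- 1) * R ks ls)" using assms(4) by (simp add: fun_eq_iff)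
  have "tensor_norm K a b A \<le> tensor_norm K a b B + tensor_norm K a b R"
    using tensor_add(2)[OF assms(2,3)] assms(4) by simp
  moreover have "tensor_norm K a b B \<le> tensor_norm K a b A + tensor_norm K a b R"
    using tensor_add(2)[OF assms(1) tensor_scale(1)[OF assms(3), of "- 1"]]
      tensor_scale(2)[OF assms(3), of "- 1"] B by simp
  ultimately show ?thesis by simp
qed

text \<open>
The difference of the two contractions is a sum of two contractions in which one factor is a remainder, so
bilinearity and submultiplicativity suffice.
\<close>

lemma contraction_norm_restrict_tendsto:
  assumes ij: "i \<le> a" "i \<le> d" "j \<le> b" "j \<le> c"
    and f: "f \<in> tensor_space K a b" and g: "g \<in> tensor_space K c d"
  shows "((\<lambda>L. contraction_norm K a b c d i j (restrict_tensor L f) (restrict_tensor L g))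
            \<longlongrightarrow> contraction_norm K a b c d i j f g) (finite_subsets_at_top K)"
    and "((\<lambda>L. sym_contraction_norm K a b c d i j (restrict_tensor L f) (restrict_tensor L g))
            \<longlongrightarrow> sym_contraction_norm K a b c d i j f g) (finite_subsets_at_top K)"
proof -
  define p where "p = (a - i) + (c - j)"
  define q where "q = (b - j) + (d - i)"
  let ?C = "contraction K a b c d i j"
  define rf where "rf = (\<lambda>L ks ls. f ks ls - restrict_tensor L f ks ls)"
  define rg where "rg = (\<lambda>L ks ls. g ks ls - restrict_tensor L g ks ls)"
  define R where "R = (\<lambda>L ks ls. ?C (restrict_tensor L f) (rg L) ks ls + ?C (rf L) g ks ls)"
  define \<epsilon> where "\<epsilon> = (\<lambda>L. tensor_norm K a b f * tensor_norm K c d (rg L) +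
                            tensor_norm K a b (rf L) * tensor_norm K c d g)"
  have tf: "restrict_tensor L f \<in> tensor_space K a b" "tensor_norm K a b (restrict_tensor L f) \<le> tensor_norm K a b f"
    and rf: "rf L \<in> tensor_space K a b" for L
    using tensor_norm_mono[OF f, of "restrict_tensor L f"] tensor_norm_mono[OF f, of "rf L"]
    by (auto simp: restrict_tensor_def rf_def)
  have tg: "restrict_tensor L g \<in> tensor_space K c d" and rg: "rg L \<in> tensor_space K c d" for L
    using tensor_norm_mono[OF g, of "restrict_tensor L g"] tensor_norm_mono[OF g, of "rg L"]
    by (auto simp: restrict_tensor_def rg_def)
  note bd = contraction_bounded[OF ij, folded p_def q_def]
  note bd2 = bd(2)[unfolded contraction_norm_def, folded p_def q_def]
  have R: "R L \<in> tensor_space K p q" "tensor_norm K p q (R L) \<le> \<epsilon> L" for L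
  proof -
    show "R L \<in> tensor_space K p q"
      unfolding R_def by (intro tensor_add bd tf rg rf g)
    have "tensor_norm K p q (R L) \<le> tensor_norm K p q (?C (restrict_tensor L f) (rg L)) + tensor_norm K p q (?C (rf L) g)"
      unfolding R_def by (intro tensor_add bd tf rg rf g)
    also have "\<dots> \<le> tensor_norm K a b (restrict_tensor L f) * tensor_norm K c d (rg L) + tensor_norm K a b (rf L) * tensor_norm K c d g"
      by (intro add_mono bd2 tf rg rf g)
    also have "\<dots> \<le> \<epsilon> L"
      unfolding \<epsilon>_def by (intro add_mono mult_right_mono tf) auto
    finally show "tensor_norm K p q (R L) \<le> \<epsilon> L" .
  qed
  have split: "?C f g = (\<lambda>ks ls. ?C (restrict_tensor L f) (restrict_tensor L g) ks ls + R L ks ls)" for L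
  proof -
    have "f = (\<lambda>ks ls. restrict_tensor L f ks ls + rf L ks ls)" by (simp add: rf_def)
    then have "?C f g = (\<lambda>ks ls. ?C (restrict_tensor L f) g ks ls + ?C (rf L) g ks ls)"
      using contraction_add_left[OF ij tf(1)[of L] rf[of L] g] by simp
    moreover have "g = (\<lambda>ks ls. restrict_tensor L g ks ls + rg L ks ls)" by (simp add: rg_def)
    then have "?C (restrict_tensor L f) g =
        (\<lambda>ks ls. ?C (restrict_tensor L f) (restrict_tensor L g) ks ls + ?C (restrict_tensor L f) (rg L) ks ls)"
      using contraction_add_right[OF ij tf(1)[of L] tg[of L] rg[of L]] by simp
    ultimately show ?thesis by (simp add: R_def add.assoc)
  qed
  have "(\<epsilon> \<longlongrightarrow> tensor_norm K a b f * 0 + 0 * tensor_norm K c d g) (finite_subsets_at_top K)"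
    unfolding \<epsilon>_def rf_def rg_def
    by (intro tendsto_intros restrict_tensor_remainder_tendsto f g)
  then have \<epsilon>: "(\<epsilon> \<longlongrightarrow> 0) (finite_subsets_at_top K)" by simp
  have lim: "(N \<longlongrightarrow> N0) (finite_subsets_at_top K)" if "\<And>L. \<bar>N0 - N L\<bar> \<le> \<epsilon> L" for N N0
    by (rule LIM_zero_cancel, rule Lim_null_comparison[OF _ \<epsilon>]) (use that in \<open>auto simp: abs_minus_commute\<close>)
  show "((\<lambda>L. contraction_norm K a b c d i j (restrict_tensor L f) (restrict_tensor L g))
            \<longlongrightarrow> contraction_norm K a b c d i j f g) (finite_subsets_at_top K)"
  proof (rule lim)
    fix L
    show "\<bar>contraction_norm K a b c d i j f g -
        contraction_norm K a b c d i j (restrict_tensor L f) (restrict_tensor L g)\<bar> \<le> \<epsilon> L"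
      using tensor_norm_reverse_triangle[OF bd(1)[OF f g] bd(1)[OF tf(1)[of L] tg[of L]] R(1)[of L] split[of L]] R(2)[of L]
      by (simp add: contraction_norm_def p_def q_def)
  qed
  show "((\<lambda>L. sym_contraction_norm K a b c d i j (restrict_tensor L f) (restrict_tensor L g))
            \<longlongrightarrow> sym_contraction_norm K a b c d i j f g) (finite_subsets_at_top K)"
  proof (rule lim)
    fix L
    have "symmetrize p q (?C f g) = (\<lambda>ks ls. symmetrize p q (?C (restrict_tensor L f) (restrict_tensor L g)) ks ls
        + symmetrize p q (R L) ks ls)"
      by (subst split[of L]) (rule symmetrize_add)
    from tensor_norm_reverse_triangle[OF symmetrize_bounded(1)[OF bd(1)[OF f g]]
        symmetrize_bounded(1)[OF bd(1)[OF tf(1)[of L] tg[of L]]] symmetrize_bounded(1)[OF R(1)[of L]] this]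
      symmetrize_bounded(2)[OF R(1)[of L]] R(2)[of L]
    show "\<bar>sym_contraction_norm K a b c d i j f g -
        sym_contraction_norm K a b c d i j (restrict_tensor L f) (restrict_tensor L g)\<bar> \<le> \<epsilon> L"
      by (simp add: sym_contraction_norm_def sym_contraction_def p_def q_def)
  qed
qed

text \<open>
For truncated tensors the whole computation takes place over the finite index set, which is where the algebraic
identity is available.
\<close>

lemma contraction_restrict:
  assumes "L \<subseteq> K"
  shows "contraction K a b c d i j (restrict_tensor L f) (restrict_tensor L g) =
         contraction L a b c d i j (restrict_tensor L f) (restrict_tensor L g)"
proof (intro ext)
  fix ks ls
  let ?p = "(a - i) + (c - j)" and ?q = "(b - j) + (d - i)"
  let ?t = "\<lambda>u v. restrict_tensor L f (take (a - i) ks @ u) (take (b - j) ls @ v) *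
            restrict_tensor L g (drop (a - i) ks @ v) (drop (b - j) ls @ u)"
  have sub: "set ks \<subseteq> L \<and> set ls \<subseteq> L \<and> set u \<subseteq> L \<and> set v \<subseteq> L" if "?t u v \<noteq> 0" for u v
  proof -
    have "set (take (a - i) ks @ drop (a - i) ks) \<subseteq> L" "set (take (b - j) ls @ drop (b - j) ls) \<subseteq> L"
      "set u \<subseteq> L" "set v \<subseteq> L"
      using that by (auto simp: restrict_tensor_def split: if_splits simp del: append_take_drop_id)
    then show ?thesis by simp
  qed
  show "contraction K a b c d i j (restrict_tensor L f) (restrict_tensor L g) ks ls =
         contraction L a b c d i j (restrict_tensor L f) (restrict_tensor L g) ks ls"
  proof (cases "ks \<in> tuples L ?p \<and> ls \<in> tuples L ?q")
    case True
    then have "ks \<in> tuples K ?p \<and> ls \<in> tuples K ?q" using assms by (auto simp: tuples_def)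
    moreover have "(\<Sum>\<^sub>\<infinity>(u, v)\<in>index_pairs K i j. ?t u v) = (\<Sum>\<^sub>\<infinity>(u, v)\<in>index_pairs L i j. ?t u v)"
    proof (rule infsum_cong_neutral)
      fix x assume x: "x \<in> index_pairs K i j - index_pairs L i j"
      obtain u v where uv: "x = (u, v)" by (cases x)
      have "\<not> (set u \<subseteq> L \<and> set v \<subseteq> L)" using x uv by (auto simp: tuples_def)
      then show "(case x of (u, v) \<Rightarrow> ?t u v) = 0" using sub[of u v] uv by auto
    qed (use assms in \<open>auto simp: tuples_def\<close>)
    ultimately show ?thesis using True by (simp add: contraction_def)
  next
    case False
    have "?t u v = 0" if "ks \<in> tuples K ?p \<and> ls \<in> tuples K ?q" for u v
      using sub[of u v] False that by (auto simp: tuples_def)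
    then have "contraction K a b c d i j (restrict_tensor L f) (restrict_tensor L g) ks ls = 0"
      unfolding contraction_def by (auto simp: case_prod_unfold intro!: infsum_0)
    then show ?thesis using False by (auto simp: contraction_def)
  qed
qed

lemma tensor_norm_subset:
  assumes "L \<subseteq> K" "\<And>ks ls. ks \<notin> tuples L a \<or> ls \<notin> tuples L b \<Longrightarrow> f ks ls = 0"
  shows "tensor_norm K a b f = tensor_norm L a b f"
  unfolding tensor_norm_def
proof (rule arg_cong[of _ _ sqrt], rule infsum_cong_neutral)
  fix x assume x: "x \<in> index_pairs K a b - index_pairs L a b"
  then show "(case x of (ks, ls) \<Rightarrow> (cmod (f ks ls))\<^sup>2) = 0"
    using assms(2)[of "fst x" "snd x"] by (cases x) auto
qed (use assms in \<open>auto simp: tuples_def\<close>)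

lemma contraction_norm_restrict:
  assumes "L \<subseteq> K"
  shows "contraction_norm K a b c d i j (restrict_tensor L f) (restrict_tensor L g) =
         contraction_norm L a b c d i j (restrict_tensor L f) (restrict_tensor L g)"
    and "sym_contraction_norm K a b c d i j (restrict_tensor L f) (restrict_tensor L g) =
         sym_contraction_norm L a b c d i j (restrict_tensor L f) (restrict_tensor L g)"
  unfolding contraction_norm_def sym_contraction_norm_def sym_contraction_def contraction_restrict[OF assms]
  by (rule tensor_norm_subset[OF assms], auto simp: contraction_def)
    (rule tensor_norm_subset[OF assms],
      auto simp: symmetrize_def permute_list_in_tuples contraction_def intro!: sum.neutral)

lemma restrict_tensor_sym:
  assumes "L \<subseteq> K" "finite L" "f \<in> sym_tensor_space K a b"
  shows "restrict_tensor L f \<in> sym_tensor_space L a b"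
    and "restrict_tensor L f \<in> sym_tensor_space K a b"
proof -
  have K: "f \<in> tensor_space K a b" using assms by (simp add: sym_tensor_space_def)
  have *: "restrict_tensor L f (permute_list \<sigma> ks) (permute_list \<tau> ls) = restrict_tensor L f ks ls"
    if "\<sigma> permutes {..<a}" "\<tau> permutes {..<b}" "ks \<in> tuples K a" "ls \<in> tuples K b" for \<sigma> \<tau> ks ls
    using that assms(3) by (auto simp: restrict_tensor_def sym_tensor_space_def tuples_def)
  have fin: "finite (tuples L r)" for r
    using finite_lists_length_eq[OF assms(2), of r] by (simp add: tuples_def)
  have "restrict_tensor L f ks ls = 0" if "ks \<notin> tuples L a \<or> ls \<notin> tuples L b" for ks ls
    using that K by (auto simp: restrict_tensor_def tensor_space_def tuples_def)
  then have "restrict_tensor L f \<in> tensor_space L a b"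
    by (simp add: tensor_space_iff square_summable_finite fin)
  then show "restrict_tensor L f \<in> sym_tensor_space L a b"
    unfolding sym_tensor_space_def using * assms(1) by (fastforce simp: tuples_def)
  show "restrict_tensor L f \<in> sym_tensor_space K a b"
    unfolding sym_tensor_space_def using * tensor_norm_mono(1)[OF K, of "restrict_tensor L f"]
    by (auto simp: restrict_tensor_def)
qed

section \<open>Polarization of symmetric tensors\<close>

text \<open>
The tensor power in terms of coordinates alone; \<^const>\<open>power_tensor\<close> is the case in which \<open>x\<close> is the coordinate
family of a vector.
\<close>

definition pow_tensor :: "'k set \<Rightarrow> nat \<Rightarrow> nat \<Rightarrow> ('k \<Rightarrow> complex) \<Rightarrow> 'k tensor" where
  "pow_tensor K m n x = (\<lambda>ks ls.
     if ks \<in> tuples K m \<and> ls \<in> tuples K n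
     then (\<Prod>k\<leftarrow>ks. x k) * (\<Prod>l\<leftarrow>ls. cnj (x l)) else 0)"

lemma finite_tuples: "finite K \<Longrightarrow> finite (tuples K r)"
  using finite_lists_length_eq[of K r] by (simp add: tuples_def)

definition unity_root :: "nat \<Rightarrow> nat \<Rightarrow> complex" where
  "unity_root N s = cis (2 * pi * (real s / real N))"

text \<open>
Exponents are only compared modulo \<open>N\<close> by the sum; the bounds turn the congruence into equality.
\<close>

lemma unity_root_orthogonality:
  assumes "u < N" "v < N"
  shows "(\<Sum>s<N. unity_root N s ^ u * cnj (unity_root N s) ^ v) = (if u = v then of_nat N else 0)"
proof -
  define d where "d = real_of_int (int u - int v)"
  define z where "z = cis (2 * pi * (d / real N))"
  have N: "N > 0" using assms by simp
  have "unity_root N s ^ u * cnj (unity_root N s) ^ v = z ^ s" for s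
  proof -
    define \<theta> where "\<theta> = 2 * pi * (real s / real N)"
    have "unity_root N s ^ u * cnj (unity_root N s) ^ v = cis (real u * \<theta> + real v * (- \<theta>))"
      by (simp only: unity_root_def \<theta>_def[symmetric] cis_cnj Complex.DeMoivre cis_mult)
    also have "real u * \<theta> + real v * (- \<theta>) = real s * (2 * pi * (d / real N))"
      by (simp add: \<theta>_def d_def algebra_simps diff_divide_distrib)
    also have "cis \<dots> = z ^ s" by (simp only: z_def Complex.DeMoivre)
    finally show ?thesis .
  qed
  then have eq: "(\<Sum>s<N. unity_root N s ^ u * cnj (unity_root N s) ^ v) = (\<Sum>s<N. z ^ s)" by simp
  show ?thesis
  proof (cases "u = v")
    case True
    then show ?thesis using eq by (simp add: z_def d_def)
  next
    case False
    have "z \<noteq> 1"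
    proof
      assume "z = 1"
      then have "cos (2 * pi * (d / real N)) = 1" by (simp add: z_def complex_eq_iff)
      then obtain k :: int where "2 * pi * (d / real N) = of_int k * 2 * pi"
        using cos_one_2pi_int by blast
      then have "d = of_int k * real N" using N by (simp add: field_simps)
      then have k: "int u - int v = k * int N" unfolding d_def by (metis of_int_eq_iff of_int_mult of_int_of_nat_eq)
      then have "k \<noteq> 0" using False by auto
      then have "1 \<le> \<bar>k\<bar>" by simp
      from mult_right_mono[OF this, of "int N"] have "int N \<le> \<bar>k * int N\<bar>" by (simp add: abs_mult)
      then show False using k assms by linarith
    qed
    moreover have "z ^ N = 1"
    proof -
      have "z ^ N = cis (2 * pi * d)" using N by (simp add: z_def Complex.DeMoivre)
      then show ?thesis by (simp add: d_def)
    qed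
    ultimately show ?thesis using False eq by (simp add: geometric_sum)
  qed
qed

lemma prod_powers_of_fibres:
  fixes g :: "'b \<Rightarrow> complex"
  assumes "finite A" "finite J" "\<phi> ` A \<subseteq> J"
  shows "(\<Prod>a\<in>A. g (\<phi> a)) = (\<Prod>j\<in>J. g j ^ card {a \<in> A. \<phi> a = j})"
proof -
  have "(\<Prod>a\<in>A. g (\<phi> a)) = (\<Prod>j\<in>J. \<Prod>a\<in>{a \<in> A. \<phi> a = j}. g (\<phi> a))"
    by (rule prod.group[symmetric]) (use assms in auto)
  also have "\<dots> = (\<Prod>j\<in>J. g j ^ card {a \<in> A. \<phi> a = j})"
    by (intro prod.cong) auto
  finally show ?thesis .
qed

text \<open>
Attach an independent root of unity to every position of the list \<open>zs\<close> and superpose the corresponding basis vectors.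
Averaging powers of this vector against suitable characters extracts the multilinear part in which each position of
the first group is used once and each position of the second group is used once with a conjugate.
\<close>

definition polarization_vector :: "nat \<Rightarrow> 'k list \<Rightarrow> (nat \<Rightarrow> nat) \<Rightarrow> 'k \<Rightarrow> complex" where
  "polarization_vector N zs t k = (\<Sum>j<length zs. unity_root N (t j) * of_bool (k = zs ! j))"

definition polarization_weight :: "nat \<Rightarrow> nat \<Rightarrow> nat \<Rightarrow> (nat \<Rightarrow> nat) \<Rightarrow> complex" where
  "polarization_weight N m n t =
     (\<Prod>j<m+n. if j < m then cnj (unity_root N (t j)) else unity_root N (t j))"

text \<open>
\<open>\<phi>\<close> and \<open>\<psi>\<close> tell which position of a concatenated list is used at each place of the two groups. The admissible
pairs use every position of the first group in the first group and every position of the second in the second.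
\<close>

definition rearrangements :: "nat \<Rightarrow> nat \<Rightarrow> ((nat \<Rightarrow> nat) \<times> (nat \<Rightarrow> nat)) set" where
  "rearrangements m n = {(\<phi>, \<psi>). \<phi> \<in> {..<m} \<rightarrow>\<^sub>E {..<m+n} \<and> \<psi> \<in> {..<n} \<rightarrow>\<^sub>E {..<m+n} \<and>
      bij_betw \<phi> {..<m} {..<m} \<and> bij_betw \<psi> {..<n} {m..<m+n}}"

lemma surjection_with_fibres:
  fixes \<phi> :: "nat \<Rightarrow> nat"
  assumes "finite A" "finite B" "card A = card B" "\<And>j. j \<in> B \<Longrightarrow> card {a \<in> A. \<phi> a = j} \<noteq> 0"
  shows "bij_betw \<phi> A B"
proof -
  have sub: "B \<subseteq> \<phi> ` A"
  proof
    fix j assume "j \<in> B"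
    then have "{a \<in> A. \<phi> a = j} \<noteq> {}" using assms(4)[of j] by (metis card.empty)
    then show "j \<in> \<phi> ` A" by auto
  qed
  have "card (\<phi> ` A) \<le> card B" using card_image_le[OF assms(1), of \<phi>] assms(3) by simp
  then have eq: "\<phi> ` A = B" using sub card_seteq[of "\<phi> ` A" B] assms by (metis finite_imageI)
  then have "inj_on \<phi> A" using assms(1,3) by (simp add: eq_card_imp_inj_on)
  then show ?thesis using eq by (simp add: bij_betw_def)
qed

lemma bij_fibre_card:
  assumes "bij_betw \<phi> A B"
  shows "card {a \<in> A. \<phi> a = j} = (if j \<in> B then 1 else 0)"
proof (cases "j \<in> B")
  case True
  then obtain a where "a \<in> A" "\<phi> a = j" using assms by (auto simp: bij_betw_def)
  then have "{a \<in> A. \<phi> a = j} = {a}" using assms by (auto simp: bij_betw_def inj_on_def)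
  then show ?thesis using True by simp
next
  case False
  then have "{a \<in> A. \<phi> a = j} = {}" using assms by (auto simp: bij_betw_def)
  then show ?thesis using False by (metis card.empty)
qed

text \<open>
The average over the root at position \<open>j\<close> vanishes unless position \<open>j\<close> occurs once more unconjugated than conjugated
(or the other way around, for the second group). There are as many places as positions, so then every position occurs
exactly once, in its own group.
\<close>

lemma polarization_character_sum:
  assumes N: "N = m + n + 2"
    and \<phi>: "\<phi> \<in> {..<m} \<rightarrow>\<^sub>E {..<m+n}" and \<psi>: "\<psi> \<in> {..<n} \<rightarrow>\<^sub>E {..<m+n}"
  shows "(\<Sum>t\<in>{..<m+n} \<rightarrow>\<^sub>E {..<N}. polarization_weight N m n t *
            ((\<Prod>a<m. unity_root N (t (\<phi> a))) * (\<Prod>b<n. cnj (unity_root N (t (\<psi> b)))))) =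
         (if (\<phi>, \<psi>) \<in> rearrangements m n then of_nat N ^ (m + n) else 0)"
proof -
  define p where "p = (\<lambda>j. card {a \<in> {..<m}. \<phi> a = j})"
  define q where "q = (\<lambda>j. card {b \<in> {..<n}. \<psi> b = j})"
  define G where "G = (\<lambda>j s. (if j < m then cnj (unity_root N s) else unity_root N s) *
      (unity_root N s ^ p j * cnj (unity_root N s) ^ q j))"
  have im: "\<phi> ` {..<m} \<subseteq> {..<m+n}" "\<psi> ` {..<n} \<subseteq> {..<m+n}" using \<phi> \<psi> by (auto simp: PiE_def Pi_def)
  have "polarization_weight N m n t * ((\<Prod>a<m. unity_root N (t (\<phi> a))) * (\<Prod>b<n. cnj (unity_root N (t (\<psi> b)))))
      = (\<Prod>j<m+n. G j (t j))" for t
    using prod_powers_of_fibres[of "{..<m}" "{..<m+n}" \<phi> "\<lambda>j. unity_root N (t j)"]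
      prod_powers_of_fibres[of "{..<n}" "{..<m+n}" \<psi> "\<lambda>j. cnj (unity_root N (t j))"] im
    by (simp add: polarization_weight_def G_def p_def q_def prod.distrib)
  then have "(\<Sum>t\<in>{..<m+n} \<rightarrow>\<^sub>E {..<N}. polarization_weight N m n t *
            ((\<Prod>a<m. unity_root N (t (\<phi> a))) * (\<Prod>b<n. cnj (unity_root N (t (\<psi> b))))))
      = (\<Prod>j<m+n. \<Sum>s<N. G j s)"
    by (simp add: prod_sum_PiE)
  also have "\<dots> = (\<Prod>j<m+n. if (if j < m then p j = q j + 1 else p j + 1 = q j) then of_nat N else 0)"
  proof (intro prod.cong refl)
    fix j
    have pq: "p j \<le> m" "q j \<le> n"
      using card_mono[of "{..<m}" "{a \<in> {..<m}. \<phi> a = j}"] card_mono[of "{..<n}" "{b \<in> {..<n}. \<psi> b = j}"]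
      by (auto simp: p_def q_def)
    show "(\<Sum>s<N. G j s) = (if (if j < m then p j = q j + 1 else p j + 1 = q j) then of_nat N else 0)"
    proof (cases "j < m")
      case True
      then have "(\<Sum>s<N. G j s) = (\<Sum>s<N. unity_root N s ^ p j * cnj (unity_root N s) ^ (q j + 1))"
        by (simp add: G_def mult_ac)
      then show ?thesis using unity_root_orthogonality[of "p j" N "q j + 1"] pq True N by simp
    next
      case False
      then have "(\<Sum>s<N. G j s) = (\<Sum>s<N. unity_root N s ^ (p j + 1) * cnj (unity_root N s) ^ q j)"
        by (simp add: G_def mult_ac)
      then show ?thesis using unity_root_orthogonality[of "p j + 1" N "q j"] pq False N by simp
    qed
  qed
  also have "\<dots> = (if (\<forall>j<m+n. if j < m then p j = q j + 1 else p j + 1 = q j) then of_nat N ^ (m + n) else 0)"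
  proof (cases "\<forall>j<m+n. if j < m then p j = q j + 1 else p j + 1 = q j")
    case True
    have *: "(\<Prod>j<m+n. if (if j < m then p j = q j + 1 else p j + 1 = q j) then of_nat N else 0)
      = (\<Prod>j<m+n. of_nat N :: complex)"
    proof (intro prod.cong refl)
      fix j assume "j \<in> {..<m+n}"
      then have "if j < m then p j = q j + 1 else p j + 1 = q j" using True by blast
      then show "(if (if j < m then p j = q j + 1 else p j + 1 = q j) then of_nat N else 0) = (of_nat N :: complex)"
        by (rule if_P)
    qed
    show ?thesis unfolding * if_P[OF True] by simp
  next
    case False
    then obtain j where j: "j < m + n" "\<not> (if j < m then p j = q j + 1 else p j + 1 = q j)" by blast
    have "(\<Prod>j<m+n. if (if j < m then p j = q j + 1 else p j + 1 = q j) then of_nat N else 0) = (0::complex)"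
      by (rule prod_zero) (use j in \<open>auto intro!: bexI[of _ j]\<close>)
    then show ?thesis by (simp only: False if_False)
  qed
  also have "(\<forall>j<m+n. if j < m then p j = q j + 1 else p j + 1 = q j) \<longleftrightarrow> (\<phi>, \<psi>) \<in> rearrangements m n"
  proof
    assume *: "\<forall>j<m+n. if j < m then p j = q j + 1 else p j + 1 = q j"
    have "bij_betw \<phi> {..<m} {..<m}"
    proof (rule surjection_with_fibres)
      fix j assume "j \<in> {..<m}"
      then have "p j = q j + 1" using *[rule_format, of j] by simp
      then show "card {a \<in> {..<m}. \<phi> a = j} \<noteq> 0" unfolding p_def by linarith
    qed auto
    moreover have "bij_betw \<psi> {..<n} {m..<m+n}"
    proof (rule surjection_with_fibres)
      fix j assume "j \<in> {m..<m+n}"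
      then have "p j + 1 = q j" using *[rule_format, of j] by simp
      then show "card {b \<in> {..<n}. \<psi> b = j} \<noteq> 0" unfolding q_def by linarith
    qed auto
    ultimately show "(\<phi>, \<psi>) \<in> rearrangements m n" using \<phi> \<psi> by (simp add: rearrangements_def)
  next
    assume "(\<phi>, \<psi>) \<in> rearrangements m n"
    then have "bij_betw \<phi> {..<m} {..<m}" "bij_betw \<psi> {..<n} {m..<m+n}" by (auto simp: rearrangements_def)
    from this[THEN bij_fibre_card]
    show "\<forall>j<m+n. if j < m then p j = q j + 1 else p j + 1 = q j"
      by (auto simp: p_def q_def)
  qed
  finally show ?thesis .
qed

abbreviation matches :: "nat \<Rightarrow> 'k list \<Rightarrow> 'k list \<Rightarrow> (nat \<Rightarrow> nat) \<Rightarrow> bool" where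
  "matches r xs zs \<phi> \<equiv> \<forall>a<r. xs ! a = zs ! \<phi> a"

lemma polarization_expansion:
  assumes N: "N = m + n + 2" and ks: "length ks = m" and ls: "length ls = n"
    and Ks: "Ks \<in> tuples K m" and Ls: "Ls \<in> tuples K n"
  shows "(\<Sum>t\<in>{..<m+n} \<rightarrow>\<^sub>E {..<N}. polarization_weight N m n t * pow_tensor K m n (polarization_vector N (ks @ ls) t) Ks Ls) =
    of_nat N ^ (m + n) * (\<Sum>(\<phi>, \<psi>)\<in>rearrangements m n.
       of_bool (matches m Ks (ks @ ls) \<phi> \<and> matches n Ls (ks @ ls) \<psi>))"
proof -
  let ?zs = "ks @ ls" and ?T = "{..<m+n} \<rightarrow>\<^sub>E {..<N}"
  let ?\<Phi> = "{..<m} \<rightarrow>\<^sub>E {..<m+n}" and ?\<Psi> = "{..<n} \<rightarrow>\<^sub>E {..<m+n}"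
  define \<delta> where "\<delta> = (\<lambda>\<phi>. (\<Prod>a<m. of_bool (Ks ! a = ?zs ! \<phi> a)) :: complex)"
  define \<delta>' where "\<delta>' = (\<lambda>\<psi>. (\<Prod>b<n. of_bool (Ls ! b = ?zs ! \<psi> b)) :: complex)"
  have lens: "length Ks = m" "length Ls = n" using Ks Ls by (auto simp: tuples_def)
  have 1: "(\<Prod>k\<leftarrow>Ks. polarization_vector N ?zs t k) = (\<Sum>\<phi>\<in>?\<Phi>. (\<Prod>a<m. unity_root N (t (\<phi> a))) * \<delta> \<phi>)" for t
  proof -
    have "(\<Prod>k\<leftarrow>Ks. polarization_vector N ?zs t k) = (\<Prod>a<m. \<Sum>j<m+n. unity_root N (t j) * of_bool (Ks ! a = ?zs ! j))"
      using lens ks ls by (simp add: prod.list_conv_set_nth polarization_vector_def atLeast0LessThan)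
    also have "\<dots> = (\<Sum>\<phi>\<in>?\<Phi>. \<Prod>a<m. unity_root N (t (\<phi> a)) * of_bool (Ks ! a = ?zs ! \<phi> a))"
      by (rule prod_sum_PiE) auto
    finally show ?thesis by (simp only: prod.distrib \<delta>_def)
  qed
  have 2: "(\<Prod>l\<leftarrow>Ls. cnj (polarization_vector N ?zs t l)) = (\<Sum>\<psi>\<in>?\<Psi>. (\<Prod>b<n. cnj (unity_root N (t (\<psi> b)))) * \<delta>' \<psi>)" for t
  proof -
    have "(\<Prod>l\<leftarrow>Ls. cnj (polarization_vector N ?zs t l)) = (\<Prod>b<n. \<Sum>j<m+n. cnj (unity_root N (t j)) * of_bool (Ls ! b = ?zs ! j))"
      using lens ks ls by (simp add: prod.list_conv_set_nth polarization_vector_def atLeast0LessThan)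
    also have "\<dots> = (\<Sum>\<psi>\<in>?\<Psi>. \<Prod>b<n. cnj (unity_root N (t (\<psi> b))) * of_bool (Ls ! b = ?zs ! \<psi> b))"
      by (rule prod_sum_PiE) auto
    finally show ?thesis by (simp only: prod.distrib \<delta>'_def)
  qed
  have "(\<Sum>t\<in>?T. polarization_weight N m n t * pow_tensor K m n (polarization_vector N ?zs t) Ks Ls) =
      (\<Sum>t\<in>?T. \<Sum>\<phi>\<in>?\<Phi>. \<Sum>\<psi>\<in>?\<Psi>. \<delta> \<phi> * \<delta>' \<psi> * (polarization_weight N m n t *
            ((\<Prod>a<m. unity_root N (t (\<phi> a))) * (\<Prod>b<n. cnj (unity_root N (t (\<psi> b)))))))"
  proof (rule sum.cong[OF refl])
    fix t
    have eq: "pow_tensor K m n (polarization_vector N ?zs t) Ks Ls =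
        (\<Sum>\<phi>\<in>?\<Phi>. (\<Prod>a<m. unity_root N (t (\<phi> a))) * \<delta> \<phi>) *
        (\<Sum>\<psi>\<in>?\<Psi>. (\<Prod>b<n. cnj (unity_root N (t (\<psi> b)))) * \<delta>' \<psi>)"
      using Ks Ls by (simp add: pow_tensor_def 1 2)
    show "polarization_weight N m n t * pow_tensor K m n (polarization_vector N ?zs t) Ks Ls =
        (\<Sum>\<phi>\<in>?\<Phi>. \<Sum>\<psi>\<in>?\<Psi>. \<delta> \<phi> * \<delta>' \<psi> * (polarization_weight N m n t *
            ((\<Prod>a<m. unity_root N (t (\<phi> a))) * (\<Prod>b<n. cnj (unity_root N (t (\<psi> b)))))))"
      by (simp only: eq sum_product, simp only: sum_distrib_left, intro sum.cong refl, simp only: mult_ac)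
  qed
  also have "\<dots> = (\<Sum>\<phi>\<in>?\<Phi>. \<Sum>\<psi>\<in>?\<Psi>. \<Sum>t\<in>?T. \<delta> \<phi> * \<delta>' \<psi> * (polarization_weight N m n t *
            ((\<Prod>a<m. unity_root N (t (\<phi> a))) * (\<Prod>b<n. cnj (unity_root N (t (\<psi> b)))))))"
    by (subst sum.swap, rule sum.cong[OF refl], rule sum.swap)
  also have "\<dots> = (\<Sum>\<phi>\<in>?\<Phi>. \<Sum>\<psi>\<in>?\<Psi>. \<delta> \<phi> * \<delta>' \<psi> * (if (\<phi>, \<psi>) \<in> rearrangements m n then of_nat N ^ (m + n) else 0))"
    by (intro sum.cong refl) (simp only: sum_distrib_left[symmetric] polarization_character_sum[OF N])
  also have "\<dots> = (\<Sum>x\<in>?\<Phi> \<times> ?\<Psi>. if x \<in> rearrangements m n then of_nat N ^ (m + n) * (\<delta> (fst x) * \<delta>' (snd x)) else 0)"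
    by (auto simp: sum.cartesian_product intro!: sum.cong)
  also have "\<dots> = (\<Sum>x\<in>rearrangements m n. of_nat N ^ (m + n) * (\<delta> (fst x) * \<delta>' (snd x)))"
    by (rule sum.mono_neutral_cong_right) (auto simp: rearrangements_def intro!: finite_PiE)
  also have "\<dots> = of_nat N ^ (m + n) * (\<Sum>(\<phi>, \<psi>)\<in>rearrangements m n.
       of_bool (matches m Ks ?zs \<phi> \<and> matches n Ls ?zs \<psi>))"
  proof -
    have "\<delta> \<phi> * \<delta>' \<psi> = of_bool (matches m Ks ?zs \<phi> \<and> matches n Ls ?zs \<psi>)" for \<phi> \<psi>
      by (auto simp: \<delta>_def \<delta>'_def prod_zero_iff)
    then show ?thesis by (simp add: sum_distrib_left case_prod_unfold)
  qed
  finally show ?thesis .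
qed

lemma permutation_matching_unique:
  assumes "\<sigma> permutes {..<r}" "Ks \<in> tuples K r"
  shows "\<exists>ks\<in>tuples K r. \<forall>xs\<in>tuples K r. (\<forall>a<r. Ks ! a = xs ! \<sigma> a) \<longleftrightarrow> xs = ks"
    "ks \<in> tuples K r \<Longrightarrow> (\<forall>a<r. Ks ! a = ks ! \<sigma> a) \<Longrightarrow> Ks = permute_list \<sigma> ks"
proof -
  have len: "length Ks = r" using assms by (simp add: tuples_def)
  show perm: "ks \<in> tuples K r \<Longrightarrow> (\<forall>a<r. Ks ! a = ks ! \<sigma> a) \<Longrightarrow> Ks = permute_list \<sigma> ks" for ks
    using assms len by (intro nth_equalityI) (auto simp: tuples_def permute_list_nth)
  let ?ks = "permute_list (inv \<sigma>) Ks"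
  have iv: "inv \<sigma> permutes {..<r}" using assms by (simp add: permutes_inv)
  have "?ks \<in> tuples K r" using assms iv len by (auto simp: tuples_def)
  moreover have "(\<forall>a<r. Ks ! a = xs ! \<sigma> a) \<longleftrightarrow> xs = ?ks" if xs: "xs \<in> tuples K r" for xs
  proof
    assume "\<forall>a<r. Ks ! a = xs ! \<sigma> a"
    then have "Ks = permute_list \<sigma> xs" using perm xs by blast
    then show "xs = ?ks"
      using permute_list_compose[of "inv \<sigma>" xs \<sigma>] iv xs assms
      by (simp add: tuples_def permutes_inv_o)
  next
    assume "xs = ?ks"
    then show "\<forall>a<r. Ks ! a = xs ! \<sigma> a"
      using iv len assms(1) by (simp add: permute_list_nth permutes_in_image permutes_inverses lessThan_def[symmetric] flip: lessThan_iff)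
  qed
  ultimately show "\<exists>ks\<in>tuples K r. \<forall>xs\<in>tuples K r. (\<forall>a<r. Ks ! a = xs ! \<sigma> a) \<longleftrightarrow> xs = ks" by blast
qed

lemma bij_extends_to_permutation:
  assumes "bij_betw \<phi> {..<r} {..<r}"
  obtains \<sigma> where "\<sigma> permutes {..<r::nat}" "\<And>a. a < r \<Longrightarrow> \<sigma> a = \<phi> a"
proof
  show "(\<lambda>a. if a < r then \<phi> a else a) permutes {..<r}"
  proof (rule bij_imp_permutes)
    show "bij_betw (\<lambda>a. if a < r then \<phi> a else a) {..<r} {..<r}"
      using assms by (subst bij_betw_cong[of _ _ \<phi>]) auto
  qed auto
qed auto

text \<open>
An admissible pair is a pair of permutations, so exactly one pair of tuples matches, and symmetry makes the
coefficient there equal to \<open>f Ks Ls\<close>.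
\<close>

lemma sum_over_matching_indices:
  assumes "finite K" "f \<in> sym_tensor_space K m n" "(\<phi>, \<psi>) \<in> rearrangements m n"
    and Ks: "Ks \<in> tuples K m" and Ls: "Ls \<in> tuples K n"
  shows "(\<Sum>(ks, ls)\<in>tuples K m \<times> tuples K n. f ks ls *
      of_bool (matches m Ks (ks @ ls) \<phi> \<and> matches n Ls (ks @ ls) \<psi>)) = f Ks Ls"
proof -
  have bij: "bij_betw \<phi> {..<m} {..<m}" "bij_betw \<psi> {..<n} {m..<m+n}" using assms by (auto simp: rearrangements_def)
  obtain \<sigma> where \<sigma>: "\<sigma> permutes {..<m}" "\<And>a. a < m \<Longrightarrow> \<sigma> a = \<phi> a"
    using bij_extends_to_permutation[OF bij(1)] by blast
  have "bij_betw (\<lambda>j. j - m) {m..<m+n} {..<n}"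
    by (rule bij_betwI[where g="\<lambda>j. j + m"]) auto
  from bij_betw_trans[OF bij(2) this] obtain \<tau> where
    \<tau>: "\<tau> permutes {..<n}" "\<And>b. b < n \<Longrightarrow> \<tau> b = \<psi> b - m"
    using bij_extends_to_permutation by (metis comp_apply)
  have lt: "\<phi> a < m" if "a < m" for a using bij(1) that by (auto simp: bij_betw_def)
  have ge: "m \<le> \<psi> b" if "b < n" for b using bij(2) that by (force simp: bij_betw_def)
  obtain ks where ks: "ks \<in> tuples K m" "\<And>xs. xs \<in> tuples K m \<Longrightarrow> (\<forall>a<m. Ks ! a = xs ! \<sigma> a) \<longleftrightarrow> xs = ks"
    using permutation_matching_unique(1)[OF \<sigma>(1) Ks] by blast
  obtain ls where ls: "ls \<in> tuples K n" "\<And>xs. xs \<in> tuples K n \<Longrightarrow> (\<forall>a<n. Ls ! a = xs ! \<tau> a) \<longleftrightarrow> xs = ls"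
    using permutation_matching_unique(1)[OF \<tau>(1) Ls] by blast
  have "matches m Ks (ks' @ ls') \<phi> \<and> matches n Ls (ks' @ ls') \<psi> \<longleftrightarrow> ks' = ks \<and> ls' = ls"
    if "ks' \<in> tuples K m" "ls' \<in> tuples K n" for ks' ls'
  proof -
    have "matches m Ks (ks' @ ls') \<phi> \<longleftrightarrow> matches m Ks ks' \<sigma>"
      using that \<sigma>(2) lt by (auto simp: tuples_def nth_append)
    moreover have "matches n Ls (ks' @ ls') \<psi> \<longleftrightarrow> matches n Ls ls' \<tau>"
    proof -
      have "(ks' @ ls') ! \<psi> b = ls' ! \<tau> b" if b: "b < n" for b
        using \<open>ks' \<in> tuples K m\<close> \<tau>(2)[OF b] ge[OF b] by (simp add: tuples_def nth_append)
      then show ?thesis by simp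
    qed
    ultimately show ?thesis using ks(2)[OF that(1)] ls(2)[OF that(2)] by (simp only:)
  qed
  note match = this
  have "(\<Sum>(ks', ls')\<in>tuples K m \<times> tuples K n. f ks' ls' *
      of_bool (matches m Ks (ks' @ ls') \<phi> \<and> matches n Ls (ks' @ ls') \<psi>))
    = (\<Sum>x\<in>tuples K m \<times> tuples K n. if x = (ks, ls) then f ks ls else 0)"
  proof (rule sum.cong[OF refl], clarify)
    fix ks' ls' assume "ks' \<in> tuples K m" "ls' \<in> tuples K n"
    from match[OF this]
    show "f ks' ls' * of_bool (matches m Ks (ks' @ ls') \<phi> \<and> matches n Ls (ks' @ ls') \<psi>)
        = (if (ks', ls') = (ks, ls) then f ks ls else 0)"
      by (simp only: prod.inject) simp
  qed
  also have "\<dots> = f ks ls" using ks(1) ls(1) assms(1) by (simp add: finite_tuples)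
  also have "f ks ls = f (permute_list \<sigma> ks) (permute_list \<tau> ls)"
    using assms(2) ks(1) ls(1) \<sigma>(1) \<tau>(1) by (simp add: sym_tensor_space_def)
  also have "permute_list \<sigma> ks = Ks"
    using permutation_matching_unique(2)[OF \<sigma>(1) Ks ks(1)] ks by blast
  also have "permute_list \<tau> ls = Ls"
    using permutation_matching_unique(2)[OF \<tau>(1) Ls ls(1)] ls by blast
  finally show ?thesis .
qed

text \<open>
Polarization for tensors that are symmetric in two groups of indices. Expanding \<open>f\<close> in elementary tensors and
replacing each of them by its average of powers gives the symmetrization of \<open>f\<close>, which is \<open>f\<close>, up to the number of
admissible rearrangements.
\<close>

theorem sym_tensor_eq_sum_of_powers:
  fixes K :: "'k set"
  assumes K: "finite K" and f: "f \<in> sym_tensor_space K m n"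
  obtains T :: "('k list \<times> 'k list \<times> (nat \<Rightarrow> nat)) set" and c x
  where "finite T" "\<And>\<alpha> k. \<alpha> \<in> T \<Longrightarrow> k \<notin> K \<Longrightarrow> x \<alpha> k = 0"
    "f = (\<lambda>ks ls. \<Sum>\<alpha>\<in>T. c \<alpha> * pow_tensor K m n (x \<alpha>) ks ls)"
proof -
  \<comment> \<open>The exponents to be separated are at most \<open>m + 1\<close> and \<open>n + 1\<close>.\<close>
  define N where "N = m + n + 2"
  let ?T = "{..<m+n} \<rightarrow>\<^sub>E {..<N}"
  let ?S = "tuples K m \<times> tuples K n"
  define C where "C = (of_nat N ^ (m + n) * of_nat (card (rearrangements m n)) :: complex)"
  have fin: "finite (rearrangements m n)"
    by (rule finite_subset[of _ "({..<m} \<rightarrow>\<^sub>E {..<m+n}) \<times> ({..<n} \<rightarrow>\<^sub>E {..<m+n})"])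
      (auto simp: rearrangements_def intro!: finite_PiE)
  have "(restrict id {..<m}, restrict (\<lambda>b. b + m) {..<n}) \<in> rearrangements m n"
  proof -
    have "bij_betw (\<lambda>b. b + m) {..<n} {m..<m+n}"
      by (rule bij_betwI[where g="\<lambda>j. j - m"]) auto
    then show ?thesis by (auto simp: rearrangements_def PiE_def Pi_def)
  qed
  then have "card (rearrangements m n) \<noteq> 0" using fin by auto
  moreover have "of_nat N \<noteq> (0::complex)" by (simp only: of_nat_eq_0_iff N_def)
  ultimately have C: "C \<noteq> 0" by (simp add: C_def)
  let ?c = "\<lambda>(ks, ls, t). f ks ls * polarization_weight N m n t / C"
  let ?x = "\<lambda>(ks, ls, t). polarization_vector N (ks @ ls) t"
  show thesis
  proof (rule that[of "tuples K m \<times> tuples K n \<times> ?T" ?x ?c])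
    show "finite (tuples K m \<times> tuples K n \<times> ?T)"
      using K by (auto intro!: finite_cartesian_product finite_PiE simp: finite_tuples)
    show "?x \<alpha> k = 0" if \<alpha>: "\<alpha> \<in> tuples K m \<times> tuples K n \<times> ?T" and k: "k \<notin> K" for \<alpha> k
    proof -
      obtain ks ls t where \<alpha>': "\<alpha> = (ks, ls, t)" by (cases \<alpha>)
      have "set (ks @ ls) \<subseteq> K" using \<alpha> \<alpha>' by (auto simp: tuples_def)
      then have "k \<noteq> (ks @ ls) ! j" if "j < length (ks @ ls)" for j
        using nth_mem[OF that] k by blast
      then show ?thesis by (auto simp: \<alpha>' polarization_vector_def intro!: sum.neutral)
    qed
    show "f = (\<lambda>Ks Ls. \<Sum>\<alpha>\<in>tuples K m \<times> tuples K n \<times> ?T. ?c \<alpha> * pow_tensor K m n (?x \<alpha>) Ks Ls)"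
    proof (intro ext)
      fix Ks Ls
      show "f Ks Ls = (\<Sum>\<alpha>\<in>tuples K m \<times> tuples K n \<times> ?T. ?c \<alpha> * pow_tensor K m n (?x \<alpha>) Ks Ls)"
      proof (cases "Ks \<in> tuples K m \<and> Ls \<in> tuples K n")
        case False
        then have "f Ks Ls = 0" using f by (auto simp: sym_tensor_space_def tensor_space_def)
        moreover have "pow_tensor K m n x Ks Ls = 0" for x using False by (auto simp: pow_tensor_def)
        ultimately show ?thesis by simp
      next
        case True
        have "(\<Sum>\<alpha>\<in>tuples K m \<times> tuples K n \<times> ?T. ?c \<alpha> * pow_tensor K m n (?x \<alpha>) Ks Ls)
          = (\<Sum>ks\<in>tuples K m. \<Sum>ls\<in>tuples K n. f ks ls / C *
              (\<Sum>t\<in>?T. polarization_weight N m n t * pow_tensor K m n (polarization_vector N (ks @ ls) t) Ks Ls))"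
          by (simp add: sum.cartesian_product case_prod_unfold sum_distrib_left mult_ac)
        also have "\<dots> = (\<Sum>ks\<in>tuples K m. \<Sum>ls\<in>tuples K n. f ks ls / C *
              (of_nat N ^ (m + n) * (\<Sum>(\<phi>, \<psi>)\<in>rearrangements m n.
       of_bool (matches m Ks (ks @ ls) \<phi> \<and> matches n Ls (ks @ ls) \<psi>))))"
          by (intro sum.cong refl) (use True in \<open>simp add: polarization_expansion[OF N_def] tuples_def\<close>)
        also have "\<dots> = of_nat N ^ (m + n) / C * (\<Sum>ks\<in>tuples K m. \<Sum>ls\<in>tuples K n. \<Sum>(\<phi>, \<psi>)\<in>rearrangements m n. f ks ls *
       of_bool (matches m Ks (ks @ ls) \<phi> \<and> matches n Ls (ks @ ls) \<psi>))"
          by (simp add: sum_distrib_left case_prod_unfold mult_ac)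
        also have "(\<Sum>ks\<in>tuples K m. \<Sum>ls\<in>tuples K n. \<Sum>(\<phi>, \<psi>)\<in>rearrangements m n. f ks ls *
       of_bool (matches m Ks (ks @ ls) \<phi> \<and> matches n Ls (ks @ ls) \<psi>))
          = (\<Sum>(ks, ls)\<in>?S. \<Sum>(\<phi>, \<psi>)\<in>rearrangements m n. f ks ls *
       of_bool (matches m Ks (ks @ ls) \<phi> \<and> matches n Ls (ks @ ls) \<psi>))"
          by (rule sum.cartesian_product)
        also have "(\<Sum>(ks, ls)\<in>?S. \<Sum>(\<phi>, \<psi>)\<in>rearrangements m n. f ks ls *
       of_bool (matches m Ks (ks @ ls) \<phi> \<and> matches n Ls (ks @ ls) \<psi>))
          = (\<Sum>(\<phi>, \<psi>)\<in>rearrangements m n. \<Sum>(ks, ls)\<in>?S. f ks ls *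
       of_bool (matches m Ks (ks @ ls) \<phi> \<and> matches n Ls (ks @ ls) \<psi>))"
          unfolding case_prod_unfold by (rule sum.swap)
        also have "\<dots> = (\<Sum>x\<in>rearrangements m n. f Ks Ls)"
          using sum_over_matching_indices[OF K f] True by (intro sum.cong refl) (auto split: prod.splits)
        also have "of_nat N ^ (m + n) / C * (\<Sum>x\<in>rearrangements m n. f Ks Ls) = C / C * f Ks Ls"
          by (simp only: sum_constant C_def times_divide_eq_left times_divide_eq_right mult.assoc)
        finally show ?thesis using C by simp
      qed
    qed
  qed
qed

section \<open>Configurations on four vertices\<close>

type_synonym config = "(nat \<times> nat \<times> nat \<times> nat) \<times> (nat \<times> nat \<times> nat \<times> nat) \<times> (nat \<times> nat \<times> nat \<times> nat)"

text \<open>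
A configuration records the twelve multiplicities of the directed edges between four distinct vertices. With
\<open>a\<^sub>u\<^sub>v\<close> for the number of edges from \<open>u\<close> to \<open>v\<close>, the entries are \<open>(a\<^sub>1\<^sub>2, a\<^sub>2\<^sub>1, a\<^sub>4\<^sub>3, a\<^sub>3\<^sub>4)\<close>,
\<open>(a\<^sub>1\<^sub>3, a\<^sub>1\<^sub>4, a\<^sub>2\<^sub>3, a\<^sub>2\<^sub>4)\<close> and \<open>(a\<^sub>3\<^sub>1, a\<^sub>4\<^sub>1, a\<^sub>3\<^sub>2, a\<^sub>4\<^sub>2)\<close>: the edges inside the pairs \<open>{1, 2}\<close> and \<open>{3, 4}\<close>, those
from the first pair to the second, and those back. The out- and in-degrees are \<open>(m, n)\<close>, \<open>(p, q)\<close>, \<open>(n, m)\<close> and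
\<open>(q, p)\<close>.
\<close>

definition configs :: "nat \<Rightarrow> nat \<Rightarrow> nat \<Rightarrow> nat \<Rightarrow> config set" where
  "configs m n p q = {((i, j, i', j'), (a, b, c, d), (e, f, g, h)).
     i + a + b = m \<and> j + c + d = p \<and> i' + a + c = m \<and> j' + b + d = p \<and>
     j + e + f = n \<and> i + g + h = q \<and> j' + e + g = n \<and> i' + f + h = q}"

text \<open>
The value of a configuration on powers of the vectors \<open>x1, \<dots>, x4\<close>, divided by the factorials of the multiplicities;
\<open>r\<close> stands for the inner product.
\<close>

definition config_weight :: "('v \<Rightarrow> 'v \<Rightarrow> complex) \<Rightarrow> 'v \<Rightarrow> 'v \<Rightarrow> 'v \<Rightarrow> 'v \<Rightarrow> config \<Rightarrow> complex" where
  "config_weight r x1 x2 x3 x4 = (\<lambda>((i, j, i', j'), (a, b, c, d), (e, f, g, h)).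
     (r x1 x2 ^ i / fact i * (r x2 x1 ^ j / fact j) * (r x4 x3 ^ i' / fact i') * (r x3 x4 ^ j' / fact j')) *
     (r x1 x3 ^ a / fact a * (r x1 x4 ^ b / fact b) * (r x2 x3 ^ c / fact c) * (r x2 x4 ^ d / fact d)) *
     (r x3 x1 ^ e / fact e * (r x4 x1 ^ f / fact f) * (r x3 x2 ^ g / fact g) * (r x4 x2 ^ h / fact h)))"

definition edges12 :: "config \<Rightarrow> nat" where "edges12 = (\<lambda>((i, j, i', j'), (a, b, c, d), (e, f, g, h)). i + j)"
definition edges13 :: "config \<Rightarrow> nat" where "edges13 = (\<lambda>((i, j, i', j'), (a, b, c, d), (e, f, g, h)). a + e)"
definition edges14 :: "config \<Rightarrow> nat" where "edges14 = (\<lambda>((i, j, i', j'), (a, b, c, d), (e, f, g, h)). b + f)"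

lemma edges_total:
  assumes "A \<in> configs m n p q"
  shows "edges12 A + edges13 A + edges14 A = m + n"
  using assms by (auto simp: configs_def edges12_def edges13_def edges14_def)

lemma finite_configs: "finite (configs m n p q)"
proof (rule finite_subset)
  let ?B = "{..m + n + p + q}"
  show "configs m n p q \<subseteq> (?B \<times> ?B \<times> ?B \<times> ?B) \<times> (?B \<times> ?B \<times> ?B \<times> ?B) \<times> (?B \<times> ?B \<times> ?B \<times> ?B)"
    by (auto simp: configs_def)
qed auto

text \<open>
The vertices 1, 3, 4, 2 take the places 1, 2, 3, 4. Vertex 3, which becomes the second one, has the degrees
\<open>(n, m)\<close>; this is why \<open>(p, q)\<close> changes. The orders 1, 4, 3, 2 and 1, 2, 4, 3 arise in the same way.
\<close>

lemma relabel_1342: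
  "(\<Sum>A\<in>configs m n m n. G (edges12 A) (edges13 A) (edges14 A) * config_weight r x1 x2 x3 x4 A) =
   (\<Sum>A\<in>configs m n n m. G (edges14 A) (edges12 A) (edges13 A) * config_weight r x1 x3 x4 x2 A)"
  by (rule sum.reindex_bij_witness[where
        j="\<lambda>((i, j, i', j'), (a, b, c, d), (e, f, g, h)). ((a, e, d, h), (b, i, j', g), (f, j, i', c))" and
        i="\<lambda>((i, j, i', j'), (a, b, c, d), (e, f, g, h)). ((b, f, g, c), (i, a, h, i'), (j, e, d, j'))"])
    (auto simp: configs_def edges12_def edges13_def edges14_def config_weight_def, simp only: mult_ac)

lemma relabel_1432:
  "(\<Sum>A\<in>configs m n m n. G (edges12 A) (edges13 A) (edges14 A) * config_weight r x1 x2 x3 x4 A) =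
   (\<Sum>A\<in>configs m n n m. G (edges14 A) (edges13 A) (edges12 A) * config_weight r x1 x4 x3 x2 A)"
  by (rule sum.reindex_bij_witness[where
        j="\<lambda>((i, j, i', j'), (a, b, c, d), (e, f, g, h)). ((b, f, c, g), (a, i, i', h), (e, j, j', d))" and
        i="\<lambda>((i, j, i', j'), (a, b, c, d), (e, f, g, h)). ((b, f, c, g), (a, i, i', h), (e, j, j', d))"])
    (auto simp: configs_def edges12_def edges13_def edges14_def config_weight_def, simp only: mult_ac)

lemma relabel_1243:
  "(\<Sum>A\<in>configs m n m n. G (edges12 A) (edges13 A) (edges14 A) * config_weight r x1 x2 x3 x4 A) =
   (\<Sum>A\<in>configs m n m n. G (edges12 A) (edges14 A) (edges13 A) * config_weight r x1 x2 x4 x3 A)"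
  by (rule sum.reindex_bij_witness[where
        j="\<lambda>((i, j, i', j'), (a, b, c, d), (e, f, g, h)). ((i, j, j', i'), (b, a, d, c), (f, e, h, g))" and
        i="\<lambda>((i, j, i', j'), (a, b, c, d), (e, f, g, h)). ((i, j, j', i'), (b, a, d, c), (f, e, h, g))"])
    (auto simp: configs_def edges12_def edges13_def edges14_def config_weight_def, simp only: mult_ac)

text \<open>
The weight \<open>3r - l\<close> sums to zero over three numbers with sum \<open>l\<close>. It is cut off at \<open>r = 0\<close> and \<open>r = l\<close>, the cases
that do not correspond to the contractions in question.
\<close>

definition crossing_weight :: "nat \<Rightarrow> nat \<Rightarrow> complex" where
  "crossing_weight l r = (if 0 < r \<and> r < l then of_int (3 * int r - int l) else 0)"

text \<open>
For \<open>r = e\<^sub>1\<^sub>2\<close> and \<open>s = e\<^sub>1\<^sub>4\<close>: there are no edges between 1 and 4, hence none between 2 and 3, and both \<open>e\<^sub>1\<^sub>2\<close> and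
\<open>e\<^sub>1\<^sub>3\<close> are positive, so the graph is a four-cycle with multiplicities.
\<close>

definition four_cycle :: "nat \<Rightarrow> nat \<Rightarrow> nat \<Rightarrow> complex" where
  "four_cycle l r s = of_bool (s = 0 \<and> 0 < r \<and> r < l)"

text \<open>
If all three numbers are positive, no cut-off applies and the weights cancel. If exactly one is zero, the other two
contribute \<open>3l - 2l\<close>. If two are zero, everything is cut off.
\<close>

lemma crossing_weight_identity:
  assumes "r + s + t = l"
  shows "crossing_weight l r + crossing_weight l s + crossing_weight l t = of_nat l * (four_cycle l r t + four_cycle l r s + four_cycle l t r)"
proof -
  have t: "int l = int r + int s + int t" using assms by simp
  consider "r > 0" "s > 0" "t > 0" | "r = 0" "s > 0" "t > 0" | "r > 0" "s = 0" "t > 0" | "r > 0" "s > 0" "t = 0"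
    | "r = 0" "s = 0" | "r = 0" "t = 0" | "s = 0" "t = 0" by linarith
  then show ?thesis
    by cases (use assms in \<open>auto simp: crossing_weight_def four_cycle_def t\<close>)
qed

text \<open>
The weights depend only on the configuration, so this is \<open>crossing_weight_identity\<close> summed over all configurations; the
relabelings bring every term into the form in which the first pair of vertices is distinguished.
\<close>

theorem config_identity:
  fixes r :: "'v \<Rightarrow> 'v \<Rightarrow> complex"
  assumes "l = m + n"
  shows "(\<Sum>A\<in>configs m n m n. crossing_weight l (edges12 A) * config_weight r x1 x2 x3 x4 A) +
         (\<Sum>A\<in>configs m n n m. crossing_weight l (edges12 A) * config_weight r x1 x3 x4 x2 A) +
         (\<Sum>A\<in>configs m n n m. crossing_weight l (edges12 A) * config_weight r x1 x4 x3 x2 A) =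
         of_nat l * (
         (\<Sum>A\<in>configs m n m n. four_cycle l (edges12 A) (edges14 A) * config_weight r x1 x2 x3 x4 A) +
         (\<Sum>A\<in>configs m n m n. four_cycle l (edges12 A) (edges14 A) * config_weight r x1 x2 x4 x3 A) +
         (\<Sum>A\<in>configs m n n m. four_cycle l (edges12 A) (edges14 A) * config_weight r x1 x4 x3 x2 A))"
proof -
  let ?w = "config_weight r x1 x2 x3 x4" and ?C = "configs m n m n"
  have "(\<Sum>A\<in>?C. (crossing_weight l (edges12 A) + crossing_weight l (edges13 A) + crossing_weight l (edges14 A)) * ?w A) =
     (\<Sum>A\<in>?C. (of_nat l * (four_cycle l (edges12 A) (edges14 A) + four_cycle l (edges12 A) (edges13 A)
        + four_cycle l (edges14 A) (edges12 A))) * ?w A)"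
  proof (rule sum.cong[OF refl])
    fix A assume "A \<in> ?C"
    then have "edges12 A + edges13 A + edges14 A = l" using edges_total assms by blast
    then show "(crossing_weight l (edges12 A) + crossing_weight l (edges13 A) + crossing_weight l (edges14 A)) * ?w A =
      (of_nat l * (four_cycle l (edges12 A) (edges14 A) + four_cycle l (edges12 A) (edges13 A)
        + four_cycle l (edges14 A) (edges12 A))) * ?w A"
      by (simp only: crossing_weight_identity)
  qed
  then have "(\<Sum>A\<in>?C. crossing_weight l (edges12 A) * ?w A) + (\<Sum>A\<in>?C. crossing_weight l (edges13 A) * ?w A) + (\<Sum>A\<in>?C. crossing_weight l (edges14 A) * ?w A)
    = of_nat l * ((\<Sum>A\<in>?C. four_cycle l (edges12 A) (edges14 A) * ?w A) +
       (\<Sum>A\<in>?C. four_cycle l (edges12 A) (edges13 A) * ?w A) + (\<Sum>A\<in>?C. four_cycle l (edges14 A) (edges12 A) * ?w A))"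
    by (simp add: sum.distrib distrib_right sum_distrib_left distrib_left mult.assoc)
  then show ?thesis
    unfolding relabel_1342[where G="\<lambda>a b c. crossing_weight l b"]
      relabel_1432[where G="\<lambda>a b c. crossing_weight l c"]
      relabel_1243[where G="\<lambda>a b c. four_cycle l a b"]
      relabel_1432[where G="\<lambda>a b c. four_cycle l c a"] .
qed

text \<open>
The ways to distribute the free outgoing edges of two vertices over the free incoming edges of two others.
\<close>

definition joinings :: "nat \<Rightarrow> nat \<Rightarrow> nat \<Rightarrow> nat \<Rightarrow> (nat \<times> nat \<times> nat \<times> nat) set" where
  "joinings r1 r2 s1 s2 = {(a, b, c, d). a + b = r1 \<and> c + d = r2 \<and> a + c = s1 \<and> b + d = s2}"

definition joining_sum :: "nat \<Rightarrow> nat \<Rightarrow> nat \<Rightarrow> nat \<Rightarrow> complex \<Rightarrow> complex \<Rightarrow> complex \<Rightarrow> complex \<Rightarrow> complex" where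
  "joining_sum r1 r2 s1 s2 \<alpha> \<beta> \<gamma> \<delta> = (\<Sum>(a, b, c, d)\<in>joinings r1 r2 s1 s2.
     \<alpha> ^ a / fact a * (\<beta> ^ b / fact b) * (\<gamma> ^ c / fact c) * (\<delta> ^ d / fact d))"

definition pair_indices :: "nat \<Rightarrow> nat \<Rightarrow> nat \<Rightarrow> nat \<Rightarrow> (nat \<times> nat \<times> nat \<times> nat) set" where
  "pair_indices m n p q = {(i, j, i', j'). i \<le> min m q \<and> j \<le> min n p \<and> i' \<le> min m q \<and> j' \<le> min n p \<and> i + j = i' + j'}"

lemma finite_pair_indices: "finite (pair_indices m n p q)"
proof (rule finite_subset)
  let ?B = "{..m + n}"
  show "pair_indices m n p q \<subseteq> ?B \<times> ?B \<times> ?B \<times> ?B" by (auto simp: pair_indices_def)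
qed auto

lemma finite_joinings: "finite (joinings r1 r2 s1 s2)"
proof (rule finite_subset)
  let ?B = "{..r1 + r2}"
  show "joinings r1 r2 s1 s2 \<subseteq> ?B \<times> ?B \<times> ?B \<times> ?B" by (auto simp: joinings_def)
qed auto

lemma configs_eq_Sigma:
  "configs m n p q = (SIGMA (i, j, i', j'):pair_indices m n p q.
     joinings (m - i) (p - j) (m - i') (p - j') \<times> joinings (n - j) (q - i) (n - j') (q - i'))"
proof (rule set_eqI)
  fix A :: config
  obtain i j i' j' a b c d e f g h where A: "A = ((i, j, i', j'), (a, b, c, d), (e, f, g, h))"
    by (metis prod.exhaust)
  have "A \<in> configs m n p q \<longleftrightarrow> (i \<le> m \<and> i \<le> q \<and> j \<le> n \<and> j \<le> p \<and> i' \<le> m \<and> i' \<le> q \<and> j' \<le> n \<and> j' \<le> p \<and> i + j = i' + j') \<and>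
      (a + b = m - i \<and> c + d = p - j \<and> a + c = m - i' \<and> b + d = p - j') \<and>
      (e + f = n - j \<and> g + h = q - i \<and> e + g = n - j' \<and> f + h = q - i')"
    (is "_ \<longleftrightarrow> ?R")
  proof
    assume "A \<in> configs m n p q"
    then have "i + a + b = m \<and> j + c + d = p \<and> i' + a + c = m \<and> j' + b + d = p \<and>
     j + e + f = n \<and> i + g + h = q \<and> j' + e + g = n \<and> i' + f + h = q"
      by (simp only: A configs_def mem_Collect_eq prod.case)
    then show ?R by (intro conjI; linarith)
  next
    assume R: ?R
    have "i + (a + b) = m" "j + (c + d) = p" "i' + (a + c) = m" "j' + (b + d) = p"
      "j + (e + f) = n" "i + (g + h) = q" "j' + (e + g) = n" "i' + (f + h) = q"
      using R by simp_all
    then show "A \<in> configs m n p q"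
      unfolding A configs_def by (simp only: mem_Collect_eq prod.case add.assoc)
  qed
  then show "A \<in> configs m n p q \<longleftrightarrow> A \<in> (SIGMA (i, j, i', j'):pair_indices m n p q.
     joinings (m - i) (p - j) (m - i') (p - j') \<times> joinings (n - j) (q - i) (n - j') (q - i'))"
    unfolding A by (simp add: pair_indices_def joinings_def)
qed

text \<open>
Once the edges inside the two pairs are fixed, the edges in the two directions between the pairs can be chosen
independently.
\<close>

lemma config_sum_grouped:
  "(\<Sum>A\<in>configs m n p q. crossing_weight l (edges12 A) * config_weight r x1 x2 x3 x4 A) =
   (\<Sum>(i, j, i', j')\<in>pair_indices m n p q. crossing_weight l (i + j) / (fact i * fact j * fact i' * fact j') *
      (r x1 x2 ^ i * r x2 x1 ^ j * r x4 x3 ^ i' * r x3 x4 ^ j') *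
      joining_sum (m - i) (p - j) (m - i') (p - j') (r x1 x3) (r x1 x4) (r x2 x3) (r x2 x4) *
      joining_sum (n - j) (q - i) (n - j') (q - i') (r x3 x1) (r x4 x1) (r x3 x2) (r x4 x2))"
proof -
  have "(\<Sum>A\<in>configs m n p q. crossing_weight l (edges12 A) * config_weight r x1 x2 x3 x4 A) =
     (\<Sum>x\<in>pair_indices m n p q. \<Sum>y\<in>(case x of (i, j, i', j') \<Rightarrow>
        joinings (m - i) (p - j) (m - i') (p - j') \<times> joinings (n - j) (q - i) (n - j') (q - i')).
        crossing_weight l (edges12 (x, y)) * config_weight r x1 x2 x3 x4 (x, y))"
    unfolding configs_eq_Sigma
    by (subst sum.Sigma) (auto simp: finite_pair_indices finite_joinings case_prod_unfold)
  also have "\<dots> = (\<Sum>(i, j, i', j')\<in>pair_indices m n p q. crossing_weight l (i + j) / (fact i * fact j * fact i' * fact j') *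
      (r x1 x2 ^ i * r x2 x1 ^ j * r x4 x3 ^ i' * r x3 x4 ^ j') *
      joining_sum (m - i) (p - j) (m - i') (p - j') (r x1 x3) (r x1 x4) (r x2 x3) (r x2 x4) *
      joining_sum (n - j) (q - i) (n - j') (q - i') (r x3 x1) (r x4 x1) (r x3 x2) (r x4 x2))"
  proof (rule sum.cong[OF refl], clarify)
    fix i j i' j'
    let ?J1 = "joinings (m - i) (p - j) (m - i') (p - j')" and ?J2 = "joinings (n - j) (q - i) (n - j') (q - i')"
    let ?w1 = "\<lambda>(a, b, c, d). r x1 x3 ^ a / fact a * (r x1 x4 ^ b / fact b) * (r x2 x3 ^ c / fact c) * (r x2 x4 ^ d / fact d)"
    let ?w2 = "\<lambda>(e, f, g, h). r x3 x1 ^ e / fact e * (r x4 x1 ^ f / fact f) * (r x3 x2 ^ g / fact g) * (r x4 x2 ^ h / fact h)"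
    let ?p = "crossing_weight l (i + j) / (fact i * fact j * fact i' * fact j') *
      (r x1 x2 ^ i * r x2 x1 ^ j * r x4 x3 ^ i' * r x3 x4 ^ j')"
    have "(\<Sum>y\<in>?J1 \<times> ?J2. crossing_weight l (edges12 ((i, j, i', j'), y)) * config_weight r x1 x2 x3 x4 ((i, j, i', j'), y))
      = (\<Sum>y\<in>?J1 \<times> ?J2. ?p * (?w1 (fst y) * ?w2 (snd y)))"
      by (rule sum.cong[OF refl]) (auto simp: edges12_def config_weight_def field_simps)
    also have "\<dots> = ?p * (sum ?w1 ?J1 * sum ?w2 ?J2)"
    proof -
      have "(\<Sum>y\<in>?J1 \<times> ?J2. ?w1 (fst y) * ?w2 (snd y)) = sum ?w1 ?J1 * sum ?w2 ?J2"
        by (simp only: sum_product sum.cartesian_product case_prod_unfold)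
      then show ?thesis by (simp only: sum_distrib_left[symmetric])
    qed
    finally show "(\<Sum>y\<in>?J1 \<times> ?J2. crossing_weight l (edges12 ((i, j, i', j'), y)) * config_weight r x1 x2 x3 x4 ((i, j, i', j'), y))
       = ?p * joining_sum (m - i) (p - j) (m - i') (p - j') (r x1 x3) (r x1 x4) (r x2 x3) (r x2 x4) *
      joining_sum (n - j) (q - i) (n - j') (q - i') (r x3 x1) (r x4 x1) (r x3 x2) (r x4 x2)"
      by (simp only: joining_sum_def mult.assoc)
  qed
  finally show ?thesis .
qed

definition proper_indices :: "nat \<Rightarrow> nat \<Rightarrow> nat \<Rightarrow> nat \<Rightarrow> (nat \<times> nat) set" where
  "proper_indices m n p q = {(i, j). i \<le> min m q \<and> j \<le> min n p \<and> 0 < i + j \<and> i + j < m + n}"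

text \<open>
A four-cycle is determined by the multiplicities between the vertices 1 and 2.
\<close>

lemma config_sum_four_cycles:
  assumes "l = m + n"
  shows "(\<Sum>A\<in>configs m n p q. four_cycle l (edges12 A) (edges14 A) * config_weight r x1 x2 x3 x4 A) =
   (\<Sum>(i, j)\<in>proper_indices m n p q.
      (r x1 x2 ^ i * r x2 x1 ^ j * r x4 x3 ^ i * r x3 x4 ^ j) *
      (r x1 x3 ^ (m - i) * r x2 x4 ^ (p - j)) * (r x3 x1 ^ (n - j) * r x4 x2 ^ (q - i)) /
      ((fact i)\<^sup>2 * (fact j)\<^sup>2 * fact (m - i) * fact (p - j) * fact (n - j) * fact (q - i)))"
proof -
  let ?\<iota> = "\<lambda>(i, j). ((i, j, i, j), (m - i, 0, 0, p - j), (n - j, 0, 0, q - i))"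
  have inj: "inj_on ?\<iota> (proper_indices m n p q)" by (auto simp: inj_on_def)
  have img: "?\<iota> ` proper_indices m n p q = {A \<in> configs m n p q. edges14 A = 0 \<and> 0 < edges12 A \<and> edges12 A < l}"
  proof (intro equalityI subsetI)
    fix A assume "A \<in> {A \<in> configs m n p q. edges14 A = 0 \<and> 0 < edges12 A \<and> edges12 A < l}"
    moreover obtain i j i' j' a b c d e f g h where A: "A = ((i, j, i', j'), (a, b, c, d), (e, f, g, h))"
      by (cases A) auto
    ultimately have "b = 0" "c = 0" "f = 0" "g = 0" "i' = i" "j' = j" "a = m - i" "d = p - j" "e = n - j" "h = q - i"
      "(i, j) \<in> proper_indices m n p q"
      by (auto simp: configs_def edges14_def edges12_def proper_indices_def assms)
    then show "A \<in> ?\<iota> ` proper_indices m n p q" unfolding A by (auto intro!: image_eqI[of _ _ "(i, j)"])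
  qed (auto simp: configs_def edges14_def edges12_def proper_indices_def assms)
  have "(\<Sum>A\<in>configs m n p q. four_cycle l (edges12 A) (edges14 A) * config_weight r x1 x2 x3 x4 A) =
      (\<Sum>A\<in>?\<iota> ` proper_indices m n p q. config_weight r x1 x2 x3 x4 A)"
    unfolding img by (rule sum.mono_neutral_cong_right) (auto simp: finite_configs four_cycle_def)
  also have "\<dots> = (\<Sum>x\<in>proper_indices m n p q. config_weight r x1 x2 x3 x4 (?\<iota> x))"
    by (simp add: sum.reindex[OF inj])
  finally show ?thesis
    by (simp add: config_weight_def case_prod_unfold power2_eq_square mult_ac)
qed

section \<open>Inner products of symmetrized powers\<close>

definition herm :: "'k set \<Rightarrow> ('k \<Rightarrow> complex) \<Rightarrow> ('k \<Rightarrow> complex) \<Rightarrow> complex" where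
  "herm K x y = (\<Sum>k\<in>K. x k * cnj (y k))"

lemma cnj_herm: "cnj (herm K x y) = herm K y x"
  by (simp add: herm_def mult.commute)

definition split_power :: "nat \<Rightarrow> ('k \<Rightarrow> complex) \<Rightarrow> ('k \<Rightarrow> complex) \<Rightarrow> 'k list \<Rightarrow> complex" where
  "split_power p x y ks = (\<Prod>k\<leftarrow>take p ks. x k) * (\<Prod>k\<leftarrow>drop p ks. y k)"

definition sym_avg :: "nat \<Rightarrow> ('k list \<Rightarrow> complex) \<Rightarrow> 'k list \<Rightarrow> complex" where
  "sym_avg N A ks = (\<Sum>\<sigma> | \<sigma> permutes {..<N}. A (permute_list \<sigma> ks)) / fact N"

lemma sum_tuples_prod:
  assumes "finite K"
  shows "(\<Sum>ks\<in>tuples K r. \<Prod>k\<leftarrow>ks. g k) = (\<Sum>k\<in>K. g k :: complex) ^ r"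
proof (induction r)
  case 0
  have "tuples K 0 = {[]}" by (auto simp: tuples_def)
  then show ?case by simp
next
  case (Suc r)
  have "bij_betw (\<lambda>(k, ks). k # ks) (K \<times> tuples K r) (tuples K (Suc r))"
    by (rule bij_betwI[where g="\<lambda>ks. (hd ks, tl ks)"]) (auto simp: tuples_def length_Suc_conv)
  then have "(\<Sum>ks\<in>tuples K (Suc r). \<Prod>k\<leftarrow>ks. g k) = (\<Sum>x\<in>K \<times> tuples K r. \<Prod>k\<leftarrow>(case x of (k, ks) \<Rightarrow> k # ks). g k)"
    by (rule sum.reindex_bij_betw[symmetric])
  also have "\<dots> = (\<Sum>k\<in>K. g k) * (\<Sum>ks\<in>tuples K r. \<Prod>k\<leftarrow>ks. g k)"
    by (simp add: sum_product sum.cartesian_product case_prod_unfold)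
  finally show ?case using Suc by simp
qed

lemma sum_tuples_split:
  "(\<Sum>ks\<in>tuples K (p + q). F (take p ks) * G (drop p ks)) =
   (\<Sum>ks\<in>tuples K p. F ks) * (\<Sum>ks\<in>tuples K q. G ks :: complex)"
proof -
  have "(\<Sum>ks\<in>tuples K (p + q). F (take p ks) * G (drop p ks)) = (\<Sum>x\<in>tuples K p \<times> tuples K q. F (fst x) * G (snd x))"
    using sum.reindex_bij_betw[OF bij_betw_take_drop[of p K q], of "\<lambda>x. F (fst x) * G (snd x)"] by simp
  then show ?thesis by (simp add: sum_product sum.cartesian_product case_prod_unfold)
qed

lemma sum_tuples_permute:
  assumes "\<sigma> permutes {..<r}"
  shows "(\<Sum>ks\<in>tuples K r. F (permute_list \<sigma> ks)) = (\<Sum>ks\<in>tuples K r. F ks)"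
  by (rule sum.reindex_bij_betw[OF bij_betw_permute_list[OF assms]])

lemma split_power_inner:
  assumes "finite K"
  shows "(\<Sum>ks\<in>tuples K (p + q). split_power p x y ks * cnj (split_power p z w ks)) = herm K x z ^ p * herm K y w ^ q"
proof -
  have "(\<Sum>ks\<in>tuples K (p + q). split_power p x y ks * cnj (split_power p z w ks)) =
     (\<Sum>ks\<in>tuples K (p + q). (\<lambda>ks. \<Prod>k\<leftarrow>ks. x k * cnj (z k)) (take p ks) * (\<lambda>ks. \<Prod>k\<leftarrow>ks. y k * cnj (w k)) (drop p ks))"
  proof (rule sum.cong[OF refl])
    fix ks :: "'a list"
    have c: "cnj (\<Prod>k\<leftarrow>l. f k) = (\<Prod>k\<leftarrow>l. cnj (f k))" for l and f :: "'a \<Rightarrow> complex" by (induction l) auto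
    have m: "(\<Prod>k\<leftarrow>l. f k * g k) = (\<Prod>k\<leftarrow>l. f k) * (\<Prod>k\<leftarrow>l. g k)" for l and f g :: "'a \<Rightarrow> complex"
      by (induction l) (auto simp: mult_ac)
    show "split_power p x y ks * cnj (split_power p z w ks) =
      (\<lambda>ks. \<Prod>k\<leftarrow>ks. x k * cnj (z k)) (take p ks) * (\<lambda>ks. \<Prod>k\<leftarrow>ks. y k * cnj (w k)) (drop p ks)"
      by (simp only: split_power_def complex_cnj_mult c m mult_ac)
  qed
  also have "\<dots> = (\<Sum>ks\<in>tuples K p. \<Prod>k\<leftarrow>ks. x k * cnj (z k)) * (\<Sum>ks\<in>tuples K q. \<Prod>k\<leftarrow>ks. y k * cnj (w k))"
    by (rule sum_tuples_split)
  finally show ?thesis by (simp add: sum_tuples_prod[OF assms] herm_def)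
qed

lemma split_power_sum_inner:
  assumes "finite K"
  shows "(\<Sum>ks\<in>tuples K (p + q). (\<Prod>k\<leftarrow>ks. u k) * cnj (split_power p z w ks)) = herm K u z ^ p * herm K u w ^ q"
proof -
  have "split_power p u u ks = (\<Prod>k\<leftarrow>ks. u k)" for ks :: "'a list"
    unfolding split_power_def prod_list.append[symmetric] map_append[symmetric] by simp
  then show ?thesis using split_power_inner[OF assms, where p=p and q=q and x=u and y=u and z=z and w=w] by simp
qed

lemma sym_avg_permute:
  assumes "\<sigma> permutes {..<N}" "length ks = N"
  shows "sym_avg N A (permute_list \<sigma> ks) = sym_avg N A ks"
proof -
  have "(\<Sum>\<tau> | \<tau> permutes {..<N}. A (permute_list \<tau> (permute_list \<sigma> ks))) =
      (\<Sum>\<tau> | \<tau> permutes {..<N}. A (permute_list (\<sigma> \<circ> \<tau>) ks))"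
    by (rule sum.cong) (use assms in \<open>auto simp: permute_list_compose\<close>)
  also have "\<dots> = (\<Sum>\<tau> | \<tau> permutes {..<N}. A (permute_list \<tau> ks))"
    by (rule setum_permutations_compose_left[OF assms(1), symmetric, where f="\<lambda>\<tau>. A (permute_list \<tau> ks)"])
  finally show ?thesis by (simp add: sym_avg_def)
qed

lemma sym_avg_self_adjoint:
  assumes "finite K"
  shows "(\<Sum>ks\<in>tuples K N. sym_avg N A ks * cnj (sym_avg N B ks)) = (\<Sum>ks\<in>tuples K N. sym_avg N A ks * cnj (B ks))"
proof -
  let ?P = "{\<sigma>. \<sigma> permutes {..<N}}"
  have "(\<Sum>ks\<in>tuples K N. sym_avg N A ks * cnj (sym_avg N B ks)) =
     (\<Sum>ks\<in>tuples K N. \<Sum>\<sigma>\<in>?P. sym_avg N A ks * cnj (B (permute_list \<sigma> ks)) / fact N)"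
    by (simp add: sym_avg_def[of N B] sum_distrib_left sum_divide_distrib)
  also have "\<dots> = (\<Sum>\<sigma>\<in>?P. \<Sum>ks\<in>tuples K N. sym_avg N A ks * cnj (B (permute_list \<sigma> ks)) / fact N)"
    by (rule sum.swap)
  also have "\<dots> = (\<Sum>\<sigma>\<in>?P. \<Sum>ks\<in>tuples K N. sym_avg N A (permute_list \<sigma> ks) * cnj (B (permute_list \<sigma> ks)) / fact N)"
    by (intro sum.cong refl) (auto simp: sym_avg_permute tuples_def)
  also have "\<dots> = (\<Sum>\<sigma>\<in>?P. \<Sum>ks\<in>tuples K N. sym_avg N A ks * cnj (B ks) / fact N)"
    by (rule sum.cong[OF refl], rule sum_tuples_permute[where F="\<lambda>ks. sym_avg N A ks * cnj (B ks) / fact N"]) simp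
  also have "\<dots> = (\<Sum>ks\<in>tuples K N. sym_avg N A ks * cnj (B ks))"
    by (simp add: card_permutations sum_divide_distrib[symmetric])
  finally show ?thesis .
qed

definition subset_product :: "nat set \<Rightarrow> ('k \<Rightarrow> complex) \<Rightarrow> ('k \<Rightarrow> complex) \<Rightarrow> 'k list \<Rightarrow> complex" where
  "subset_product S x y ks = (\<Prod>i\<in>S. x (ks ! i)) * (\<Prod>i\<in>{..<length ks} - S. y (ks ! i))"

lemma split_power_eq_subset_product:
  assumes "p \<le> length ks"
  shows "split_power p x y ks = subset_product {..<p} x y ks"
proof -
  have 1: "(\<Prod>k\<leftarrow>take p ks. x k) = (\<Prod>i<p. x (ks ! i))"
    using assms by (simp add: prod.list_conv_set_nth atLeast0LessThan min_def)
  have "(\<Prod>k\<leftarrow>drop p ks. y k) = (\<Prod>i<length ks - p. y (ks ! (p + i)))"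
    using assms by (simp add: prod.list_conv_set_nth atLeast0LessThan)
  also have "\<dots> = (\<Prod>i\<in>{..<length ks} - {..<p}. y (ks ! i))"
    by (rule prod.reindex_bij_witness[where i="\<lambda>i. i - p" and j="\<lambda>i. p + i"]) (use assms in auto)
  finally show ?thesis using 1 by (simp add: split_power_def subset_product_def)
qed

lemma subset_product_permute:
  assumes \<sigma>: "\<sigma> permutes {..<N}" and len: "length ks = N" and S: "S \<subseteq> {..<N}"
  shows "subset_product S x y (permute_list \<sigma> ks) = subset_product (\<sigma> ` S) x y ks"
proof -
  have inj: "inj_on \<sigma> A" for A using \<sigma> by (meson inj_on_subset permutes_inj subset_UNIV)
  have "\<sigma> ` ({..<N} - S) = {..<N} - \<sigma> ` S"
    using image_set_diff[OF permutes_inj[OF \<sigma>], of "{..<N}" S] permutes_image[OF \<sigma>] by simp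
  moreover have "(\<Prod>i\<in>A. f (permute_list \<sigma> ks ! i)) = (\<Prod>i\<in>\<sigma> ` A. f (ks ! i))" if "A \<subseteq> {..<N}" for A and f :: "'a \<Rightarrow> complex"
    using that \<sigma> len by (subst prod.reindex[OF inj]) (auto simp: permute_list_nth intro!: prod.cong)
  ultimately show ?thesis using S len by (simp add: subset_product_def)
qed

lemma ex_permutation_onto:
  assumes "S \<subseteq> {..<N}" "card S = p"
  obtains \<rho> where "\<rho> permutes {..<N::nat}" "\<rho> ` {..<p} = S"
proof -
  have fin: "finite S" using assms finite_subset by blast
  have p: "p \<le> N" using card_mono[OF _ assms(1)] assms(2) by simp
  obtain f where f: "bij_betw f {..<p} S"
    using finite_same_card_bij[of "{..<p}" S] fin assms by auto
  have "card ({..<N} - {..<p}) = card ({..<N} - S)"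
    using assms fin p by (simp add: card_Diff_subset)
  then obtain g where g: "bij_betw g ({..<N} - {..<p}) ({..<N} - S)"
    using finite_same_card_bij[of "{..<N} - {..<p}" "{..<N} - S"] by auto
  \<comment> \<open>Glue a bijection onto \<open>S\<close> and one onto its complement; outside the range it has to be the identity.\<close>
  define \<rho> where "\<rho> = (\<lambda>i. if i < p then f i else if i < N then g i else i)"
  have "bij_betw \<rho> {..<p} S" using f by (subst bij_betw_cong[of _ _ f]) (auto simp: \<rho>_def)
  moreover have "bij_betw \<rho> ({..<N} - {..<p}) ({..<N} - S)"
    using g by (subst bij_betw_cong[of _ _ g]) (auto simp: \<rho>_def)
  ultimately have "bij_betw \<rho> ({..<p} \<union> ({..<N} - {..<p})) (S \<union> ({..<N} - S))"
    by (rule bij_betw_combine) auto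
  moreover have "{..<p} \<union> ({..<N} - {..<p}) = {..<N}" "S \<union> ({..<N} - S) = {..<N}" using p assms by auto
  ultimately have "\<rho> permutes {..<N}"
    by (intro bij_imp_permutes) (use p in \<open>auto simp: \<rho>_def\<close>)
  moreover have "\<rho> ` {..<p} = S" using \<open>bij_betw \<rho> {..<p} S\<close> by (simp add: bij_betw_def)
  ultimately show thesis using that by blast
qed

text \<open>
Averaging over all permutations may be done on either side: a permutation permutes the subsets of size \<open>p\<close>, and
every such subset is the image of the first \<open>p\<close> positions under some permutation.
\<close>

lemma sum_subset_products:
  assumes len: "length ks = N" and p: "p \<le> N"
  shows "(\<Sum>S | S \<subseteq> {..<N} \<and> card S = p. subset_product S x y ks) = of_nat (N choose p) * sym_avg N (split_power p x y) ks"
proof -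
  let ?P = "{\<sigma>. \<sigma> permutes {..<N}}" and ?S = "{S. S \<subseteq> {..<N} \<and> card S = p}"
  have fin: "finite ?S" by (rule finite_subset[of _ "Pow {..<N}"]) auto
  have "fact N * (\<Sum>S\<in>?S. subset_product S x y ks) = (\<Sum>\<sigma>\<in>?P. \<Sum>S\<in>?S. subset_product S x y ks)"
    by (simp add: card_permutations)
  also have "\<dots> = (\<Sum>\<sigma>\<in>?P. \<Sum>S\<in>?S. subset_product (\<sigma> ` S) x y ks)"
  proof (rule sum.cong[OF refl])
    fix \<sigma> assume "\<sigma> \<in> ?P"
    then have \<sigma>: "\<sigma> permutes {..<N}" by simp
    have c: "card (\<sigma> ` S) = card S" for S using \<sigma> by (meson card_image inj_on_subset permutes_inj subset_UNIV)
    have c': "card (inv \<sigma> ` S) = card S" for S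
      using permutes_inv[OF \<sigma>] by (meson card_image inj_on_subset permutes_inj subset_UNIV)
    show "(\<Sum>S\<in>?S. subset_product S x y ks) = (\<Sum>S\<in>?S. subset_product (\<sigma> ` S) x y ks)"
    proof (rule sum.reindex_bij_witness[where j="\<lambda>S. inv \<sigma> ` S" and i="\<lambda>S. \<sigma> ` S"])
      fix S assume S: "S \<in> ?S"
      show "\<sigma> ` inv \<sigma> ` S = S" "inv \<sigma> ` \<sigma> ` S = S"
        using permutes_inverses[OF \<sigma>] by (auto simp: image_image)
      show "inv \<sigma> ` S \<in> ?S" using S c' image_mono[of S "{..<N}" "inv \<sigma>"] permutes_image[OF permutes_inv[OF \<sigma>]] by simp
      show "\<sigma> ` S \<in> ?S" using S c image_mono[of S "{..<N}" \<sigma>] permutes_image[OF \<sigma>] by simp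
      show "subset_product (\<sigma> ` inv \<sigma> ` S) x y ks = subset_product S x y ks"
        using permutes_inverses[OF \<sigma>] by (simp add: image_image)
    qed
  qed
  also have "\<dots> = (\<Sum>S\<in>?S. \<Sum>\<sigma>\<in>?P. subset_product (\<sigma> ` S) x y ks)" by (rule sum.swap)
  also have "\<dots> = (\<Sum>S\<in>?S. \<Sum>\<sigma>\<in>?P. subset_product (\<sigma> ` {..<p}) x y ks)"
  proof (rule sum.cong[OF refl])
    fix S assume "S \<in> ?S"
    then obtain \<rho> where \<rho>: "\<rho> permutes {..<N}" "\<rho> ` {..<p} = S" using ex_permutation_onto[of S N p] by auto
    have "(\<Sum>\<sigma>\<in>?P. subset_product (\<sigma> ` S) x y ks) = (\<Sum>\<sigma>\<in>?P. subset_product ((\<sigma> \<circ> \<rho>) ` {..<p}) x y ks)"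
      by (simp only: image_comp[symmetric] \<rho>(2))
    also have "\<dots> = (\<Sum>\<sigma>\<in>?P. subset_product (\<sigma> ` {..<p}) x y ks)"
      by (rule sum_permutations_compose_right[OF \<rho>(1), symmetric, where f="\<lambda>\<sigma>. subset_product (\<sigma> ` {..<p}) x y ks"])
    finally show "(\<Sum>\<sigma>\<in>?P. subset_product (\<sigma> ` S) x y ks) = (\<Sum>\<sigma>\<in>?P. subset_product (\<sigma> ` {..<p}) x y ks)" .
  qed
  also have "\<dots> = of_nat (N choose p) * (\<Sum>\<sigma>\<in>?P. subset_product (\<sigma> ` {..<p}) x y ks)"
    using n_subsets[of "{..<N}" p] by simp
  also have "(\<Sum>\<sigma>\<in>?P. subset_product (\<sigma> ` {..<p}) x y ks) = (\<Sum>\<sigma>\<in>?P. split_power p x y (permute_list \<sigma> ks))"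
    by (rule sum.cong[OF refl]) (use len p in \<open>simp add: split_power_eq_subset_product subset_product_permute\<close>)
  also have "\<dots> = fact N * sym_avg N (split_power p x y) ks" by (simp add: sym_avg_def)
  finally show ?thesis by simp
qed

text \<open>
The generating function of the symmetrized tensors \<open>x \<otimes> \<dots> \<otimes> x \<otimes> y \<otimes> \<dots> \<otimes> y\<close> is the power of \<open>s x + y\<close>.
\<close>

lemma power_of_sum_expansion:
  assumes len: "length ks = N"
  shows "(\<Prod>k\<leftarrow>ks. s * x k + y k) = (\<Sum>p\<le>N. of_nat (N choose p) * sym_avg N (split_power p x y) ks * s ^ p)"
proof -
  have "(\<Prod>k\<leftarrow>ks. s * x k + y k) = (\<Prod>i<N. s * x (ks ! i) + y (ks ! i))"
    using len by (simp add: prod.list_conv_set_nth atLeast0LessThan)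
  also have "\<dots> = (\<Sum>S\<in>Pow {..<N}. (\<Prod>i\<in>S. s * x (ks ! i)) * (\<Prod>i\<in>{..<N} - S. y (ks ! i)))"
    by (rule prod_add) simp
  also have "\<dots> = (\<Sum>S\<in>Pow {..<N}. s ^ card S * subset_product S x y ks)"
    using len by (intro sum.cong refl) (simp add: subset_product_def prod.distrib)
  also have "\<dots> = (\<Sum>p\<le>N. \<Sum>S\<in>{S \<in> Pow {..<N}. card S = p}. s ^ card S * subset_product S x y ks)"
    by (rule sum.group[symmetric]) (auto intro: card_mono[of "{..<N}", simplified])
  also have "\<dots> = (\<Sum>p\<le>N. s ^ p * (\<Sum>S | S \<subseteq> {..<N} \<and> card S = p. subset_product S x y ks))"
    by (intro sum.cong refl) (simp add: sum_distrib_left Pow_def)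
  also have "\<dots> = (\<Sum>p\<le>N. of_nat (N choose p) * sym_avg N (split_power p x y) ks * s ^ p)"
    by (intro sum.cong refl) (simp add: sum_subset_products[OF len] mult_ac)
  finally show ?thesis .
qed

text \<open>
The inner product of the power of \<open>s x + y\<close> with \<open>z \<otimes> \<dots> \<otimes> z \<otimes> w \<otimes> \<dots> \<otimes> w\<close> is a product of powers of two linear
polynomials in \<open>s\<close>. Comparing the coefficients of \<open>s ^ p\<close> gives the sum over joinings, without counting
permutations.
\<close>

theorem sym_split_power_inner:
  assumes K: "finite K" and N: "p + q = N" "p' + q' = N"
  shows "(\<Sum>ks\<in>tuples K N. sym_avg N (split_power p x y) ks * cnj (sym_avg N (split_power p' z w) ks)) =
    (fact p * fact q * fact p' * fact q' / fact N) *
      joining_sum p q p' q' (herm K x z) (herm K x w) (herm K y z) (herm K y w)"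
proof -
  define A where "A = herm K x z" define B where "B = herm K x w"
  define C where "C = herm K y z" define D where "D = herm K y w"
  define I where "I = (\<lambda>p. \<Sum>ks\<in>tuples K N. sym_avg N (split_power p x y) ks * cnj (split_power p' z w ks))"
  \<comment> \<open>The coefficients of the product of the two binomial expansions.\<close>
  define J where "J = (\<lambda>p. \<Sum>a\<le>p. (of_nat (p' choose a) * A ^ a * C ^ (p' - a)) * (of_nat (q' choose (p - a)) * B ^ (p - a) * D ^ (q' - (p - a))))"
  have "(\<Sum>p\<le>N. (of_nat (N choose p) * I p) * s ^ p) = (\<Sum>p\<le>N. J p * s ^ p)" for s
  proof -
    have "(\<Sum>p\<le>N. (of_nat (N choose p) * I p) * s ^ p) =
        (\<Sum>ks\<in>tuples K N. (\<Prod>k\<leftarrow>ks. s * x k + y k) * cnj (split_power p' z w ks))"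
    proof -
      have "(\<Sum>ks\<in>tuples K N. (\<Prod>k\<leftarrow>ks. s * x k + y k) * cnj (split_power p' z w ks)) =
        (\<Sum>ks\<in>tuples K N. \<Sum>p\<le>N. of_nat (N choose p) * (sym_avg N (split_power p x y) ks * cnj (split_power p' z w ks)) * s ^ p)"
        by (rule sum.cong[OF refl]) (simp add: tuples_def power_of_sum_expansion sum_distrib_left mult_ac)
      also have "\<dots> = (\<Sum>p\<le>N. \<Sum>ks\<in>tuples K N. of_nat (N choose p) * (sym_avg N (split_power p x y) ks * cnj (split_power p' z w ks)) * s ^ p)"
        by (rule sum.swap)
      finally show ?thesis by (simp add: I_def sum_distrib_left sum_distrib_right)
    qed
    also have "\<dots> = herm K (\<lambda>k. s * x k + y k) z ^ p' * herm K (\<lambda>k. s * x k + y k) w ^ q'"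
      using split_power_sum_inner[OF K, where p=p' and q=q' and u="\<lambda>k. s * x k + y k" and z=z and w=w] N by simp
    also have "herm K (\<lambda>k. s * x k + y k) z = A * s + C"
      by (simp add: herm_def A_def C_def sum.distrib sum_distrib_left algebra_simps)
    also have "herm K (\<lambda>k. s * x k + y k) w = B * s + D"
      by (simp add: herm_def B_def D_def sum.distrib sum_distrib_left algebra_simps)
    also have "(A * s + C) ^ p' * (B * s + D) ^ q' =
       (\<Sum>a\<le>p'. (of_nat (p' choose a) * A ^ a * C ^ (p' - a)) * s ^ a) *
       (\<Sum>b\<le>q'. (of_nat (q' choose b) * B ^ b * D ^ (q' - b)) * s ^ b)"
      by (simp add: binomial_ring power_mult_distrib mult_ac)
    also have "\<dots> = (\<Sum>p\<le>p' + q'. J p * s ^ p)"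
      unfolding J_def by (rule polynomial_product) auto
    finally show ?thesis using N by simp
  qed
  then have "\<forall>p\<le>N. of_nat (N choose p) * I p = J p" by (subst polyfun_eq_coeffs[symmetric]) auto
  then have "of_nat (N choose p) * I p = J p" using N by simp
  moreover have "of_nat (N choose p) = (fact N / (fact p * fact q) :: complex)"
    using binomial_fact[of p N, where 'a=complex] N by (metis add_diff_cancel_left' le_add1)
  ultimately have I: "I p = fact p * fact q / fact N * J p" by (simp add: field_simps)
  have J: "J p = fact p' * fact q' * joining_sum p q p' q' A B C D"
  proof -
    have "J p = (\<Sum>a\<in>{a. a \<le> p \<and> a \<le> p' \<and> p - a \<le> q'}. (of_nat (p' choose a) * A ^ a * C ^ (p' - a)) * (of_nat (q' choose (p - a)) * B ^ (p - a) * D ^ (q' - (p - a))))"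
      unfolding J_def by (rule sum.mono_neutral_right) auto
    also have "\<dots> = (\<Sum>(a, b, c, d)\<in>joinings p q p' q'. fact p' * fact q' * (A ^ a / fact a * (B ^ b / fact b) * (C ^ c / fact c) * (D ^ d / fact d)))"
    proof (rule sum.reindex_bij_witness[where i="\<lambda>(a, b, c, d). a" and j="\<lambda>a. (a, p - a, p' - a, q' - (p - a))"])
      fix a assume a: "a \<in> {a. a \<le> p \<and> a \<le> p' \<and> p - a \<le> q'}"
      show "(a, p - a, p' - a, q' - (p - a)) \<in> joinings p q p' q'" using a N by (auto simp: joinings_def)
      have "of_nat (p' choose a) = (fact p' / (fact a * fact (p' - a)) :: complex)"
        "of_nat (q' choose (p - a)) = (fact q' / (fact (p - a) * fact (q' - (p - a))) :: complex)"
        using a by (simp_all add: binomial_fact)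
      then show "(case (a, p - a, p' - a, q' - (p - a)) of (a, b, c, d) \<Rightarrow>
          fact p' * fact q' * (A ^ a / fact a * (B ^ b / fact b) * (C ^ c / fact c) * (D ^ d / fact d))) =
          (of_nat (p' choose a) * A ^ a * C ^ (p' - a)) * (of_nat (q' choose (p - a)) * B ^ (p - a) * D ^ (q' - (p - a)))"
        by (simp add: mult_ac)
    qed (auto simp: joinings_def)
    finally show ?thesis by (simp add: joining_sum_def sum_distrib_left case_prod_unfold)
  qed
  show ?thesis
    using sym_avg_self_adjoint[OF K, of N "split_power p x y" "split_power p' z w"] I J
    by (simp add: I_def A_def B_def C_def D_def mult_ac)
qed

section \<open>The identity for finitely many basis indices\<close>

definition tensor_inner :: "'k set \<Rightarrow> nat \<Rightarrow> nat \<Rightarrow> 'k tensor \<Rightarrow> 'k tensor \<Rightarrow> complex" where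
  "tensor_inner K a b T U = (\<Sum>ks\<in>tuples K a. \<Sum>ls\<in>tuples K b. T ks ls * cnj (U ks ls))"

lemma tensor_inner_self:
  assumes "finite K"
  shows "tensor_inner K a b T T = of_real ((tensor_norm K a b T)\<^sup>2)"
proof -
  have "(tensor_norm K a b T)\<^sup>2 = (\<Sum>(ks, ls)\<in>index_pairs K a b. (cmod (T ks ls))\<^sup>2)"
    using finite_tuples[OF assms] by (simp add: tensor_norm_def sum_nonneg case_prod_unfold)
  then show ?thesis
    by (simp only: tensor_inner_def sum.cartesian_product case_prod_unfold of_real_sum complex_norm_square)
qed

lemma tensor_inner_bound:
  assumes "finite K"
  shows "cmod (tensor_inner K a b T U) \<le> tensor_norm K a b T * tensor_norm K a b U"
proof -
  have fin: "finite (index_pairs K a b)" using finite_tuples[OF assms] by simp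
  have "tensor_inner K a b T U = (\<Sum>x\<in>index_pairs K a b. case_prod T x * cnj (case_prod U x))"
    by (simp add: tensor_inner_def sum.cartesian_product case_prod_unfold)
  moreover have "l2_norm (index_pairs K a b) (\<lambda>x. cnj (case_prod U x)) = tensor_norm K a b U"
    by (simp add: tensor_norm_eq_l2_norm l2_norm_def)
  ultimately show ?thesis
    using l2_Cauchy_Schwarz(2)[of "index_pairs K a b" "case_prod T" "\<lambda>x. cnj (case_prod U x)"] fin
    by (simp add: square_summable_finite tensor_norm_eq_l2_norm)
qed

lemma sum_product_factor:
  "(\<Sum>w\<in>A \<times> B. s * (F (fst w) * G (snd w))) = s * ((\<Sum>u\<in>A. F u) * (\<Sum>v\<in>B. G v :: complex))"
proof -
  have "(\<Sum>u\<in>A. F u) * (\<Sum>v\<in>B. G v) = (\<Sum>w\<in>A \<times> B. F (fst w) * G (snd w))"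
    by (simp only: sum_product sum.cartesian_product case_prod_unfold)
  then show ?thesis by (simp only: sum_distrib_left)
qed

lemma tensor_inner_expansion:
  assumes T: "\<And>ks ls. ks \<in> tuples K a \<Longrightarrow> ls \<in> tuples K b \<Longrightarrow> T ks ls = (\<Sum>x\<in>X. D x * P x ks * cnj (R x ls))"
    and U: "\<And>ks ls. ks \<in> tuples K a \<Longrightarrow> ls \<in> tuples K b \<Longrightarrow> U ks ls = (\<Sum>y\<in>X. E y * P' y ks * cnj (R' y ls))"
  shows "tensor_inner K a b T U = (\<Sum>(x, y)\<in>X \<times> X. D x * cnj (E y) *
      (\<Sum>ks\<in>tuples K a. P x ks * cnj (P' y ks)) * cnj (\<Sum>ls\<in>tuples K b. R x ls * cnj (R' y ls)))"
proof -
  have "tensor_inner K a b T U = (\<Sum>ks\<in>tuples K a. \<Sum>ls\<in>tuples K b. \<Sum>w\<in>X \<times> X.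
      D (fst w) * cnj (E (snd w)) * (P (fst w) (ks) * cnj (P' (snd w) (ks))) * cnj (R (fst w) (ls) * cnj (R' (snd w) (ls))))"
    unfolding tensor_inner_def
    by (intro sum.cong refl) (simp add: T U sum_product sum.cartesian_product case_prod_unfold mult_ac)
  also have "\<dots> = (\<Sum>z\<in>index_pairs K a b. \<Sum>w\<in>X \<times> X.
      D (fst w) * cnj (E (snd w)) * (P (fst w) (fst z) * cnj (P' (snd w) (fst z))) * cnj (R (fst w) (snd z) * cnj (R' (snd w) (snd z))))"
    by (subst sum.cartesian_product) (simp only: case_prod_unfold)
  also have "\<dots> = (\<Sum>w\<in>X \<times> X. \<Sum>z\<in>index_pairs K a b.
      D (fst w) * cnj (E (snd w)) * (P (fst w) (fst z) * cnj (P' (snd w) (fst z))) * cnj (R (fst w) (snd z) * cnj (R' (snd w) (snd z))))"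
    by (rule sum.swap)
  also have "\<dots> = (\<Sum>w\<in>X \<times> X. D (fst w) * cnj (E (snd w)) *
      (\<Sum>ks\<in>tuples K a. P (fst w) ks * cnj (P' (snd w) ks)) * cnj (\<Sum>ls\<in>tuples K b. R (fst w) ls * cnj (R' (snd w) ls)))"
  proof (rule sum.cong[OF refl])
    fix w
    let ?A = "\<lambda>ks. P (fst w) ks * cnj (P' (snd w) ks)" and ?B = "\<lambda>ls. cnj (R (fst w) ls * cnj (R' (snd w) ls))"
    have "(\<Sum>z\<in>index_pairs K a b. D (fst w) * cnj (E (snd w)) * ?A (fst z) * ?B (snd z))
       = D (fst w) * cnj (E (snd w)) * ((\<Sum>ks\<in>tuples K a. ?A ks) * (\<Sum>ls\<in>tuples K b. ?B ls))"
      by (simp only: sum_product_factor[symmetric] mult.assoc)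
    then show "(\<Sum>z\<in>index_pairs K a b. D (fst w) * cnj (E (snd w)) * ?A (fst z) * ?B (snd z)) = D (fst w) * cnj (E (snd w)) *
      (\<Sum>ks\<in>tuples K a. ?A ks) * cnj (\<Sum>ls\<in>tuples K b. R (fst w) ls * cnj (R' (snd w) ls))"
      by (simp only: cnj_sum mult.assoc)
  qed
  finally show ?thesis by (simp only: case_prod_unfold)
qed

lemma prod_list_mult_distrib: "(\<Prod>k\<leftarrow>ks. f k * g k) = (\<Prod>k\<leftarrow>ks. f k) * (\<Prod>k\<leftarrow>ks. g k :: complex)"
  by (induction ks) (auto simp: mult_ac)

lemma cnj_prod_list: "cnj (\<Prod>k\<leftarrow>ks. f k) = (\<Prod>k\<leftarrow>ks. cnj (f k))"
  by (induction ks) auto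

lemma contraction_pow_tensor:
  assumes K: "finite K" and ij: "i \<le> a" "i \<le> d" "j \<le> b" "j \<le> c"
    and ks: "ks \<in> tuples K ((a - i) + (c - j))" and ls: "ls \<in> tuples K ((b - j) + (d - i))"
  shows "contraction K a b c d i j (pow_tensor K a b x) (pow_tensor K c d y) ks ls =
    herm K x y ^ i * herm K y x ^ j * split_power (a - i) x y ks * cnj (split_power (b - j) x y ls)"
proof -
  let ?k = "take (a - i) ks" and ?k' = "drop (a - i) ks" and ?l = "take (b - j) ls" and ?l' = "drop (b - j) ls"
  have t: "?k \<in> tuples K (a - i)" "?k' \<in> tuples K (c - j)" "?l \<in> tuples K (b - j)" "?l' \<in> tuples K (d - i)"
    using ks ls take_drop_in_tuples by blast+
  let ?S = "split_power (a - i) x y ks * cnj (split_power (b - j) x y ls)"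
  have "contraction K a b c d i j (pow_tensor K a b x) (pow_tensor K c d y) ks ls =
     (\<Sum>(u, v)\<in>index_pairs K i j. pow_tensor K a b x (?k @ u) (?l @ v) * pow_tensor K c d y (?k' @ v) (?l' @ u))"
    using ks ls K by (simp add: contraction_def finite_tuples)
  also have "\<dots> = (\<Sum>(u, v)\<in>index_pairs K i j. ?S * ((\<Prod>k\<leftarrow>u. x k * cnj (y k)) * (\<Prod>k\<leftarrow>v. y k * cnj (x k))))"
  proof (rule sum.cong[OF refl], clarify)
    fix u v assume uv: "u \<in> tuples K i" "v \<in> tuples K j"
    have m: "?k @ u \<in> tuples K a" "?l @ v \<in> tuples K b" "?k' @ v \<in> tuples K c" "?l' @ u \<in> tuples K d"
      using append_in_tuples[OF t(1) uv(1)] append_in_tuples[OF t(3) uv(2)]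
        append_in_tuples[OF t(2) uv(2)] append_in_tuples[OF t(4) uv(1)] ij by simp_all
    then show "pow_tensor K a b x (?k @ u) (?l @ v) * pow_tensor K c d y (?k' @ v) (?l' @ u) =
        ?S * ((\<Prod>k\<leftarrow>u. x k * cnj (y k)) * (\<Prod>k\<leftarrow>v. y k * cnj (x k)))"
      by (simp add: pow_tensor_def split_power_def prod_list_mult_distrib cnj_prod_list mult_ac)
  qed
  also have "\<dots> = ?S * ((\<Sum>u\<in>tuples K i. \<Prod>k\<leftarrow>u. x k * cnj (y k)) * (\<Sum>v\<in>tuples K j. \<Prod>k\<leftarrow>v. y k * cnj (x k)))"
    unfolding case_prod_unfold by (rule sum_product_factor)
  also have "\<dots> = ?S * (herm K x y ^ i * herm K y x ^ j)"
    by (simp add: sum_tuples_prod[OF K] herm_def)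
  finally show ?thesis by (simp add: mult_ac)
qed

text \<open>
The form in which polarization presents a symmetric tensor.
\<close>

definition power_sum :: "'k set \<Rightarrow> nat \<Rightarrow> nat \<Rightarrow> 'a set \<Rightarrow> ('a \<Rightarrow> 'k \<Rightarrow> complex) \<Rightarrow> ('a \<Rightarrow> complex) \<Rightarrow> 'k tensor" where
  "power_sum K m n I x c = (\<lambda>ks ls. \<Sum>\<alpha>\<in>I. c \<alpha> * pow_tensor K m n (x \<alpha>) ks ls)"

definition pair_coeff :: "'k set \<Rightarrow> ('a \<Rightarrow> 'k \<Rightarrow> complex) \<Rightarrow> ('a \<Rightarrow> complex) \<Rightarrow> ('a \<Rightarrow> complex) \<Rightarrow> nat \<Rightarrow> nat \<Rightarrow> 'a \<times> 'a \<Rightarrow> complex" where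
  "pair_coeff K x c d i j = (\<lambda>(\<alpha>, \<beta>). c \<alpha> * d \<beta> * (herm K (x \<alpha>) (x \<beta>) ^ i * herm K (x \<beta>) (x \<alpha>) ^ j))"

text \<open>
Fourfold sums of this form arise from inner products of two contractions, the conjugated coefficients coming from the
second one.
\<close>

definition quad_sum :: "'a set \<Rightarrow> ('a \<Rightarrow> complex) \<Rightarrow> ('a \<Rightarrow> complex) \<Rightarrow> ('a \<Rightarrow> 'a \<Rightarrow> 'a \<Rightarrow> 'a \<Rightarrow> complex) \<Rightarrow> complex" where
  "quad_sum I c d \<Phi> = (\<Sum>((\<alpha>, \<beta>), (\<gamma>, \<delta>))\<in>(I \<times> I) \<times> (I \<times> I). c \<alpha> * d \<beta> * cnj (c \<gamma>) * cnj (d \<delta>) * \<Phi> \<alpha> \<beta> \<gamma> \<delta>)"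

text \<open>
The quotient of the weights in \<open>config_sum_grouped\<close> by the factors from \<open>sym_split_power_inner\<close> for the two groups of
indices.
\<close>

definition grouping_coeff :: "nat \<Rightarrow> nat \<Rightarrow> nat \<Rightarrow> nat \<Rightarrow> nat \<times> nat \<times> nat \<times> nat \<Rightarrow> complex" where
  "grouping_coeff m n p q = (\<lambda>(i, j, i', j'). crossing_weight (m + n) (i + j) / (fact i * fact j * fact i' * fact j') *
     (fact ((m - i) + (p - j)) / (fact (m - i) * fact (p - j) * fact (m - i') * fact (p - j'))) *
     (fact ((n - j) + (q - i)) / (fact (n - j) * fact (q - i) * fact (n - j') * fact (q - i'))))"

definition cycle_coeff :: "nat \<Rightarrow> nat \<Rightarrow> nat \<Rightarrow> nat \<Rightarrow> nat \<times> nat \<Rightarrow> real" where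
  "cycle_coeff m n p q = (\<lambda>(i, j). 1 / ((fact i)\<^sup>2 * (fact j)\<^sup>2 * fact (m - i) * fact (p - j) * fact (n - j) * fact (q - i)))"

lemma cnj_joining_sum:
  "cnj (joining_sum r1 r2 s1 s2 A B C D) = joining_sum r1 r2 s1 s2 (cnj A) (cnj B) (cnj C) (cnj D)"
  by (simp add: joining_sum_def case_prod_unfold cnj_sum)

text \<open>
Contracting with the conjugate kernel conjugates one coefficient in each of the two contractions. The same fourfold
coefficients arise after the vertices are renamed.
\<close>

lemma quad_sum_relabel:
  "quad_sum I c (\<lambda>\<alpha>. cnj (c \<alpha>)) \<Phi> = quad_sum I c c (\<lambda>\<alpha> \<beta> \<gamma> \<delta>. \<Phi> \<alpha> \<gamma> \<delta> \<beta>)"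
  "quad_sum I c (\<lambda>\<alpha>. cnj (c \<alpha>)) \<Phi> = quad_sum I c c (\<lambda>\<alpha> \<beta> \<gamma> \<delta>. \<Phi> \<alpha> \<delta> \<gamma> \<beta>)"
  "quad_sum I c c \<Phi> = quad_sum I c c (\<lambda>\<alpha> \<beta> \<gamma> \<delta>. \<Phi> \<alpha> \<beta> \<delta> \<gamma>)"
  unfolding quad_sum_def
  by (rule sum.reindex_bij_witness[where
        j="\<lambda>((\<alpha>, \<beta>), (\<gamma>, \<delta>)). ((\<alpha>, \<delta>), (\<beta>, \<gamma>))" and i="\<lambda>((\<alpha>, \<beta>), (\<gamma>, \<delta>)). ((\<alpha>, \<gamma>), (\<delta>, \<beta>))"], auto simp: mult_ac)
    (rule sum.reindex_bij_witness[where
        j="\<lambda>((\<alpha>, \<beta>), (\<gamma>, \<delta>)). ((\<alpha>, \<delta>), (\<gamma>, \<beta>))" and i="\<lambda>((\<alpha>, \<beta>), (\<gamma>, \<delta>)). ((\<alpha>, \<delta>), (\<gamma>, \<beta>))"], auto simp: mult_ac,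
     rule sum.reindex_bij_witness[where
        j="\<lambda>((\<alpha>, \<beta>), (\<gamma>, \<delta>)). ((\<alpha>, \<beta>), (\<delta>, \<gamma>))" and i="\<lambda>((\<alpha>, \<beta>), (\<gamma>, \<delta>)). ((\<alpha>, \<beta>), (\<delta>, \<gamma>))"], auto simp: mult_ac)

lemma quad_sum_sum:
  "quad_sum I c d (\<lambda>\<alpha> \<beta> \<gamma> \<delta>. \<Sum>s\<in>S. \<Phi> s \<alpha> \<beta> \<gamma> \<delta>) = (\<Sum>s\<in>S. quad_sum I c d (\<Phi> s))"
  unfolding quad_sum_def case_prod_unfold sum_distrib_left by (rule sum.swap)

context
  fixes K :: "'k set" and I :: "'a set" and x :: "'a \<Rightarrow> 'k \<Rightarrow> complex"
  assumes K: "finite K"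
begin

abbreviation plain_pair where
  "plain_pair m n p q c d i j \<equiv> contraction K m n p q i j (power_sum K m n I x c) (power_sum K p q I x d)"

abbreviation sym_pair where
  "sym_pair m n p q c d i j \<equiv> sym_contraction K m n p q i j (power_sum K m n I x c) (power_sum K p q I x d)"

lemma contraction_power_sum:
  assumes ij: "i \<le> m" "i \<le> q" "j \<le> n" "j \<le> p"
    and ks: "ks \<in> tuples K ((m - i) + (p - j))" and ls: "ls \<in> tuples K ((n - j) + (q - i))"
  shows "plain_pair m n p q c d i j ks ls =
     (\<Sum>z\<in>I \<times> I. pair_coeff K x c d i j z * split_power (m - i) (x (fst z)) (x (snd z)) ks *
        cnj (split_power (n - j) (x (fst z)) (x (snd z)) ls))"
proof -
  let ?F = "\<lambda>\<alpha> u v. pow_tensor K m n (x \<alpha>) (take (m - i) ks @ u) (take (n - j) ls @ v)"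
  let ?G = "\<lambda>\<beta> u v. pow_tensor K p q (x \<beta>) (drop (m - i) ks @ v) (drop (n - j) ls @ u)"
  have "plain_pair m n p q c d i j ks ls =
     (\<Sum>w\<in>index_pairs K i j. (\<Sum>\<alpha>\<in>I. c \<alpha> * ?F \<alpha> (fst w) (snd w)) * (\<Sum>\<beta>\<in>I. d \<beta> * ?G \<beta> (fst w) (snd w)))"
    using ks ls K by (simp add: contraction_def power_sum_def finite_tuples case_prod_unfold)
  also have "\<dots> = (\<Sum>w\<in>index_pairs K i j. \<Sum>z\<in>I \<times> I. c (fst z) * d (snd z) * (?F (fst z) (fst w) (snd w) * ?G (snd z) (fst w) (snd w)))"
    by (simp add: sum_product sum.cartesian_product case_prod_unfold mult_ac)
  also have "\<dots> = (\<Sum>z\<in>I \<times> I. \<Sum>w\<in>index_pairs K i j. c (fst z) * d (snd z) * (?F (fst z) (fst w) (snd w) * ?G (snd z) (fst w) (snd w)))"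
    by (rule sum.swap)
  also have "\<dots> = (\<Sum>z\<in>I \<times> I. c (fst z) * d (snd z) * contraction K m n p q i j (pow_tensor K m n (x (fst z))) (pow_tensor K p q (x (snd z))) ks ls)"
    using ks ls K by (simp add: contraction_def finite_tuples case_prod_unfold sum_distrib_left)
  finally show ?thesis
    by (simp add: contraction_pow_tensor[OF K ij ks ls] pair_coeff_def case_prod_unfold mult_ac)
qed

lemma sym_contraction_power_sum:
  assumes ij: "i \<le> m" "i \<le> q" "j \<le> n" "j \<le> p"
    and N1: "N1 = (m - i) + (p - j)" and N2: "N2 = (n - j) + (q - i)"
    and ks: "ks \<in> tuples K N1" and ls: "ls \<in> tuples K N2"
  shows "sym_pair m n p q c d i j ks ls =
     (\<Sum>z\<in>I \<times> I. pair_coeff K x c d i j z * sym_avg N1 (split_power (m - i) (x (fst z)) (x (snd z))) ks *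
        cnj (sym_avg N2 (split_power (n - j) (x (fst z)) (x (snd z))) ls))"
proof -
  let ?P = "{\<sigma>. \<sigma> permutes {..<N1}}" and ?Q = "{\<sigma>. \<sigma> permutes {..<N2}}"
  let ?A = "\<lambda>z. split_power (m - i) (x (fst z)) (x (snd z))" and ?B = "\<lambda>z. split_power (n - j) (x (fst z)) (x (snd z))"
  have "sym_pair m n p q c d i j ks ls =
    (\<Sum>\<sigma>\<in>?P. \<Sum>\<tau>\<in>?Q. \<Sum>z\<in>I \<times> I. pair_coeff K x c d i j z * ?A z (permute_list \<sigma> ks) * cnj (?B z (permute_list \<tau> ls))) / (fact N1 * fact N2)"
    unfolding sym_contraction_def symmetrize_def N1[symmetric] N2[symmetric]
    using ks ls
    by (simp add: contraction_power_sum[OF ij, folded N1 N2] permute_list_in_tuples)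
  also have "(\<Sum>\<sigma>\<in>?P. \<Sum>\<tau>\<in>?Q. \<Sum>z\<in>I \<times> I. pair_coeff K x c d i j z * ?A z (permute_list \<sigma> ks) * cnj (?B z (permute_list \<tau> ls)))
    = (\<Sum>w\<in>?P \<times> ?Q. \<Sum>z\<in>I \<times> I. pair_coeff K x c d i j z * ?A z (permute_list (fst w) ks) * cnj (?B z (permute_list (snd w) ls)))"
    by (subst sum.cartesian_product) (simp only: case_prod_unfold)
  also have "(\<Sum>w\<in>?P \<times> ?Q. \<Sum>z\<in>I \<times> I. pair_coeff K x c d i j z * ?A z (permute_list (fst w) ks) * cnj (?B z (permute_list (snd w) ls)))
    = (\<Sum>z\<in>I \<times> I. \<Sum>w\<in>?P \<times> ?Q. pair_coeff K x c d i j z * ?A z (permute_list (fst w) ks) * cnj (?B z (permute_list (snd w) ls)))"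
    by (rule sum.swap)
  also have "\<dots> = (\<Sum>z\<in>I \<times> I. pair_coeff K x c d i j z * ((\<Sum>\<sigma>\<in>?P. ?A z (permute_list \<sigma> ks)) * (\<Sum>\<tau>\<in>?Q. cnj (?B z (permute_list \<tau> ls)))))"
    by (simp only: sum_product_factor[symmetric] mult.assoc)
  also have "\<dots> / (fact N1 * fact N2) = (\<Sum>z\<in>I \<times> I. pair_coeff K x c d i j z * sym_avg N1 (?A z) ks * cnj (sym_avg N2 (?B z) ls))"
    by (subst sum_divide_distrib) (simp add: sym_avg_def mult.assoc)
  finally show ?thesis .
qed

abbreviation gram :: "'a \<Rightarrow> 'a \<Rightarrow> complex" where "gram \<alpha> \<beta> \<equiv> herm K (x \<alpha>) (x \<beta>)"

text \<open>
A contraction of powers is again a product of powers, times inner products for the contracted indices. So the inner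
product of two symmetrized contractions is a sum over joinings, for each of the two groups of free indices.
\<close>

lemma sym_contraction_inner:
  assumes idx: "(i, j, i', j') \<in> pair_indices m n p q"
  shows "grouping_coeff m n p q (i, j, i', j') *
    tensor_inner K ((m - i) + (p - j)) ((n - j) + (q - i))
      (sym_pair m n p q c d i j)
      (sym_pair m n p q c d i' j') =
    quad_sum I c d (\<lambda>\<alpha> \<beta> \<gamma> \<delta>. crossing_weight (m + n) (i + j) / (fact i * fact j * fact i' * fact j') *
      (gram \<alpha> \<beta> ^ i * gram \<beta> \<alpha> ^ j * gram \<delta> \<gamma> ^ i' * gram \<gamma> \<delta> ^ j') *
      joining_sum (m - i) (p - j) (m - i') (p - j') (gram \<alpha> \<gamma>) (gram \<alpha> \<delta>) (gram \<beta> \<gamma>) (gram \<beta> \<delta>) *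
      joining_sum (n - j) (q - i) (n - j') (q - i') (gram \<gamma> \<alpha>) (gram \<delta> \<alpha>) (gram \<gamma> \<beta>) (gram \<delta> \<beta>))"
proof -
  have b: "i \<le> m" "i \<le> q" "j \<le> n" "j \<le> p" "i' \<le> m" "i' \<le> q" "j' \<le> n" "j' \<le> p" "i + j = i' + j'"
    using idx by (auto simp: pair_indices_def)
  define N1 where "N1 = (m - i) + (p - j)"
  define N2 where "N2 = (n - j) + (q - i)"
  have N1': "N1 = (m - i') + (p - j')" and N2': "N2 = (n - j') + (q - i')" using b by (auto simp: N1_def N2_def)
  define \<kappa>1 where "\<kappa>1 = (fact (m - i) * fact (p - j) * fact (m - i') * fact (p - j') / fact N1 :: complex)"
  define \<kappa>2 where "\<kappa>2 = (fact (n - j) * fact (q - i) * fact (n - j') * fact (q - i') / fact N2 :: complex)"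
  define g where "g = crossing_weight (m + n) (i + j) / (fact i * fact j * fact i' * fact j')"
  have coeff: "grouping_coeff m n p q (i, j, i', j') * (\<kappa>1 * \<kappa>2) = g"
    by (simp add: grouping_coeff_def \<kappa>1_def \<kappa>2_def g_def N1_def N2_def)
  let ?J1 = "\<lambda>\<alpha> \<beta> \<gamma> \<delta>. joining_sum (m - i) (p - j) (m - i') (p - j') (gram \<alpha> \<gamma>) (gram \<alpha> \<delta>) (gram \<beta> \<gamma>) (gram \<beta> \<delta>)"
  let ?J2 = "\<lambda>\<alpha> \<beta> \<gamma> \<delta>. joining_sum (n - j) (q - i) (n - j') (q - i') (gram \<gamma> \<alpha>) (gram \<delta> \<alpha>) (gram \<gamma> \<beta>) (gram \<delta> \<beta>)"
  have "tensor_inner K N1 N2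
      (sym_pair m n p q c d i j)
      (sym_pair m n p q c d i' j') =
    (\<Sum>(z, w)\<in>(I \<times> I) \<times> (I \<times> I). pair_coeff K x c d i j z * cnj (pair_coeff K x c d i' j' w) *
      (\<kappa>1 * ?J1 (fst z) (snd z) (fst w) (snd w)) * cnj (\<kappa>2 *
        joining_sum (n - j) (q - i) (n - j') (q - i') (gram (fst z) (fst w)) (gram (fst z) (snd w)) (gram (snd z) (fst w)) (gram (snd z) (snd w))))"
  proof -
    have "tensor_inner K N1 N2
      (sym_pair m n p q c d i j)
      (sym_pair m n p q c d i' j') =
      (\<Sum>(z, w)\<in>(I \<times> I) \<times> (I \<times> I). pair_coeff K x c d i j z * cnj (pair_coeff K x c d i' j' w) *
        (\<Sum>ks\<in>tuples K N1. sym_avg N1 (split_power (m - i) (x (fst z)) (x (snd z))) ks *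
            cnj (sym_avg N1 (split_power (m - i') (x (fst w)) (x (snd w))) ks)) *
        cnj (\<Sum>ls\<in>tuples K N2. sym_avg N2 (split_power (n - j) (x (fst z)) (x (snd z))) ls *
            cnj (sym_avg N2 (split_power (n - j') (x (fst w)) (x (snd w))) ls)))"
      by (rule tensor_inner_expansion)
        (rule sym_contraction_power_sum[OF b(1-4) N1_def N2_def] sym_contraction_power_sum[OF b(5-8) N1' N2']; assumption)+
    then show ?thesis
      by (simp only: sym_split_power_inner[OF K N1_def[symmetric] N1'[symmetric]]
        sym_split_power_inner[OF K N2_def[symmetric] N2'[symmetric]] \<kappa>1_def[symmetric] \<kappa>2_def[symmetric])
  qed
  also have "\<dots> = quad_sum I c d (\<lambda>\<alpha> \<beta> \<gamma> \<delta>. (\<kappa>1 * \<kappa>2) *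
      ((gram \<alpha> \<beta> ^ i * gram \<beta> \<alpha> ^ j * gram \<delta> \<gamma> ^ i' * gram \<gamma> \<delta> ^ j') * ?J1 \<alpha> \<beta> \<gamma> \<delta> * ?J2 \<alpha> \<beta> \<gamma> \<delta>))"
    unfolding quad_sum_def
    by (intro sum.cong refl)
      (simp add: case_prod_unfold pair_coeff_def cnj_joining_sum cnj_herm \<kappa>2_def mult_ac)
  finally have "grouping_coeff m n p q (i, j, i', j') * tensor_inner K N1 N2
      (sym_pair m n p q c d i j)
      (sym_pair m n p q c d i' j') =
      quad_sum I c d (\<lambda>\<alpha> \<beta> \<gamma> \<delta>. (grouping_coeff m n p q (i, j, i', j') * (\<kappa>1 * \<kappa>2)) *
      ((gram \<alpha> \<beta> ^ i * gram \<beta> \<alpha> ^ j * gram \<delta> \<gamma> ^ i' * gram \<gamma> \<delta> ^ j') * ?J1 \<alpha> \<beta> \<gamma> \<delta> * ?J2 \<alpha> \<beta> \<gamma> \<delta>))"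
    by (simp add: quad_sum_def sum_distrib_left case_prod_unfold mult_ac)
  then show ?thesis
    unfolding coeff N1_def[symmetric] N2_def[symmetric] g_def[symmetric] by (simp only: mult.assoc)
qed

lemma contraction_inner:
  assumes b: "i \<le> m" "i \<le> q" "j \<le> n" "j \<le> p"
  shows "tensor_inner K ((m - i) + (p - j)) ((n - j) + (q - i))
      (plain_pair m n p q c d i j)
      (plain_pair m n p q c d i j) =
    quad_sum I c d (\<lambda>\<alpha> \<beta> \<gamma> \<delta>.
      (gram \<alpha> \<beta> ^ i * gram \<beta> \<alpha> ^ j * gram \<delta> \<gamma> ^ i * gram \<gamma> \<delta> ^ j) *
      (gram \<alpha> \<gamma> ^ (m - i) * gram \<beta> \<delta> ^ (p - j)) * (gram \<gamma> \<alpha> ^ (n - j) * gram \<delta> \<beta> ^ (q - i)))"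
proof -
  have "tensor_inner K ((m - i) + (p - j)) ((n - j) + (q - i))
      (plain_pair m n p q c d i j)
      (plain_pair m n p q c d i j) =
    (\<Sum>(z, w)\<in>(I \<times> I) \<times> (I \<times> I). pair_coeff K x c d i j z * cnj (pair_coeff K x c d i j w) *
        (\<Sum>ks\<in>tuples K ((m - i) + (p - j)). split_power (m - i) (x (fst z)) (x (snd z)) ks *
            cnj (split_power (m - i) (x (fst w)) (x (snd w)) ks)) *
        cnj (\<Sum>ls\<in>tuples K ((n - j) + (q - i)). split_power (n - j) (x (fst z)) (x (snd z)) ls *
            cnj (split_power (n - j) (x (fst w)) (x (snd w)) ls)))"
    by (rule tensor_inner_expansion) (rule contraction_power_sum[OF b]; assumption)+
  also have "\<dots> = quad_sum I c d (\<lambda>\<alpha> \<beta> \<gamma> \<delta>.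
      (gram \<alpha> \<beta> ^ i * gram \<beta> \<alpha> ^ j * gram \<delta> \<gamma> ^ i * gram \<gamma> \<delta> ^ j) *
      (gram \<alpha> \<gamma> ^ (m - i) * gram \<beta> \<delta> ^ (p - j)) * (gram \<gamma> \<alpha> ^ (n - j) * gram \<delta> \<beta> ^ (q - i)))"
    unfolding quad_sum_def split_power_inner[OF K]
    by (intro sum.cong refl) (simp add: case_prod_unfold pair_coeff_def cnj_herm mult_ac)
  finally show ?thesis .
qed

text \<open>
The configurations grouped by the edges inside the pairs: \<open>i, j, i', j'\<close> are the numbers of contracted indices.
\<close>

lemma sym_contraction_inner_sum:
  "(\<Sum>(i, j, i', j')\<in>pair_indices m n p q. grouping_coeff m n p q (i, j, i', j') *
    tensor_inner K ((m - i) + (p - j)) ((n - j) + (q - i))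
      (sym_pair m n p q c d i j)
      (sym_pair m n p q c d i' j')) =
   quad_sum I c d (\<lambda>\<alpha> \<beta> \<gamma> \<delta>. \<Sum>A\<in>configs m n p q. crossing_weight (m + n) (edges12 A) * config_weight gram \<alpha> \<beta> \<gamma> \<delta> A)"
  unfolding config_sum_grouped quad_sum_sum
proof (rule sum.cong[OF refl])
  fix s assume s: "s \<in> pair_indices m n p q"
  obtain i j i' j' where eq: "s = (i, j, i', j')" by (cases s)
  show "(case s of (i, j, i', j') \<Rightarrow> grouping_coeff m n p q (i, j, i', j') *
    tensor_inner K ((m - i) + (p - j)) ((n - j) + (q - i))
      (sym_pair m n p q c d i j)
      (sym_pair m n p q c d i' j')) =
    quad_sum I c d (\<lambda>\<alpha> \<beta> \<gamma> \<delta>. case s of (i, j, i', j') \<Rightarrow> crossing_weight (m + n) (i + j) / (fact i * fact j * fact i' * fact j') *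
      (gram \<alpha> \<beta> ^ i * gram \<beta> \<alpha> ^ j * gram \<delta> \<gamma> ^ i' * gram \<gamma> \<delta> ^ j') *
      joining_sum (m - i) (p - j) (m - i') (p - j') (gram \<alpha> \<gamma>) (gram \<alpha> \<delta>) (gram \<beta> \<gamma>) (gram \<beta> \<delta>) *
      joining_sum (n - j) (q - i) (n - j') (q - i') (gram \<gamma> \<alpha>) (gram \<delta> \<alpha>) (gram \<gamma> \<beta>) (gram \<delta> \<beta>))"
    unfolding eq prod.case by (rule sym_contraction_inner[OF s[unfolded eq]])
qed

text \<open>
Without symmetrization, the free indices of the first factors are paired with each other, and so are those of the
second factors. This leaves exactly the four-cycles.
\<close>

lemma contraction_inner_sum:
  "(\<Sum>(i, j)\<in>proper_indices m n p q. of_real (cycle_coeff m n p q (i, j)) *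
    tensor_inner K ((m - i) + (p - j)) ((n - j) + (q - i))
      (plain_pair m n p q c d i j)
      (plain_pair m n p q c d i j)) =
   quad_sum I c d (\<lambda>\<alpha> \<beta> \<gamma> \<delta>. \<Sum>A\<in>configs m n p q. four_cycle (m + n) (edges12 A) (edges14 A) * config_weight gram \<alpha> \<beta> \<gamma> \<delta> A)"
  unfolding config_sum_four_cycles[OF refl] quad_sum_sum case_prod_unfold
  proof (rule sum.cong[OF refl])
    fix s assume "s \<in> proper_indices m n p q"
    then have "fst s \<le> m" "fst s \<le> q" "snd s \<le> n" "snd s \<le> p" by (auto simp: proper_indices_def)
    from contraction_inner[OF this]
    show "of_real (cycle_coeff m n p q (fst s, snd s)) *
      tensor_inner K ((m - fst s) + (p - snd s)) ((n - snd s) + (q - fst s))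
      (plain_pair m n p q c d (fst s) (snd s))
      (plain_pair m n p q c d (fst s) (snd s)) =
      quad_sum I c d (\<lambda>\<alpha> \<beta> \<gamma> \<delta>.
      (gram \<alpha> \<beta> ^ fst s * gram \<beta> \<alpha> ^ snd s * gram \<delta> \<gamma> ^ fst s * gram \<gamma> \<delta> ^ snd s) *
      (gram \<alpha> \<gamma> ^ (m - fst s) * gram \<beta> \<delta> ^ (p - snd s)) * (gram \<gamma> \<alpha> ^ (n - snd s) * gram \<delta> \<beta> ^ (q - fst s)) /
      ((fact (fst s))\<^sup>2 * (fact (snd s))\<^sup>2 * fact (m - fst s) * fact (p - snd s) * fact (n - snd s) * fact (q - fst s)))"
      by (simp add: cycle_coeff_def quad_sum_def sum_divide_distrib case_prod_unfold)
  qed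

end

text \<open>
The kernel of the conjugate of a multiple integral; see \<open>kernel_of_conjugate\<close>.
\<close>

definition conj_kernel :: "'k tensor \<Rightarrow> 'k tensor" where
  "conj_kernel f = (\<lambda>ks ls. cnj (f ls ks))"

text \<open>
An upper bound for the combination of inner products of symmetrized contractions, by Cauchy--Schwarz.
\<close>

definition sym_side :: "'k set \<Rightarrow> nat \<Rightarrow> nat \<Rightarrow> nat \<Rightarrow> nat \<Rightarrow> 'k tensor \<Rightarrow> 'k tensor \<Rightarrow> real" where
  "sym_side K m n p q f g = (\<Sum>(i, j, i', j')\<in>pair_indices m n p q. cmod (grouping_coeff m n p q (i, j, i', j')) *
     (sym_contraction_norm K m n p q i j f g * sym_contraction_norm K m n p q i' j' f g))"

definition plain_side :: "'k set \<Rightarrow> nat \<Rightarrow> nat \<Rightarrow> nat \<Rightarrow> nat \<Rightarrow> 'k tensor \<Rightarrow> 'k tensor \<Rightarrow> real" where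
  "plain_side K m n p q f g = (\<Sum>(i, j)\<in>proper_indices m n p q. cycle_coeff m n p q (i, j) *
     (contraction_norm K m n p q i j f g)\<^sup>2)"

text \<open>
Apply \<open>config_identity\<close> to the vectors of a polarized form of \<open>f\<close> and sum over all quadruples of them. The three
groupings become the contractions of \<open>f\<close> with itself (once) and with its conjugate kernel (twice). The
four-cycles contribute squared norms, and the other side of the identity is bounded termwise by Cauchy--Schwarz.
\<close>

theorem contraction_norm_inequality_finite:
  fixes K :: "'k set"
  assumes K: "finite K" and f: "f \<in> sym_tensor_space K m n"
  shows "real (m + n) * (2 * plain_side K m n m n f f + plain_side K m n n m f (conj_kernel f)) \<le>
    sym_side K m n m n f f + 2 * sym_side K m n n m f (conj_kernel f)"
proof -
  obtain I :: "('k list \<times> 'k list \<times> (nat \<Rightarrow> nat)) set" and c x where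
    "f = (\<lambda>ks ls. \<Sum>\<alpha>\<in>I. c \<alpha> * pow_tensor K m n (x \<alpha>) ks ls)"
    by (rule sym_tensor_eq_sum_of_powers[OF K f]) (rule that, assumption)
  then have f_eq: "f = power_sum K m n I x c" by (simp only: power_sum_def)
  have h_eq: "conj_kernel f = power_sum K n m I x (\<lambda>\<alpha>. cnj (c \<alpha>))"
    by (auto simp: f_eq conj_kernel_def power_sum_def pow_tensor_def cnj_prod_list fun_eq_iff mult_ac intro!: sum.cong)
  define S where "S = (\<lambda>p q g. \<Sum>(i, j, i', j')\<in>pair_indices m n p q. grouping_coeff m n p q (i, j, i', j') *
    tensor_inner K ((m - i) + (p - j)) ((n - j) + (q - i))
      (sym_contraction K m n p q i j f g) (sym_contraction K m n p q i' j' f g))"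
  have S_bound: "cmod (S p q g) \<le> sym_side K m n p q f g" for p q g
    unfolding S_def sym_side_def
  proof (rule sum_norm_le, clarify)
    fix i j i' j' assume idx: "(i, j, i', j') \<in> pair_indices m n p q"
    then have N: "(m - i) + (p - j) = (m - i') + (p - j')" "(n - j) + (q - i) = (n - j') + (q - i')"
      by (auto simp: pair_indices_def)
    show "cmod (grouping_coeff m n p q (i, j, i', j') *
      tensor_inner K ((m - i) + (p - j)) ((n - j) + (q - i))
      (sym_contraction K m n p q i j f g) (sym_contraction K m n p q i' j' f g))
      \<le> cmod (grouping_coeff m n p q (i, j, i', j')) *
     (sym_contraction_norm K m n p q i j f g * sym_contraction_norm K m n p q i' j' f g)"
      unfolding norm_mult sym_contraction_norm_def N[symmetric]
      by (intro mult_left_mono tensor_inner_bound K norm_ge_zero)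
  qed
  have P_eq: "(\<Sum>(i, j)\<in>proper_indices m n p q. of_real (cycle_coeff m n p q (i, j)) *
    tensor_inner K ((m - i) + (p - j)) ((n - j) + (q - i))
      (contraction K m n p q i j f g) (contraction K m n p q i j f g)) = of_real (plain_side K m n p q f g)" for p q g
    by (simp add: plain_side_def tensor_inner_self[OF K] contraction_norm_def case_prod_unfold)
  let ?r = "\<lambda>\<alpha> \<beta>. herm K (x \<alpha>) (x \<beta>)"
  let ?Q = "quad_sum I c c"
  let ?\<Phi> = "\<lambda>p q \<alpha> \<beta> \<gamma> \<delta>. \<Sum>A\<in>configs m n p q. crossing_weight (m + n) (edges12 A) * config_weight ?r \<alpha> \<beta> \<gamma> \<delta> A"
  let ?\<Psi> = "\<lambda>p q \<alpha> \<beta> \<gamma> \<delta>. \<Sum>A\<in>configs m n p q. four_cycle (m + n) (edges12 A) (edges14 A) * config_weight ?r \<alpha> \<beta> \<gamma> \<delta> A"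
  have S1: "S m n f = ?Q (?\<Phi> m n)"
    using sym_contraction_inner_sum[OF K, of m n m n I x c c] by (simp add: S_def f_eq)
  have S2: "S n m (conj_kernel f) = quad_sum I c (\<lambda>\<alpha>. cnj (c \<alpha>)) (?\<Phi> n m)"
    using sym_contraction_inner_sum[OF K, of m n n m I x c "\<lambda>\<alpha>. cnj (c \<alpha>)"] by (simp add: S_def f_eq[symmetric] h_eq[symmetric])
  have P1: "of_real (plain_side K m n m n f f) = ?Q (?\<Psi> m n)"
    unfolding P_eq[symmetric] using contraction_inner_sum[OF K, of m n m n I x c c] by (simp add: f_eq)
  have P2: "of_real (plain_side K m n n m f (conj_kernel f)) = quad_sum I c (\<lambda>\<alpha>. cnj (c \<alpha>)) (?\<Psi> n m)"
    unfolding P_eq[symmetric] using contraction_inner_sum[OF K, of m n n m I x c "\<lambda>\<alpha>. cnj (c \<alpha>)"]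
    by (simp add: f_eq[symmetric] h_eq[symmetric])
  have lin: "?Q (\<lambda>\<alpha> \<beta> \<gamma> \<delta>. F \<alpha> \<beta> \<gamma> \<delta> + G \<alpha> \<beta> \<gamma> \<delta>) = ?Q F + ?Q G"
    "?Q (\<lambda>\<alpha> \<beta> \<gamma> \<delta>. e * F \<alpha> \<beta> \<gamma> \<delta>) = e * ?Q F" for F G e
    by (simp_all add: quad_sum_def case_prod_unfold distrib_left sum.distrib sum_distrib_left mult_ac)
  have "S m n f + S n m (conj_kernel f) + S n m (conj_kernel f) =
      ?Q (\<lambda>\<alpha> \<beta> \<gamma> \<delta>. ?\<Phi> m n \<alpha> \<beta> \<gamma> \<delta> + ?\<Phi> n m \<alpha> \<gamma> \<delta> \<beta> + ?\<Phi> n m \<alpha> \<delta> \<gamma> \<beta>)"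
    unfolding lin S1 S2 quad_sum_relabel(1)[of I c "?\<Phi> n m", symmetric]
      quad_sum_relabel(2)[of I c "?\<Phi> n m", symmetric] ..
  also have "\<dots> = ?Q (\<lambda>\<alpha> \<beta> \<gamma> \<delta>. of_nat (m + n) * (?\<Psi> m n \<alpha> \<beta> \<gamma> \<delta> + ?\<Psi> m n \<alpha> \<beta> \<delta> \<gamma> + ?\<Psi> n m \<alpha> \<delta> \<gamma> \<beta>))"
    by (simp only: config_identity[OF refl])
  also have "\<dots> = of_nat (m + n) * (of_real (plain_side K m n m n f f) + of_real (plain_side K m n m n f f) + of_real (plain_side K m n n m f (conj_kernel f)))"
    unfolding lin P1 P2 quad_sum_relabel(3)[of I c "?\<Psi> m n", symmetric]
      quad_sum_relabel(2)[of I c "?\<Psi> n m", symmetric] ..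
  finally have eq: "S m n f + S n m (conj_kernel f) + S n m (conj_kernel f) =
      of_real (real (m + n) * (2 * plain_side K m n m n f f + plain_side K m n n m f (conj_kernel f)))"
    by simp
  have "real (m + n) * (2 * plain_side K m n m n f f + plain_side K m n n m f (conj_kernel f))
      \<le> cmod (S m n f + S n m (conj_kernel f) + S n m (conj_kernel f))"
    unfolding eq by (simp only: norm_of_real abs_ge_self)
  also have "\<dots> \<le> cmod (S m n f) + cmod (S n m (conj_kernel f)) + cmod (S n m (conj_kernel f))"
    by (meson add_right_mono norm_triangle_ineq order_trans)
  finally show ?thesis using S_bound[of m n f] S_bound[of n m "conj_kernel f"] by linarith
qed

section \<open>Contractions and symmetrized contractions\<close>

lemma conj_kernel_in_sym_tensor_space:
  assumes "f \<in> sym_tensor_space K m n"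
  shows "conj_kernel f \<in> sym_tensor_space K n m"
proof -
  have "bij_betw prod.swap (index_pairs K n m) (index_pairs K m n)"
    by (rule bij_betwI[where g=prod.swap]) auto
  from l2_reindex_bij(1)[OF this, of "\<lambda>x. cnj (case_prod f x)"]
  have "square_summable (index_pairs K n m) (case_prod (conj_kernel f)) \<longleftrightarrow> square_summable (index_pairs K m n) (case_prod f)"
    by (simp add: conj_kernel_def case_prod_unfold square_summable_def)
  then show ?thesis using assms by (auto simp: sym_tensor_space_def tensor_space_iff conj_kernel_def)
qed

lemma conj_kernel_restrict_tensor: "conj_kernel (restrict_tensor L f) = restrict_tensor L (conj_kernel f)"
  by (auto simp: conj_kernel_def restrict_tensor_def fun_eq_iff)

lemma side_tendsto:
  assumes f: "f \<in> tensor_space K m n" and g: "g \<in> tensor_space K p q"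
  shows "((\<lambda>L. sym_side K m n p q (restrict_tensor L f) (restrict_tensor L g)) \<longlongrightarrow> sym_side K m n p q f g) (finite_subsets_at_top K)"
    and "((\<lambda>L. plain_side K m n p q (restrict_tensor L f) (restrict_tensor L g)) \<longlongrightarrow> plain_side K m n p q f g) (finite_subsets_at_top K)"
  unfolding sym_side_def plain_side_def case_prod_unfold
  by (intro tendsto_intros contraction_norm_restrict_tendsto f g; auto simp: pair_indices_def proper_indices_def)+

text \<open>
Both sides are continuous along the truncations, which reduces the claim to finitely many basis indices.
\<close>

theorem contraction_norm_inequality:
  assumes f: "f \<in> sym_tensor_space K m n"
  shows "real (m + n) * (2 * plain_side K m n m n f f + plain_side K m n n m f (conj_kernel f)) \<le>
    sym_side K m n m n f f + 2 * sym_side K m n n m f (conj_kernel f)"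
proof (rule tendsto_le)
  have mem: "f \<in> tensor_space K m n" "conj_kernel f \<in> tensor_space K n m"
    using f conj_kernel_in_sym_tensor_space[OF f] by (auto simp: sym_tensor_space_def)
  note lims = side_tendsto[OF mem(1) mem(1)] side_tendsto[OF mem]
  let ?r = "\<lambda>L. restrict_tensor L f" and ?s = "\<lambda>L. restrict_tensor L (conj_kernel f)"
  show "((\<lambda>L. real (m + n) * (2 * plain_side K m n m n (?r L) (?r L) + plain_side K m n n m (?r L) (?s L)))
      \<longlongrightarrow> real (m + n) * (2 * plain_side K m n m n f f + plain_side K m n n m f (conj_kernel f))) (finite_subsets_at_top K)"
    by (intro tendsto_intros lims)
  show "((\<lambda>L. sym_side K m n m n (?r L) (?r L) + 2 * sym_side K m n n m (?r L) (?s L))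
      \<longlongrightarrow> sym_side K m n m n f f + 2 * sym_side K m n n m f (conj_kernel f)) (finite_subsets_at_top K)"
    by (intro tendsto_intros lims)
  show "\<forall>\<^sub>F L in finite_subsets_at_top K. real (m + n) * (2 * plain_side K m n m n (?r L) (?r L) + plain_side K m n n m (?r L) (?s L))
     \<le> sym_side K m n m n (?r L) (?r L) + 2 * sym_side K m n n m (?r L) (?s L)"
  proof (rule eventually_finite_subsets_at_top_weakI)
    fix L assume L: "finite L" "L \<subseteq> K"
    have "sym_side K m n p q (?r L) (restrict_tensor L g) = sym_side L m n p q (?r L) (restrict_tensor L g)"
      "plain_side K m n p q (?r L) (restrict_tensor L g) = plain_side L m n p q (?r L) (restrict_tensor L g)" for p q g
      by (simp_all add: sym_side_def plain_side_def contraction_norm_restrict[OF L(2)])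
    then show "real (m + n) * (2 * plain_side K m n m n (?r L) (?r L) + plain_side K m n n m (?r L) (?s L))
     \<le> sym_side K m n m n (?r L) (?r L) + 2 * sym_side K m n n m (?r L) (?s L)"
      using contraction_norm_inequality_finite[OF L(1) restrict_tensor_sym(1)[OF L(2) L(1) f]]
      by (simp add: conj_kernel_restrict_tensor)
  qed
qed simp

lemma contraction_norm_nonneg [simp]: "0 \<le> contraction_norm K a b c d i j f g"
  by (simp add: contraction_norm_def)

lemma sym_contraction_norm_nonneg [simp]: "0 \<le> sym_contraction_norm K a b c d i j f g"
  by (simp add: sym_contraction_norm_def)

lemma sym_contraction_norm_le:
  assumes "i \<le> a" "i \<le> d" "j \<le> b" "j \<le> c" "f \<in> tensor_space K a b" "g \<in> tensor_space K c d"
  shows "sym_contraction_norm K a b c d i j f g \<le> contraction_norm K a b c d i j f g"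
  unfolding sym_contraction_norm_def contraction_norm_def sym_contraction_def
  by (rule symmetrize_bounded(2)[OF contraction_bounded(1)[OF assms]])

text \<open>
The coefficient vanishes for the pairs \<open>(i, j)\<close> that are excluded, and both factors of every remaining product tend
to zero.
\<close>

lemma sym_side_tendsto_zero:
  assumes "\<And>i j. (i, j) \<in> proper_indices m n p q \<Longrightarrow> (\<lambda>k. sym_contraction_norm K m n p q i j (f k) (g k)) \<longlonglongrightarrow> 0"
  shows "(\<lambda>k. sym_side K m n p q (f k) (g k)) \<longlonglongrightarrow> 0"
  unfolding sym_side_def
proof (rule tendsto_null_sum)
  fix s assume s: "s \<in> pair_indices m n p q"
  obtain i j i' j' where eq: "s = (i, j, i', j')" by (cases s)
  let ?N = "\<lambda>i j k. sym_contraction_norm K m n p q i j (f k) (g k)"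
  have "(\<lambda>k. cmod (grouping_coeff m n p q (i, j, i', j')) * (?N i j k * ?N i' j' k)) \<longlonglongrightarrow> 0"
  proof (cases "0 < i + j \<and> i + j < m + n")
    case True
    then have "(i, j) \<in> proper_indices m n p q" "(i', j') \<in> proper_indices m n p q"
      using s by (auto simp: eq pair_indices_def proper_indices_def)
    from assms[OF this(1)] assms[OF this(2)] show ?thesis
      by (intro tendsto_mult_right_zero tendsto_mult_zero)
  next
    case False
    then have "grouping_coeff m n p q (i, j, i', j') = 0" by (auto simp: grouping_coeff_def crossing_weight_def)
    then show ?thesis by simp
  qed
  then show "(\<lambda>k. case s of (i, j, i', j') \<Rightarrow> cmod (grouping_coeff m n p q (i, j, i', j')) * (?N i j k * ?N i' j' k)) \<longlonglongrightarrow> 0"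
    by (simp add: eq)
qed

lemma cycle_coeff_pos: "0 < cycle_coeff m n p q s"
  by (simp add: cycle_coeff_def case_prod_unfold)

lemma contraction_norm_tendsto_zero:
  assumes lim: "(\<lambda>k. plain_side K m n p q (f k) (g k)) \<longlonglongrightarrow> 0" and ij: "(i, j) \<in> proper_indices m n p q"
  shows "(\<lambda>k. contraction_norm K m n p q i j (f k) (g k)) \<longlonglongrightarrow> 0"
proof -
  let ?N = "\<lambda>k. contraction_norm K m n p q i j (f k) (g k)" and ?c = "cycle_coeff m n p q (i, j)"
  have fin: "finite (proper_indices m n p q)"
    by (rule finite_subset[of _ "{..m} \<times> {..n}"]) (auto simp: proper_indices_def)
  have le: "?c * (?N k)\<^sup>2 \<le> plain_side K m n p q (f k) (g k)" for k
    unfolding plain_side_def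
    using member_le_sum[OF ij, of "\<lambda>(i, j). cycle_coeff m n p q (i, j) * (contraction_norm K m n p q i j (f k) (g k))\<^sup>2"] fin
    by (auto simp: case_prod_unfold less_imp_le[OF cycle_coeff_pos])
  have "(\<lambda>k. plain_side K m n p q (f k) (g k) / ?c) \<longlonglongrightarrow> 0 / ?c"
    using cycle_coeff_pos[of m n p q "(i, j)"] by (intro tendsto_divide lim tendsto_const) simp
  then have "(\<lambda>k. plain_side K m n p q (f k) (g k) / ?c) \<longlonglongrightarrow> 0" by simp
  then have "(\<lambda>k. (?N k)\<^sup>2) \<longlonglongrightarrow> 0"
    by (rule Lim_null_comparison[rotated])
      (use le cycle_coeff_pos[of m n p q "(i, j)"] in \<open>auto simp: pos_le_divide_eq mult.commute\<close>)
  then have "(\<lambda>k. sqrt ((?N k)\<^sup>2)) \<longlonglongrightarrow> sqrt 0" by (rule tendsto_real_sqrt)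
  then show ?thesis by simp
qed

theorem contraction_norms_tendsto_zero_iff:
  assumes mn: "0 < m + n" and f: "\<And>k. f k \<in> sym_tensor_space K m n"
  shows "(\<forall>(i, j)\<in>proper_indices m n m n. (\<lambda>k. contraction_norm K m n m n i j (f k) (f k)) \<longlonglongrightarrow> 0) \<and>
         (\<forall>(i, j)\<in>proper_indices m n n m. (\<lambda>k. contraction_norm K m n n m i j (f k) (conj_kernel (f k))) \<longlonglongrightarrow> 0) \<longleftrightarrow>
         (\<forall>(i, j)\<in>proper_indices m n m n. (\<lambda>k. sym_contraction_norm K m n m n i j (f k) (f k)) \<longlonglongrightarrow> 0) \<and>
         (\<forall>(i, j)\<in>proper_indices m n n m. (\<lambda>k. sym_contraction_norm K m n n m i j (f k) (conj_kernel (f k))) \<longlonglongrightarrow> 0)"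
    (is "?plain1 \<and> ?plain2 \<longleftrightarrow> ?sym1 \<and> ?sym2")
proof
  have mem: "f k \<in> tensor_space K m n" "conj_kernel (f k) \<in> tensor_space K n m" for k
    using f[of k] conj_kernel_in_sym_tensor_space[OF f[of k]] by (auto simp: sym_tensor_space_def)
  have sandwich: "(\<lambda>k. sym_contraction_norm K m n p q i j (f k) (g k)) \<longlonglongrightarrow> 0"
    if "(\<lambda>k. contraction_norm K m n p q i j (f k) (g k)) \<longlonglongrightarrow> 0" "(i, j) \<in> proper_indices m n p q"
      "\<And>k. g k \<in> tensor_space K p q" for p q i j g
    by (rule Lim_null_comparison[OF _ that(1)])
      (use that mem in \<open>auto simp: proper_indices_def intro!: always_eventually sym_contraction_norm_le\<close>)
  assume "?plain1 \<and> ?plain2"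
  then show "?sym1 \<and> ?sym2" using sandwich mem by fast
next
  assume sym: "?sym1 \<and> ?sym2"
  let ?P1 = "\<lambda>k. plain_side K m n m n (f k) (f k)" and ?P2 = "\<lambda>k. plain_side K m n n m (f k) (conj_kernel (f k))"
  let ?R = "\<lambda>k. sym_side K m n m n (f k) (f k) + 2 * sym_side K m n n m (f k) (conj_kernel (f k))"
  have "?R \<longlonglongrightarrow> 0 + 2 * 0"
    by (intro tendsto_add tendsto_mult tendsto_const sym_side_tendsto_zero) (use sym in auto)
  then have R: "?R \<longlonglongrightarrow> 0" by simp
  have nonneg: "0 \<le> plain_side K m n p q g g'" for p q g g'
    unfolding plain_side_def by (rule sum_nonneg) (auto simp: less_imp_le[OF cycle_coeff_pos])
  have le: "2 * ?P1 k + ?P2 k \<le> ?R k" for k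
  proof -
    have "1 * (2 * ?P1 k + ?P2 k) \<le> real (m + n) * (2 * ?P1 k + ?P2 k)"
      by (rule mult_right_mono) (use mn nonneg in auto)
    also have "\<dots> \<le> ?R k" by (rule contraction_norm_inequality[OF f])
    finally show ?thesis by simp
  qed
  have P: "?P1 \<longlonglongrightarrow> 0" "?P2 \<longlonglongrightarrow> 0"
    by (rule Lim_null_comparison[OF _ R], rule always_eventually, rule allI,
        use le nonneg in \<open>smt (verit, best) real_norm_def\<close>)+
  show "?plain1 \<and> ?plain2"
    using contraction_norm_tendsto_zero[OF P(1)] contraction_norm_tendsto_zero[OF P(2)] by blast
qed

section \<open>Gaussian processes\<close>

lemma (in prob_space) centered_gaussian_moments_integrable:
  assumes "centered_gaussian M Y"
  shows "integrable M (\<lambda>\<omega>. \<bar>Y \<omega>\<bar> ^ k)"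
proof -
  have meas [measurable]: "Y \<in> borel_measurable M" using assms by (simp add: centered_gaussian_def)
  consider "AE \<omega> in M. Y \<omega> = 0" | \<sigma> where "\<sigma> > 0" "distributed M lborel Y (normal_density 0 \<sigma>)"
    using assms by (auto simp: centered_gaussian_def)
  then show ?thesis
  proof cases
    case 1
    have "integrable M (\<lambda>\<omega>. (0::real) ^ k)" by simp
    then show ?thesis
      by (rule integrable_cong_AE_imp) (use 1 in \<open>auto elim: eventually_mono\<close>)
  next
    case 2
    have "integrable lborel (\<lambda>x. normal_density 0 \<sigma> x * \<bar>x - 0\<bar> ^ k)"
      by (rule integrable_normal_moment_abs[OF 2(1)])
    then show ?thesis
      using distributed_integrable[OF 2(2), of "\<lambda>x. \<bar>x\<bar> ^ k"] by simp
  qed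
qed

lemma (in prob_space) centered_gaussian_char:
  assumes "centered_gaussian M Y"
  shows "(\<integral>\<omega>. iexp (Y \<omega>) \<partial>M) = of_real (exp (- (\<integral>\<omega>. (Y \<omega>)\<^sup>2 \<partial>M) / 2))"
proof -
  have meas [measurable]: "Y \<in> borel_measurable M" using assms by (simp add: centered_gaussian_def)
  consider "AE \<omega> in M. Y \<omega> = 0" | \<sigma> where "\<sigma> > 0" "distributed M lborel Y (normal_density 0 \<sigma>)"
    using assms by (auto simp: centered_gaussian_def)
  then show ?thesis
  proof cases
    case 1
    have "(\<integral>\<omega>. iexp (Y \<omega>) \<partial>M) = (\<integral>\<omega>. 1 \<partial>M)"
      by (rule integral_cong_AE) (use 1 in \<open>auto elim: eventually_mono\<close>)
    moreover have "(\<integral>\<omega>. (Y \<omega>)\<^sup>2 \<partial>M) = (\<integral>\<omega>. 0 \<partial>M)"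
      by (rule integral_cong_AE) (use 1 in \<open>auto elim: eventually_mono\<close>)
    ultimately show ?thesis by (simp add: prob_space)
  next
    case 2
    define G where "G = (\<lambda>\<omega>. (Y \<omega> - 0) / \<sigma>)"
    have G [measurable]: "G \<in> borel_measurable M" unfolding G_def by measurable
    have D: "distributed M lborel G std_normal_density"
      unfolding G_def using 2 normal_standard_normal_convert[OF 2(1), of Y 0] by simp
    have "(\<integral>\<omega>. iexp (Y \<omega>) \<partial>M) = (\<integral>\<omega>. iexp (\<sigma> * G \<omega>) \<partial>M)"
      using 2(1) by (intro Bochner_Integration.integral_cong) (auto simp: G_def)
    also have "\<dots> = (\<integral>x. iexp (\<sigma> * x) \<partial>distr M lborel G)"
      by (rule integral_distr[symmetric]) auto
    also have "\<dots> = char std_normal_distribution \<sigma>"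
      unfolding distributed_distr_eq_density[OF D] by (simp add: char_def)
    also have "\<dots> = of_real (exp (- (\<sigma>\<^sup>2) / 2))"
      by (simp add: char_std_normal_distribution)
    also have "\<sigma>\<^sup>2 = (\<integral>\<omega>. (Y \<omega>)\<^sup>2 \<partial>M)"
      using normal_distributed_variance[OF 2] normal_distributed_expectation[OF 2] by simp
    finally show ?thesis .
  qed
qed

context prob_space
begin

context
  fixes X :: "'h::real_inner \<Rightarrow> 'a \<Rightarrow> real"
  assumes X: "real_isonormal M X"
begin

lemma isonormal_scaled_gaussian: "centered_gaussian M (\<lambda>\<omega>. c * X h \<omega>)"
proof -
  have "\<forall>S c. finite S \<longrightarrow> centered_gaussian M (\<lambda>\<omega>. \<Sum>h\<in>S. c h * X h \<omega>)"
    using X by (simp add: real_isonormal_def)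
  from this[rule_format, of "{h}" "\<lambda>_. c"] show ?thesis by simp
qed

lemma isonormal_measurable [measurable]: "X h \<in> borel_measurable M"
  using isonormal_scaled_gaussian[of 1 h] by (simp add: centered_gaussian_def)

lemma isonormal_moments_integrable: "integrable M (\<lambda>\<omega>. \<bar>X h \<omega>\<bar> ^ k)"
  using centered_gaussian_moments_integrable[OF isonormal_scaled_gaussian[of 1 h]] by simp

lemma isonormal_product_integrable: "integrable M (\<lambda>\<omega>. X g \<omega> * X h \<omega>)"
proof (rule Bochner_Integration.integrable_bound)
  show "integrable M (\<lambda>\<omega>. \<bar>X g \<omega>\<bar> ^ 2 + \<bar>X h \<omega>\<bar> ^ 2)"
    by (intro Bochner_Integration.integrable_add isonormal_moments_integrable)
  have "\<bar>a * b\<bar> \<le> a\<^sup>2 + b\<^sup>2" for a b :: real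
  proof -
    have "2 * \<bar>a * b\<bar> \<le> a\<^sup>2 + b\<^sup>2"
      using sum_squares_bound[of "\<bar>a\<bar>" "\<bar>b\<bar>"] by (simp add: abs_mult)
    then show ?thesis using abs_ge_zero[of "a * b"] by linarith
  qed
  then show "AE \<omega> in M. norm (X g \<omega> * X h \<omega>) \<le> norm (\<bar>X g \<omega>\<bar> ^ 2 + \<bar>X h \<omega>\<bar> ^ 2)"
    by simp
qed measurable

lemma isonormal_covariance: "(\<integral>\<omega>. X g \<omega> * X h \<omega> \<partial>M) = g \<bullet> h"
  using X by (simp add: real_isonormal_def)

text \<open>
The variance of the difference is zero by the covariance formula.
\<close>

lemma isonormal_linear: "AE \<omega> in M. X (u + r *\<^sub>R v) \<omega> = X u \<omega> + r * X v \<omega>"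
proof -
  let ?w = "u + r *\<^sub>R v"
  let ?D = "\<lambda>\<omega>. (X ?w \<omega> - X u \<omega> - r * X v \<omega>)\<^sup>2"
  have eq: "?D = (\<lambda>\<omega>. X ?w \<omega> * X ?w \<omega> + X u \<omega> * X u \<omega> + r\<^sup>2 * (X v \<omega> * X v \<omega>)
      - 2 * (X ?w \<omega> * X u \<omega>) - 2 * r * (X ?w \<omega> * X v \<omega>) + 2 * r * (X u \<omega> * X v \<omega>))"
    by (rule ext) (simp add: power2_eq_square algebra_simps)
  have int: "integrable M ?D"
    unfolding eq by (intro Bochner_Integration.integrable_add Bochner_Integration.integrable_diff
      integrable_mult_right isonormal_product_integrable)
  have "(\<integral>\<omega>. ?D \<omega> \<partial>M) = ?w \<bullet> ?w + u \<bullet> u + r\<^sup>2 * (v \<bullet> v) - 2 * (?w \<bullet> u) - 2 * r * (?w \<bullet> v) + 2 * r * (u \<bullet> v)"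
    unfolding eq by (simp add: isonormal_product_integrable isonormal_covariance)
  also have "\<dots> = 0" by (simp add: inner_add_left inner_add_right inner_commute[of v u] power2_eq_square algebra_simps)
  finally have "AE \<omega> in M. ?D \<omega> = 0" using integral_nonneg_eq_0_iff_AE[OF int] by simp
  then show ?thesis by eventually_elim simp
qed

lemma isonormal_char: "(\<integral>\<omega>. iexp (c * X h \<omega>) \<partial>M) = of_real (exp (- (c\<^sup>2 * (norm h)\<^sup>2) / 2))"
proof -
  have "(\<integral>\<omega>. (c * X h \<omega>)\<^sup>2 \<partial>M) = c\<^sup>2 * (\<integral>\<omega>. X h \<omega> * X h \<omega> \<partial>M)"
    by (simp add: power2_eq_square mult_ac)
  then show ?thesis
    using centered_gaussian_char[OF isonormal_scaled_gaussian[of c h]]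
    by (simp add: isonormal_covariance power2_norm_eq_inner)
qed

end

end

text \<open>
The properties of a complex isonormal process from which the expectations below are computed. Linearity is only
stated for real parts along real directions; \<open>Z_rotate\<close> supplies the imaginary parts.
\<close>

locale complex_gaussian_process = prob_space M for M :: "'w measure" +
  fixes Z :: "'h::real_inner complexified \<Rightarrow> 'w \<Rightarrow> complex"
  assumes Z_measurable [measurable]: "\<And>h. Z h \<in> borel_measurable M"
    and Z_moments: "\<And>h k. integrable M (\<lambda>\<omega>. cmod (Z h \<omega>) ^ k)"
    and Z_char: "\<And>w. (\<integral>\<omega>. iexp (Re (Z w \<omega>)) \<partial>M) = of_real (exp (- (norm w)\<^sup>2 / 4))"
    and Z_linear: "\<And>w r v. AE \<omega> in M. Re (Z (w + r *\<^sub>R v) \<omega>) = Re (Z w \<omega>) + r * Re (Z v \<omega>)"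
    and Z_rotate: "\<And>h. AE \<omega> in M. Re (Z (snd h, - fst h) \<omega>) = Im (Z h \<omega>)"

text \<open>
The real part of \<open>Z w\<close> is a sum of two independent centered Gaussian variables, which gives its characteristic
function. Multiplying the argument by \<open>-\<i>\<close> turns real parts into imaginary parts.
\<close>

lemma complex_isonormal_imp_process:
  assumes "prob_space M" "complex_isonormal M Z"
  shows "complex_gaussian_process M Z"
proof -
  interpret prob_space M by fact
  obtain X Y where X: "real_isonormal M X" and Y: "real_isonormal M Y"
    and ind: "indep_var (Pi\<^sub>M UNIV (\<lambda>_. borel)) (\<lambda>\<omega> h. X h \<omega>) (Pi\<^sub>M UNIV (\<lambda>_. borel)) (\<lambda>\<omega> h. Y h \<omega>)"
    and Zeq: "\<And>h \<omega>. \<omega> \<in> space M \<Longrightarrow> Z h \<omega> =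
           (complex_extension X h \<omega> + \<i> * complex_extension Y h \<omega>) / complex_of_real (sqrt 2)"
    using assms(2) unfolding complex_isonormal_def by blast
  note [measurable] = isonormal_measurable[OF X] isonormal_measurable[OF Y]
  have Re: "Re (Z h \<omega>) = (X (fst h) \<omega> - Y (snd h) \<omega>) / sqrt 2"
    and Im: "Im (Z h \<omega>) = (X (snd h) \<omega> + Y (fst h) \<omega>) / sqrt 2" if "\<omega> \<in> space M" for h \<omega>
    using Zeq[OF that, of h] by (simp_all add: complex_extension_def)
  show ?thesis
  proof
    show meas [measurable]: "Z h \<in> borel_measurable M" for h
    proof -
      have "(\<lambda>\<omega>. (complex_extension X h \<omega> + \<i> * complex_extension Y h \<omega>) / complex_of_real (sqrt 2)) \<in> borel_measurable M"
        unfolding complex_extension_def by measurable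
      then show ?thesis by (simp add: Zeq cong: measurable_cong)
    qed
    show "integrable M (\<lambda>\<omega>. cmod (Z h \<omega>) ^ k)" for h k
    proof (rule Bochner_Integration.integrable_bound)
      let ?B = "\<lambda>\<omega>. 4 ^ k * (\<bar>X (fst h) \<omega>\<bar> ^ k + \<bar>Y (snd h) \<omega>\<bar> ^ k + \<bar>X (snd h) \<omega>\<bar> ^ k + \<bar>Y (fst h) \<omega>\<bar> ^ k)"
      show "integrable M ?B"
        by (intro integrable_mult_right Bochner_Integration.integrable_add
            isonormal_moments_integrable[OF X] isonormal_moments_integrable[OF Y])
      have pw: "(a + b + c + d) ^ k \<le> 4 ^ k * (a ^ k + b ^ k + c ^ k + d ^ k)"
        if "0 \<le> a" "0 \<le> b" "0 \<le> c" "0 \<le> d" for a b c d :: real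
      proof -
        let ?m = "max (max a b) (max c d)"
        have "(a + b + c + d) ^ k \<le> (4 * ?m) ^ k" using that by (intro power_mono) auto
        also have "\<dots> = 4 ^ k * ?m ^ k" by (simp add: power_mult_distrib)
        also have "?m ^ k \<le> a ^ k + b ^ k + c ^ k + d ^ k"
          using that by (auto simp: max_def add_increasing add_increasing2)
        finally show ?thesis by simp
      qed
      show "AE \<omega> in M. norm (cmod (Z h \<omega>) ^ k) \<le> norm (?B \<omega>)"
      proof (rule AE_I2)
        fix \<omega> assume \<omega>: "\<omega> \<in> space M"
        have s: "\<bar>x / sqrt 2\<bar> \<le> \<bar>x\<bar>" for x :: real
          using mult_left_mono[of 1 "sqrt 2" "\<bar>x\<bar>"] by (simp add: divide_le_eq)
        have "cmod (Z h \<omega>) \<le> \<bar>Re (Z h \<omega>)\<bar> + \<bar>Im (Z h \<omega>)\<bar>" by (rule cmod_le)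
        also have "\<dots> \<le> \<bar>X (fst h) \<omega>\<bar> + \<bar>Y (snd h) \<omega>\<bar> + \<bar>X (snd h) \<omega>\<bar> + \<bar>Y (fst h) \<omega>\<bar>"
          using s[of "X (fst h) \<omega> - Y (snd h) \<omega>"] s[of "X (snd h) \<omega> + Y (fst h) \<omega>"]
          unfolding Re[OF \<omega>] Im[OF \<omega>] by linarith
        finally have "cmod (Z h \<omega>) ^ k \<le> (\<bar>X (fst h) \<omega>\<bar> + \<bar>Y (snd h) \<omega>\<bar> + \<bar>X (snd h) \<omega>\<bar> + \<bar>Y (fst h) \<omega>\<bar>) ^ k"
          by (intro power_mono) auto
        also have "\<dots> \<le> ?B \<omega>" by (rule pw) auto
        finally show "norm (cmod (Z h \<omega>) ^ k) \<le> norm (?B \<omega>)" by simp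
      qed
    qed measurable
    show "(\<integral>\<omega>. iexp (Re (Z w \<omega>)) \<partial>M) = of_real (exp (- (norm w)\<^sup>2 / 4))" for w
    proof -
      let ?c = "1 / sqrt 2"
      have "(\<integral>\<omega>. iexp (Re (Z w \<omega>)) \<partial>M) = (\<integral>\<omega>. iexp (?c * X (fst w) \<omega>) * iexp (- ?c * Y (snd w) \<omega>) \<partial>M)"
        by (intro Bochner_Integration.integral_cong refl)
          (simp add: Re exp_add[symmetric] diff_divide_distrib algebra_simps)
      also have "\<dots> = (\<integral>\<omega>. iexp (?c * X (fst w) \<omega>) \<partial>M) * (\<integral>\<omega>. iexp (- ?c * Y (snd w) \<omega>) \<partial>M)"
      proof (rule indep_var_lebesgue_integral)
        have "indep_var borel ((\<lambda>f. iexp (?c * f (fst w))) \<circ> (\<lambda>\<omega> h. X h \<omega>)) borel ((\<lambda>f. iexp (- ?c * f (snd w))) \<circ> (\<lambda>\<omega> h. Y h \<omega>))"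
          by (rule indep_var_compose[OF ind]) measurable
        then show "indep_var borel (\<lambda>\<omega>. iexp (?c * X (fst w) \<omega>)) borel (\<lambda>\<omega>. iexp (- ?c * Y (snd w) \<omega>))"
          by (simp add: o_def)
        show "integrable M (\<lambda>\<omega>. iexp (?c * X (fst w) \<omega>))" "integrable M (\<lambda>\<omega>. iexp (- ?c * Y (snd w) \<omega>))"
          by (rule integrable_const_bound[where B=1]; (rule AE_I2, rule norm_exp_i_times[THEN eq_refl] | measurable))+
      qed
      also have "\<dots> = of_real (exp (- (?c\<^sup>2 * (norm (fst w))\<^sup>2) / 2)) * of_real (exp (- ((- ?c)\<^sup>2 * (norm (snd w))\<^sup>2) / 2))"
        by (simp only: isonormal_char[OF X] isonormal_char[OF Y])
      also have "\<dots> = of_real (exp (- (norm w)\<^sup>2 / 4))"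
      proof -
        have "(norm w)\<^sup>2 = (norm (fst w))\<^sup>2 + (norm (snd w))\<^sup>2"
          by (simp add: norm_prod_def)
        then show ?thesis
          by (simp add: of_real_mult[symmetric] exp_add[symmetric] power_divide add_divide_distrib del: of_real_mult)
      qed
      finally show ?thesis .
    qed
    show "AE \<omega> in M. Re (Z (w + r *\<^sub>R v) \<omega>) = Re (Z w \<omega>) + r * Re (Z v \<omega>)" for w r v
    proof -
      have "AE \<omega> in M. X (fst w + r *\<^sub>R fst v) \<omega> = X (fst w) \<omega> + r * X (fst v) \<omega>" by (rule isonormal_linear[OF X])
      moreover have "AE \<omega> in M. Y (snd w + r *\<^sub>R snd v) \<omega> = Y (snd w) \<omega> + r * Y (snd v) \<omega>" by (rule isonormal_linear[OF Y])
      moreover have "AE \<omega> in M. \<omega> \<in> space M" by simp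
      ultimately show ?thesis
        by eventually_elim (simp add: Re add_divide_distrib diff_divide_distrib algebra_simps)
    qed
    show "AE \<omega> in M. Re (Z (snd h, - fst h) \<omega>) = Im (Z h \<omega>)" for h
    proof -
      have "AE \<omega> in M. Y (fst h + (- 2) *\<^sub>R fst h) \<omega> = Y (fst h) \<omega> + (- 2) * Y (fst h) \<omega>" by (rule isonormal_linear[OF Y])
      moreover have "fst h + (- 2) *\<^sub>R fst h = - fst h"
        by (simp add: scaleR_2)
      ultimately have "AE \<omega> in M. Y (- fst h) \<omega> = - Y (fst h) \<omega>" by simp
      moreover have "AE \<omega> in M. \<omega> \<in> space M" by simp
      ultimately show ?thesis by eventually_elim (simp add: Re Im)
    qed
  qed
qed

section \<open>Gaussian integration by parts\<close>

definition herm_prod :: "'h::real_inner complexified \<Rightarrow> 'h complexified \<Rightarrow> complex" where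
  "herm_prod h w = Complex (fst h \<bullet> fst w + snd h \<bullet> snd w) (snd h \<bullet> fst w - fst h \<bullet> snd w)"

definition times_minus_i :: "'h::real_inner complexified \<Rightarrow> 'h complexified" where
  "times_minus_i h = (snd h, - fst h)"

lemma herm_prod_shift: "herm_prod h (w + r *\<^sub>R v) = herm_prod h w + of_real r * herm_prod h v"
  by (simp add: herm_prod_def complex_eq_iff inner_add_right algebra_simps)

lemma herm_prod_self: "herm_prod h h = of_real ((norm h)\<^sup>2)"
  by (simp add: herm_prod_def complex_eq_iff norm_prod_def power2_norm_eq_inner inner_commute)

lemma herm_prod_times_minus_i: "herm_prod h (times_minus_i h) = \<i> * of_real ((norm h)\<^sup>2)"
  by (simp add: herm_prod_def times_minus_i_def complex_eq_iff norm_prod_def power2_norm_eq_inner inner_commute)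

lemma herm_prod_minus: "herm_prod h (- w) = - herm_prod h w"
  by (simp add: herm_prod_def complex_eq_iff)

lemma cnj_measurable [measurable (raw)]:
  "f \<in> borel_measurable M \<Longrightarrow> (\<lambda>x. cnj (f x)) \<in> borel_measurable M"
proof -
  assume f: "f \<in> borel_measurable M"
  have "cnj \<in> borel_measurable borel"
    by (rule borel_measurable_continuous_onI) (rule continuous_on_cnj[OF continuous_on_id, unfolded o_def])
  from measurable_compose[OF f this] show ?thesis .
qed

text \<open>
Derivatives along a direction are only needed as limits of difference quotients with these increments.
\<close>

definition step_size :: "nat \<Rightarrow> real" where "step_size k = inverse (real (Suc k))"

lemma step_size_pos [simp]: "step_size k > 0" "step_size k \<noteq> 0"
  by (simp_all add: step_size_def)

lemma step_size_tendsto: "step_size \<longlonglongrightarrow> 0"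
  unfolding step_size_def by (rule LIMSEQ_inverse_real_of_nat)

text \<open>
Dominated convergence: the difference quotient of the exponential is bounded by \<open>\<bar>U\<bar>\<close>.
\<close>

lemma (in prob_space) iexp_integral_difference_quotient:
  fixes F :: "'a \<Rightarrow> complex" and L U :: "'a \<Rightarrow> real"
  assumes [measurable]: "L \<in> borel_measurable M" "U \<in> borel_measurable M"
    and F: "integrable M F" and FU: "integrable M (\<lambda>\<omega>. F \<omega> * of_real (U \<omega>))"
  shows "(\<lambda>k. ((\<integral>\<omega>. F \<omega> * iexp (L \<omega> + step_size k * U \<omega>) \<partial>M) - (\<integral>\<omega>. F \<omega> * iexp (L \<omega>) \<partial>M)) / of_real (step_size k))
    \<longlonglongrightarrow> (\<integral>\<omega>. \<i> * (of_real (U \<omega>) * (F \<omega> * iexp (L \<omega>))) \<partial>M)"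
proof -
  have [measurable]: "F \<in> borel_measurable M" using F by auto
  have int: "integrable M (\<lambda>\<omega>. F \<omega> * iexp (G \<omega>))" if [measurable]: "G \<in> borel_measurable M" for G
    by (rule Bochner_Integration.integrable_bound[OF F]) (auto simp: norm_mult)
  let ?q = "\<lambda>k \<omega>. F \<omega> * iexp (L \<omega>) * ((iexp (step_size k * U \<omega>) - 1) / of_real (step_size k))"
  have eq: "((\<integral>\<omega>. F \<omega> * iexp (L \<omega> + step_size k * U \<omega>) \<partial>M) - (\<integral>\<omega>. F \<omega> * iexp (L \<omega>) \<partial>M)) / of_real (step_size k)
      = (\<integral>\<omega>. ?q k \<omega> \<partial>M)" for k
  proof -
    have "(\<integral>\<omega>. F \<omega> * iexp (L \<omega> + step_size k * U \<omega>) \<partial>M) - (\<integral>\<omega>. F \<omega> * iexp (L \<omega>) \<partial>M)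
       = (\<integral>\<omega>. F \<omega> * iexp (L \<omega> + step_size k * U \<omega>) - F \<omega> * iexp (L \<omega>) \<partial>M)"
      by (rule Bochner_Integration.integral_diff[symmetric]; rule int; measurable)
    also have "(\<lambda>\<omega>. F \<omega> * iexp (L \<omega> + step_size k * U \<omega>) - F \<omega> * iexp (L \<omega>)) = (\<lambda>\<omega>. ?q k \<omega> * of_real (step_size k))"
      by (rule ext) (simp add: exp_add distrib_left right_diff_distrib)
    finally show ?thesis by simp
  qed
  have "(\<lambda>k. \<integral>\<omega>. ?q k \<omega> \<partial>M) \<longlonglongrightarrow> (\<integral>\<omega>. \<i> * (of_real (U \<omega>) * (F \<omega> * iexp (L \<omega>))) \<partial>M)"
  proof (rule integral_dominated_convergence[where w="\<lambda>\<omega>. cmod (F \<omega> * of_real (U \<omega>))"])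
    show "integrable M (\<lambda>\<omega>. cmod (F \<omega> * of_real (U \<omega>)))" using FU by (rule integrable_norm)
    show "AE \<omega> in M. norm (?q k \<omega>) \<le> cmod (F \<omega> * of_real (U \<omega>))" for k
    proof (rule AE_I2)
      fix \<omega>
      have "cmod (iexp (step_size k * U \<omega>) - 1) \<le> \<bar>step_size k * U \<omega>\<bar>"
        using iexp_approx1[of "step_size k * U \<omega>" 0] by simp
      then have "cmod ((iexp (step_size k * U \<omega>) - 1) / of_real (step_size k)) \<le> \<bar>U \<omega>\<bar>"
        by (simp add: norm_divide abs_mult divide_le_eq mult.commute)
      moreover have "norm (F \<omega> * iexp (L \<omega>) * B) \<le> cmod (F \<omega> * of_real (U \<omega>))" if "cmod B \<le> \<bar>U \<omega>\<bar>" for B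
        using that by (simp add: norm_mult mult_left_mono)
      ultimately show "norm (?q k \<omega>) \<le> cmod (F \<omega> * of_real (U \<omega>))" by blast
    qed
    show "AE \<omega> in M. (\<lambda>k. ?q k \<omega>) \<longlonglongrightarrow> \<i> * (of_real (U \<omega>) * (F \<omega> * iexp (L \<omega>)))"
    proof (rule AE_I2)
      fix \<omega>
      have "(\<lambda>k. (iexp (step_size k * U \<omega>) - 1) / of_real (step_size k) - \<i> * of_real (U \<omega>)) \<longlonglongrightarrow> 0"
      proof (rule Lim_null_comparison)
        show "\<forall>\<^sub>F k in sequentially. norm ((iexp (step_size k * U \<omega>) - 1) / of_real (step_size k) - \<i> * of_real (U \<omega>)) \<le> step_size k * (U \<omega>)\<^sup>2 / 2"
        proof (rule always_eventually, rule allI)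
          fix k
          let ?A = "iexp (step_size k * U \<omega>) - (1 + \<i> * of_real (step_size k * U \<omega>))"
          have "(iexp (step_size k * U \<omega>) - 1) / of_real (step_size k) - \<i> * of_real (U \<omega>) =
             (iexp (step_size k * U \<omega>) - (1 + \<i> * of_real (step_size k * U \<omega>))) / of_real (step_size k)"
            by (simp add: field_simps)
          then have "norm ((iexp (step_size k * U \<omega>) - 1) / of_real (step_size k) - \<i> * of_real (U \<omega>)) = cmod ?A / \<bar>step_size k\<bar>"
            by (simp only: norm_divide norm_of_real)
          also have "\<dots> = cmod ?A / step_size k" by (simp only: abs_of_pos[OF step_size_pos(1)])
          also have "\<dots> \<le> (step_size k * U \<omega>)\<^sup>2 / 2 / step_size k"
          proof (rule divide_right_mono)
            show "cmod ?A \<le> (step_size k * U \<omega>)\<^sup>2 / 2"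
              using iexp_approx1[of "step_size k * U \<omega>" 1] by (simp add: numeral_2_eq_2)
          qed (rule less_imp_le[OF step_size_pos(1)])
          also have "\<dots> = step_size k * (U \<omega>)\<^sup>2 / 2" by (simp add: power2_eq_square)
          finally show "norm ((iexp (step_size k * U \<omega>) - 1) / of_real (step_size k) - \<i> * of_real (U \<omega>)) \<le> step_size k * (U \<omega>)\<^sup>2 / 2" .
        qed
        have "(\<lambda>k. step_size k * (U \<omega>)\<^sup>2 / 2) \<longlonglongrightarrow> 0 * (U \<omega>)\<^sup>2 / 2"
          by (intro tendsto_intros step_size_tendsto) auto
        then show "(\<lambda>k. step_size k * (U \<omega>)\<^sup>2 / 2) \<longlonglongrightarrow> 0" by simp
      qed
      then have "(\<lambda>k. (iexp (step_size k * U \<omega>) - 1) / of_real (step_size k)) \<longlonglongrightarrow> \<i> * of_real (U \<omega>)"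
        by (rule LIM_zero_cancel)
      from tendsto_mult_left[OF this, of "F \<omega> * iexp (L \<omega>)"]
      show "(\<lambda>k. ?q k \<omega>) \<longlonglongrightarrow> \<i> * (of_real (U \<omega>) * (F \<omega> * iexp (L \<omega>)))"
        by (simp add: mult_ac)
    qed
  qed measurable
  then show ?thesis by (simp only: eq)
qed

context complex_gaussian_process
begin

text \<open>
The bounded factor \<open>iexp (Re (Z w))\<close> makes every moment depend differentiably on \<open>w\<close>.
\<close>

definition test_moment :: "'h complexified \<Rightarrow> nat \<Rightarrow> nat \<Rightarrow> 'h complexified \<Rightarrow> complex" where
  "test_moment h a b w = (\<integral>\<omega>. Z h \<omega> ^ a * cnj (Z h \<omega>) ^ b * iexp (Re (Z w \<omega>)) \<partial>M)"

definition real_test_moment :: "'h complexified \<Rightarrow> 'h complexified \<Rightarrow> nat \<Rightarrow> nat \<Rightarrow> 'h complexified \<Rightarrow> complex" where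
  "real_test_moment h v a b w = (\<integral>\<omega>. of_real (Re (Z v \<omega>)) * (Z h \<omega> ^ a * cnj (Z h \<omega>) ^ b * iexp (Re (Z w \<omega>))) \<partial>M)"

lemma moment_integrable: "integrable M (\<lambda>\<omega>. Z h \<omega> ^ a * cnj (Z h \<omega>) ^ b)"
  by (rule Bochner_Integration.integrable_bound[OF Z_moments[of h "a + b"]])
    (auto simp: norm_mult norm_power power_add)

lemma moment_product_integrable:
  "integrable M (\<lambda>\<omega>. Z h \<omega> ^ a * cnj (Z h \<omega>) ^ b * of_real (Re (Z v \<omega>)))"
proof (rule Bochner_Integration.integrable_bound)
  show "integrable M (\<lambda>\<omega>. cmod (Z h \<omega>) ^ (2 * (a + b)) + cmod (Z v \<omega>) ^ 2)"
    by (intro Bochner_Integration.integrable_add Z_moments)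
  show "AE \<omega> in M. norm (Z h \<omega> ^ a * cnj (Z h \<omega>) ^ b * of_real (Re (Z v \<omega>)))
      \<le> norm (cmod (Z h \<omega>) ^ (2 * (a + b)) + cmod (Z v \<omega>) ^ 2)"
  proof (rule AE_I2)
    fix \<omega>
    let ?x = "cmod (Z h \<omega>) ^ (a + b)" and ?y = "cmod (Z v \<omega>)"
    have "norm (Z h \<omega> ^ a * cnj (Z h \<omega>) ^ b * of_real (Re (Z v \<omega>))) = ?x * \<bar>Re (Z v \<omega>)\<bar>"
      by (simp add: norm_mult norm_power power_add)
    also have "\<dots> \<le> ?x * ?y" by (intro mult_left_mono abs_Re_le_cmod) auto
    also have "\<dots> \<le> ?x\<^sup>2 + ?y\<^sup>2"
    proof -
      have "2 * (?x * ?y) \<le> ?x\<^sup>2 + ?y\<^sup>2" using sum_squares_bound[of ?x ?y] by simp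
      moreover have "0 \<le> ?x * ?y" by simp
      ultimately show ?thesis by linarith
    qed
    also have "?x\<^sup>2 = cmod (Z h \<omega>) ^ (2 * (a + b))" by (simp add: power_mult[symmetric] mult.commute)
    finally show "norm (Z h \<omega> ^ a * cnj (Z h \<omega>) ^ b * of_real (Re (Z v \<omega>)))
      \<le> norm (cmod (Z h \<omega>) ^ (2 * (a + b)) + cmod (Z v \<omega>) ^ 2)" by simp
  qed
qed measurable

lemma test_moment_integrable: "integrable M (\<lambda>\<omega>. Z h \<omega> ^ a * cnj (Z h \<omega>) ^ b * iexp (Re (Z w \<omega>)))"
  by (rule Bochner_Integration.integrable_bound[OF moment_integrable[of h a b]]) (auto simp: norm_mult)

lemma real_test_moment_integrable:
  "integrable M (\<lambda>\<omega>. of_real (Re (Z v \<omega>)) * (Z h \<omega> ^ a * cnj (Z h \<omega>) ^ b * iexp (Re (Z w \<omega>))))"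
  by (rule Bochner_Integration.integrable_bound[OF moment_product_integrable[of h a b v]]) (auto simp: norm_mult mult_ac)

lemma test_moment_difference_quotient:
  "(\<lambda>k. (test_moment h a b (w + step_size k *\<^sub>R v) - test_moment h a b w) / of_real (step_size k))
     \<longlonglongrightarrow> \<i> * real_test_moment h v a b w"
proof -
  have "test_moment h a b (w + step_size k *\<^sub>R v) =
      (\<integral>\<omega>. Z h \<omega> ^ a * cnj (Z h \<omega>) ^ b * iexp (Re (Z w \<omega>) + step_size k * Re (Z v \<omega>)) \<partial>M)" for k
    unfolding test_moment_def
    by (rule integral_cong_AE) (use Z_linear[of w "step_size k" v] in \<open>auto elim: eventually_mono\<close>)
  then show ?thesis
    using iexp_integral_difference_quotient[OF _ _ moment_integrable[of h a b] moment_product_integrable[of h a b v], of "\<lambda>\<omega>. Re (Z w \<omega>)"]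
    by (simp add: test_moment_def real_test_moment_def)
qed

lemma test_moment_continuous: "(\<lambda>k. test_moment h a b (w + step_size k *\<^sub>R v)) \<longlonglongrightarrow> test_moment h a b w"
proof -
  have "(\<lambda>k. of_real (step_size k) * ((test_moment h a b (w + step_size k *\<^sub>R v) - test_moment h a b w) / of_real (step_size k)) + test_moment h a b w)
     \<longlonglongrightarrow> of_real 0 * (\<i> * real_test_moment h v a b w) + test_moment h a b w"
    by (intro tendsto_intros test_moment_difference_quotient step_size_tendsto)
  then show ?thesis by simp
qed

text \<open>
A factor \<open>Z h\<close> or its conjugate is split into its real and imaginary part, and \<open>Z_rotate\<close> turns the latter into a
real part.
\<close>

lemma test_moment_Suc:
  "test_moment h (Suc a) b w = real_test_moment h h a b w + \<i> * real_test_moment h (times_minus_i h) a b w"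
  "test_moment h a (Suc b) w = real_test_moment h h a b w - \<i> * real_test_moment h (times_minus_i h) a b w"
proof -
  let ?f = "\<lambda>\<omega>. Z h \<omega> ^ a * cnj (Z h \<omega>) ^ b * iexp (Re (Z w \<omega>))"
  have times_minus_i: "real_test_moment h (times_minus_i h) a b w = (\<integral>\<omega>. of_real (Im (Z h \<omega>)) * ?f \<omega> \<partial>M)"
    unfolding real_test_moment_def
    by (rule integral_cong_AE) (use Z_rotate[of h] in \<open>auto simp: times_minus_i_def elim: eventually_mono\<close>)
  have int: "integrable M (\<lambda>\<omega>. of_real (Im (Z h \<omega>)) * ?f \<omega>)"
    by (rule integrable_cong_AE_imp[OF real_test_moment_integrable[of "times_minus_i h" h a b w]])
      (use Z_rotate[of h] in \<open>auto simp: times_minus_i_def elim: eventually_mono\<close>)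
  have z: "Z h \<omega> = of_real (Re (Z h \<omega>)) + \<i> * of_real (Im (Z h \<omega>))"
    "cnj (Z h \<omega>) = of_real (Re (Z h \<omega>)) - \<i> * of_real (Im (Z h \<omega>))" for \<omega>
    by (simp_all add: complex_eq_iff)
  have "test_moment h (Suc a) b w = (\<integral>\<omega>. of_real (Re (Z h \<omega>)) * ?f \<omega> + \<i> * (of_real (Im (Z h \<omega>)) * ?f \<omega>) \<partial>M)"
  proof -
    have "Z h \<omega> ^ Suc a * cnj (Z h \<omega>) ^ b * iexp (Re (Z w \<omega>)) = of_real (Re (Z h \<omega>)) * ?f \<omega> + \<i> * (of_real (Im (Z h \<omega>)) * ?f \<omega>)" for \<omega>
    proof -
      have "Z h \<omega> ^ Suc a * cnj (Z h \<omega>) ^ b * iexp (Re (Z w \<omega>)) = Z h \<omega> * ?f \<omega>" by (simp add: mult_ac)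
      also have "\<dots> = (of_real (Re (Z h \<omega>)) + \<i> * of_real (Im (Z h \<omega>))) * ?f \<omega>" using z(1)[of \<omega>] by argo
      finally show ?thesis by (simp only: distrib_right mult.assoc)
    qed
    then show ?thesis unfolding test_moment_def by presburger
  qed
  then show "test_moment h (Suc a) b w = real_test_moment h h a b w + \<i> * real_test_moment h (times_minus_i h) a b w"
    using int real_test_moment_integrable[of h h a b w] by (simp add: times_minus_i) (simp add: real_test_moment_def)
  have "test_moment h a (Suc b) w = (\<integral>\<omega>. of_real (Re (Z h \<omega>)) * ?f \<omega> - \<i> * (of_real (Im (Z h \<omega>)) * ?f \<omega>) \<partial>M)"
  proof -
    have "Z h \<omega> ^ a * cnj (Z h \<omega>) ^ Suc b * iexp (Re (Z w \<omega>)) = of_real (Re (Z h \<omega>)) * ?f \<omega> - \<i> * (of_real (Im (Z h \<omega>)) * ?f \<omega>)" for \<omega>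
    proof -
      have "Z h \<omega> ^ a * cnj (Z h \<omega>) ^ Suc b * iexp (Re (Z w \<omega>)) = cnj (Z h \<omega>) * ?f \<omega>" by (simp add: mult_ac)
      also have "\<dots> = (of_real (Re (Z h \<omega>)) - \<i> * of_real (Im (Z h \<omega>))) * ?f \<omega>" using z(2)[of \<omega>] by argo
      finally show ?thesis by (simp only: left_diff_distrib mult.assoc)
    qed
    then show ?thesis unfolding test_moment_def by presburger
  qed
  then show "test_moment h a (Suc b) w = real_test_moment h h a b w - \<i> * real_test_moment h (times_minus_i h) a b w"
    using int real_test_moment_integrable[of h h a b w] by (simp add: times_minus_i) (simp add: real_test_moment_def)
qed

lemma test_moment_0: "test_moment h 0 0 w = of_real (exp (- (norm w)\<^sup>2 / 4))"
  by (simp add: test_moment_def Z_char)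

text \<open>
Differentiate the characteristic function along \<open>v\<close>.
\<close>

lemma real_test_moment_0: "real_test_moment h v 0 0 w = (\<i> / 2) * of_real (w \<bullet> v) * test_moment h 0 0 w"
proof -
  \<comment> \<open>The exponent of the characteristic function along the line \<open>w + r v\<close>.\<close>
  define p where "p = (\<lambda>r::real. - ((w \<bullet> w) + 2 * r * (w \<bullet> v) + r\<^sup>2 * (v \<bullet> v)) / 4)"
  have n: "test_moment h 0 0 (w + r *\<^sub>R v) = of_real (exp (p r))" for r
  proof -
    have "(norm (w + r *\<^sub>R v))\<^sup>2 = (w \<bullet> w) + 2 * r * (w \<bullet> v) + r\<^sup>2 * (v \<bullet> v)"
      unfolding power2_norm_eq_inner
      by (simp add: inner_add_left inner_add_right inner_commute[of v w] power2_eq_square algebra_simps)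
    then show ?thesis by (simp add: test_moment_0 p_def)
  qed
  have "((\<lambda>r. exp (p r)) has_real_derivative (- (w \<bullet> v) / 2 * exp (p 0))) (at 0)"
    unfolding p_def by (auto intro!: derivative_eq_intros)
  then have "((\<lambda>r. (exp (p (0 + r)) - exp (p 0)) / r) \<longlongrightarrow> - (w \<bullet> v) / 2 * exp (p 0)) (at 0)"
    by (simp add: DERIV_def)
  moreover have "filterlim step_size (at 0) sequentially"
    using step_size_tendsto by (auto simp: filterlim_at)
  ultimately have "(\<lambda>k. (exp (p (0 + step_size k)) - exp (p 0)) / step_size k) \<longlonglongrightarrow> - (w \<bullet> v) / 2 * exp (p 0)"
    by (rule filterlim_compose)
  then have "(\<lambda>k. (of_real ((exp (p (0 + step_size k)) - exp (p 0)) / step_size k) :: complex)) \<longlonglongrightarrow> of_real (- (w \<bullet> v) / 2 * exp (p 0))"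
    by (rule tendsto_of_real)
  then have "(\<lambda>k. (test_moment h 0 0 (w + step_size k *\<^sub>R v) - test_moment h 0 0 w) / of_real (step_size k)) \<longlonglongrightarrow> of_real (- (w \<bullet> v) / 2) * test_moment h 0 0 w"
    using n[of 0] by (simp add: n)
  from LIMSEQ_unique[OF this test_moment_difference_quotient[of h 0 0 w v]]
  have "\<i> * real_test_moment h v 0 0 w = of_real (- (w \<bullet> v) / 2) * test_moment h 0 0 w" by simp
  then have "\<i> * (\<i> * real_test_moment h v 0 0 w) = \<i> * (of_real (- (w \<bullet> v) / 2) * test_moment h 0 0 w)" by simp
  then show ?thesis by (simp add: mult.assoc[symmetric])
qed

text \<open>
Gaussian integration by parts: the factor \<open>Z h\<close> is paired with the exponential or with one of the \<open>b\<close> conjugate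
factors. Its covariance with the unconjugated factors is zero.
\<close>

definition integration_by_parts :: "'h complexified \<Rightarrow> nat \<Rightarrow> nat \<Rightarrow> bool" where
  "integration_by_parts h a b \<longleftrightarrow> (\<forall>w. test_moment h (Suc a) b w =
     (\<i> / 2) * herm_prod h w * test_moment h a b w + of_nat b * of_real ((norm h)\<^sup>2) * test_moment h a (b - 1) w)"

text \<open>
The formula for the exponents \<open>(a, b)\<close> holds for all \<open>w\<close>, so it can be differentiated in \<open>w\<close>. This produces one more
factor \<open>Re (Z v)\<close>; the directions \<open>h\<close> and \<open>times_minus_i h\<close> together recover a factor \<open>Z h\<close> or its conjugate.
\<close>

lemma integration_by_parts_differentiated:
  assumes "integration_by_parts h a b"
  shows "real_test_moment h v (Suc a) b w =
    herm_prod h v / 2 * test_moment h a b w + (\<i> / 2) * herm_prod h w * real_test_moment h v a b w +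
    of_nat b * of_real ((norm h)\<^sup>2) * real_test_moment h v a (b - 1) w"
proof -
  let ?T = "test_moment h" and ?c = "\<i> / 2" and ?d = "of_nat b * of_real ((norm h)\<^sup>2) :: complex"
  let ?q = "\<lambda>a b k. (?T a b (w + step_size k *\<^sub>R v) - ?T a b w) / of_real (step_size k)"
  have "?q (Suc a) b k = ?c * herm_prod h v * ?T a b (w + step_size k *\<^sub>R v) + ?c * herm_prod h w * ?q a b k + ?d * ?q a (b - 1) k" for k
  proof -
    have s: "of_real (step_size k) \<noteq> (0::complex)" by simp
    have T: "?T (Suc a) b u = ?c * herm_prod h u * ?T a b u + ?d * ?T a (b - 1) u" for u
      using assms unfolding integration_by_parts_def by blast
    show ?thesis unfolding T herm_prod_shift using s by (simp add: field_simps)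
  qed
  then have "?q (Suc a) b = (\<lambda>k. ?c * herm_prod h v * ?T a b (w + step_size k *\<^sub>R v) + ?c * herm_prod h w * ?q a b k + ?d * ?q a (b - 1) k)"
    by (rule ext)
  moreover have "(\<lambda>k. ?c * herm_prod h v * ?T a b (w + step_size k *\<^sub>R v) + ?c * herm_prod h w * ?q a b k + ?d * ?q a (b - 1) k)
     \<longlonglongrightarrow> ?c * herm_prod h v * ?T a b w + ?c * herm_prod h w * (\<i> * real_test_moment h v a b w) + ?d * (\<i> * real_test_moment h v a (b - 1) w)"
    by (intro tendsto_intros test_moment_continuous test_moment_difference_quotient)
  ultimately have "?q (Suc a) b \<longlonglongrightarrow> ?c * herm_prod h v * ?T a b w + ?c * herm_prod h w * (\<i> * real_test_moment h v a b w) + ?d * (\<i> * real_test_moment h v a (b - 1) w)"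
    by simp
  from LIMSEQ_unique[OF test_moment_difference_quotient this]
  have "\<i> * real_test_moment h v (Suc a) b w = \<i> * (herm_prod h v / 2 * test_moment h a b w + (\<i> / 2) * herm_prod h w * real_test_moment h v a b w +
    of_nat b * of_real ((norm h)\<^sup>2) * real_test_moment h v a (b - 1) w)"
    by (simp add: algebra_simps)
  then show ?thesis by simp
qed

lemma integration_by_parts_0: "integration_by_parts h 0 0"
proof -
  have "test_moment h (Suc 0) 0 w = (\<i> / 2) * herm_prod h w * test_moment h 0 0 w" for w
  proof -
    have "of_real (w \<bullet> h) + \<i> * of_real (w \<bullet> times_minus_i h) = herm_prod h w"
      by (simp add: herm_prod_def times_minus_i_def complex_eq_iff inner_prod_def inner_commute)
    moreover have "test_moment h (Suc 0) 0 w = (\<i> / 2) * (of_real (w \<bullet> h) + \<i> * of_real (w \<bullet> times_minus_i h)) * test_moment h 0 0 w"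
      unfolding test_moment_Suc(1) real_test_moment_0 by (simp add: algebra_simps)
    ultimately show ?thesis by simp
  qed
  then show ?thesis by (simp add: integration_by_parts_def)
qed

lemma integration_by_parts_Suc_left:
  assumes "integration_by_parts h a b"
  shows "integration_by_parts h (Suc a) b"
  unfolding integration_by_parts_def
proof
  fix w
  let ?\<rho> = "of_real ((norm h)\<^sup>2) :: complex"
  have "test_moment h (Suc (Suc a)) b w = real_test_moment h h (Suc a) b w + \<i> * real_test_moment h (times_minus_i h) (Suc a) b w"
    by (rule test_moment_Suc)
  also have "\<dots> = (\<i> / 2) * herm_prod h w * (real_test_moment h h a b w + \<i> * real_test_moment h (times_minus_i h) a b w) +
      of_nat b * ?\<rho> * (real_test_moment h h a (b - 1) w + \<i> * real_test_moment h (times_minus_i h) a (b - 1) w)"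
    unfolding integration_by_parts_differentiated[OF assms] herm_prod_self herm_prod_times_minus_i
    by (simp add: algebra_simps)
  finally show "test_moment h (Suc (Suc a)) b w = (\<i> / 2) * herm_prod h w * test_moment h (Suc a) b w + of_nat b * ?\<rho> * test_moment h (Suc a) (b - 1) w"
    by (simp only: test_moment_Suc(1)[symmetric])
qed

lemma integration_by_parts_Suc_right:
  assumes "integration_by_parts h a b"
  shows "integration_by_parts h a (Suc b)"
  unfolding integration_by_parts_def
proof
  fix w
  let ?\<rho> = "of_real ((norm h)\<^sup>2) :: complex"
  have "test_moment h (Suc a) (Suc b) w = real_test_moment h h (Suc a) b w - \<i> * real_test_moment h (times_minus_i h) (Suc a) b w"
    by (rule test_moment_Suc)
  also have "\<dots> = ?\<rho> * test_moment h a b w + (\<i> / 2) * herm_prod h w * (real_test_moment h h a b w - \<i> * real_test_moment h (times_minus_i h) a b w) +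
      of_nat b * ?\<rho> * (real_test_moment h h a (b - 1) w - \<i> * real_test_moment h (times_minus_i h) a (b - 1) w)"
    unfolding integration_by_parts_differentiated[OF assms] herm_prod_self herm_prod_times_minus_i
    by (simp add: algebra_simps)
  also have "of_nat b * ?\<rho> * (real_test_moment h h a (b - 1) w - \<i> * real_test_moment h (times_minus_i h) a (b - 1) w) = of_nat b * ?\<rho> * test_moment h a b w"
    by (cases b) (simp_all add: test_moment_Suc(2)[symmetric])
  finally show "test_moment h (Suc a) (Suc b) w = (\<i> / 2) * herm_prod h w * test_moment h a (Suc b) w + of_nat (Suc b) * ?\<rho> * test_moment h a (Suc b - 1) w"
    by (simp add: test_moment_Suc(2)[symmetric] algebra_simps)
qed

lemma integration_by_parts_all: "integration_by_parts h a b"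
proof (induction a)
  case 0
  show ?case by (induction b) (auto intro: integration_by_parts_0 integration_by_parts_Suc_right)
qed (rule integration_by_parts_Suc_left)

lemma test_moment_cnj: "test_moment h 0 b w = cnj (test_moment h b 0 (- w))"
proof -
  have "w + (- 2) *\<^sub>R w = - w" by (simp add: scaleR_2)
  then have ae: "AE \<omega> in M. Re (Z (- w) \<omega>) = - Re (Z w \<omega>)" using Z_linear[of w "- 2" w] by simp
  have "cnj (test_moment h b 0 (- w)) = (\<integral>\<omega>. cnj (Z h \<omega> ^ b * iexp (Re (Z (- w) \<omega>))) \<partial>M)"
    by (simp add: test_moment_def del: complex_cnj_mult)
  also have "\<dots> = test_moment h 0 b w"
    unfolding test_moment_def
    by (rule integral_cong_AE) (use ae in \<open>auto elim!: eventually_mono simp: exp_cnj\<close>)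
  finally show ?thesis by simp
qed

lemma test_moment_0_Suc: "test_moment h 0 (Suc b) w = (\<i> / 2) * cnj (herm_prod h w) * test_moment h 0 b w"
proof -
  have "test_moment h (Suc b) 0 (- w) = (\<i> / 2) * herm_prod h (- w) * test_moment h b 0 (- w)"
    using integration_by_parts_all[of h b 0, unfolded integration_by_parts_def, rule_format, of "- w"] by simp
  then show ?thesis by (simp add: test_moment_cnj herm_prod_minus)
qed

definition hermite_test :: "'h complexified \<Rightarrow> nat \<Rightarrow> nat \<Rightarrow> 'h complexified \<Rightarrow> complex" where
  "hermite_test h m n w = (\<Sum>k\<le>m. (- 1) ^ k * fact k * of_nat (m choose k) * of_nat (n choose k) *
     of_real ((norm h)\<^sup>2) ^ k * test_moment h (m - k) (n - k) w)"

lemma Suc_times_choose_Suc: "Suc k * (n choose Suc k) = (n - k) * (n choose k)"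
  by (simp only: binomial_absorption binomial_absorb_comp)

text \<open>
The terms in which \<open>Z h\<close> is paired with a conjugate factor are cancelled by the lower order terms of the Hermite
polynomial; only the pairing with the exponential remains.
\<close>

lemma hermite_test_Suc: "hermite_test h (Suc m) n w = (\<i> / 2) * herm_prod h w * hermite_test h m n w"
proof -
  let ?\<rho> = "of_real ((norm h)\<^sup>2) :: complex" and ?\<alpha> = "(\<i> / 2) * herm_prod h w"
  let ?T = "\<lambda>a b. test_moment h a b w"
  let ?c = "\<lambda>k. (- 1) ^ k * fact k * of_nat (n choose k) * ?\<rho> ^ k :: complex"
  \<comment> \<open>The pairings of \<open>Z h\<close> with a conjugate factor.\<close>
  define R where "R = (\<Sum>k\<le>m. (- 1) ^ k * fact k * of_nat (m choose k) * of_nat ((n - k) * (n choose k)) * ?\<rho> ^ Suc k * ?T (m - k) (n - Suc k))"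
  have "hermite_test h (Suc m) n w = (\<Sum>k\<le>Suc m. ?c k * of_nat (Suc m choose k) * ?T (Suc m - k) (n - k))"
    by (simp add: hermite_test_def mult_ac)
  also have "\<dots> = ?T (Suc m) n + (\<Sum>k\<le>m. ?c (Suc k) * of_nat (Suc m choose Suc k) * ?T (m - k) (n - Suc k))"
    by (subst sum.atMost_Suc_shift) simp
  also have "(\<Sum>k\<le>m. ?c (Suc k) * of_nat (Suc m choose Suc k) * ?T (m - k) (n - Suc k)) =
     (\<Sum>k\<le>m. ?c (Suc k) * of_nat (m choose k) * ?T (m - k) (n - Suc k)) +
     (\<Sum>k\<le>m. ?c (Suc k) * of_nat (m choose Suc k) * ?T (m - k) (n - Suc k))"
    by (simp add: sum.distrib[symmetric] distrib_left distrib_right)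
  also have "(\<Sum>k\<le>m. ?c (Suc k) * of_nat (m choose k) * ?T (m - k) (n - Suc k)) = - R"
    unfolding R_def sum_negf[symmetric]
  proof (rule sum.cong[OF refl])
    fix k
    have "?c (Suc k) = - ((- 1) ^ k * fact k * of_nat (Suc k * (n choose Suc k)) * ?\<rho> ^ Suc k)"
      by (simp add: algebra_simps)
    then show "?c (Suc k) * of_nat (m choose k) * ?T (m - k) (n - Suc k) =
      - ((- 1) ^ k * fact k * of_nat (m choose k) * of_nat ((n - k) * (n choose k)) * ?\<rho> ^ Suc k * ?T (m - k) (n - Suc k))"
      unfolding Suc_times_choose_Suc by (simp only: mult_minus_left mult_minus_right mult_ac)
  qed
  also have "?T (Suc m) n + (- R + (\<Sum>k\<le>m. ?c (Suc k) * of_nat (m choose Suc k) * ?T (m - k) (n - Suc k))) =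
     (\<Sum>k\<le>m. ?c k * of_nat (m choose k) * ?T (Suc m - k) (n - k)) - R"
  proof -
    have "?T (Suc m) n + (\<Sum>k\<le>m. ?c (Suc k) * of_nat (m choose Suc k) * ?T (m - k) (n - Suc k)) =
        (\<Sum>k\<le>Suc m. ?c k * of_nat (m choose k) * ?T (Suc m - k) (n - k))"
      by (subst sum.atMost_Suc_shift) simp
    also have "\<dots> = (\<Sum>k\<le>m. ?c k * of_nat (m choose k) * ?T (Suc m - k) (n - k))" by simp
    finally show ?thesis by (simp add: algebra_simps)
  qed
  also have "(\<Sum>k\<le>m. ?c k * of_nat (m choose k) * ?T (Suc m - k) (n - k)) = ?\<alpha> * hermite_test h m n w + R"
  proof -
    have "?c k * of_nat (m choose k) * ?T (Suc m - k) (n - k) =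
        ?\<alpha> * ((- 1) ^ k * fact k * of_nat (m choose k) * of_nat (n choose k) * ?\<rho> ^ k * ?T (m - k) (n - k)) +
        (- 1) ^ k * fact k * of_nat (m choose k) * of_nat ((n - k) * (n choose k)) * ?\<rho> ^ Suc k * ?T (m - k) (n - Suc k)"
      if "k \<in> {..m}" for k
    proof -
      have "?T (Suc m - k) (n - k) = ?\<alpha> * ?T (m - k) (n - k) + of_nat (n - k) * ?\<rho> * ?T (m - k) (n - Suc k)"
        using integration_by_parts_all[of h "m - k" "n - k", unfolded integration_by_parts_def, rule_format, of w] that by (simp add: Suc_diff_le)
      then show ?thesis by (simp only: of_nat_mult power_Suc ring_distribs mult_ac)
    qed
    then show ?thesis by (simp add: R_def hermite_test_def sum.distrib sum_distrib_left)
  qed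
  finally show ?thesis by simp
qed

lemma hermite_test_eq:
  "hermite_test h m n w = ((\<i> / 2) * herm_prod h w) ^ m * ((\<i> / 2) * cnj (herm_prod h w)) ^ n * of_real (exp (- (norm w)\<^sup>2 / 4))"
proof (induction m)
  case 0
  have "hermite_test h 0 n w = test_moment h 0 n w" by (simp add: hermite_test_def)
  also have "\<dots> = ((\<i> / 2) * cnj (herm_prod h w)) ^ n * of_real (exp (- (norm w)\<^sup>2 / 4))"
    by (induction n) (simp_all add: test_moment_0 test_moment_0_Suc)
  finally show ?case by simp
next
  case (Suc m)
  then show ?case by (simp add: hermite_test_Suc)
qed

text \<open>
Pairings inside the Hermite polynomial cancel, so every factor is paired with the exponential.
\<close>

theorem expectation_complex_hermite_iexp:
  "(\<integral>\<omega>. complex_hermite m n (Z h \<omega>) ((norm h)\<^sup>2) * iexp (Re (Z w \<omega>)) \<partial>M) =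
   ((\<i> / 2) * herm_prod h w) ^ m * ((\<i> / 2) * cnj (herm_prod h w)) ^ n * of_real (exp (- (norm w)\<^sup>2 / 4))"
proof -
  let ?c = "\<lambda>k. (- 1) ^ k * fact k * of_nat (m choose k) * of_nat (n choose k) * of_real ((norm h)\<^sup>2) ^ k :: complex"
  have "(\<integral>\<omega>. complex_hermite m n (Z h \<omega>) ((norm h)\<^sup>2) * iexp (Re (Z w \<omega>)) \<partial>M) =
     (\<integral>\<omega>. (\<Sum>k\<le>min m n. ?c k * (Z h \<omega> ^ (m - k) * cnj (Z h \<omega>) ^ (n - k) * iexp (Re (Z w \<omega>)))) \<partial>M)"
    by (simp add: complex_hermite_def sum_distrib_left mult_ac)
  also have "\<dots> = (\<Sum>k\<le>min m n. ?c k * test_moment h (m - k) (n - k) w)"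
    by (simp add: test_moment_integrable test_moment_def)
  also have "\<dots> = hermite_test h m n w"
    unfolding hermite_test_def by (rule sum.mono_neutral_left) auto
  finally show ?thesis by (simp only: hermite_test_eq)
qed

end

section \<open>Kernels of multiple integrals\<close>

definition from_coords :: "('k \<Rightarrow> 'h::real_inner) \<Rightarrow> 'k set \<Rightarrow> ('k \<Rightarrow> complex) \<Rightarrow> 'h complexified" where
  "from_coords e L y = (\<Sum>k\<in>L. Re (y k) *\<^sub>R e k, \<Sum>k\<in>L. Im (y k) *\<^sub>R e k)"

lemma from_coords_uminus: "from_coords e L (\<lambda>k. - y k) = - from_coords e L y"
  by (simp add: from_coords_def sum_negf)

lemma coord_from_coords:
  assumes e: "orthonormal_basis e K" and L: "finite L" "L \<subseteq> K" and y: "\<And>k. k \<notin> L \<Longrightarrow> y k = 0" and k: "k \<in> K"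
  shows "coord e (from_coords e L y) k = y k"
proof -
  have o: "e i \<bullet> e k = (if i = k then 1 else 0)" if "i \<in> L" for i
    using e subsetD[OF L(2) that] k by (simp add: orthonormal_basis_def)
  have "(\<Sum>i\<in>L. c i *\<^sub>R e i) \<bullet> e k = (\<Sum>i\<in>L. if i = k then c i else 0)" for c :: "'a \<Rightarrow> real"
    unfolding inner_sum_left by (rule sum.cong) (simp_all add: o)
  then show ?thesis
    using L(1) y[of k] by (auto simp: coord_def from_coords_def complex_eq_iff)
qed

lemma herm_prod_from_coords:
  assumes e: "orthonormal_basis e K" and L: "finite L" "L \<subseteq> K"
  shows "herm_prod (from_coords e L x) (from_coords e L y) = herm L x y"
proof -
  have o: "e i \<bullet> e k = (if i = k then 1 else 0)" if "i \<in> L" "k \<in> L" for i k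
    using e subsetD[OF L(2) that(1)] subsetD[OF L(2) that(2)] by (simp add: orthonormal_basis_def)
  have "(\<Sum>i\<in>L. c i *\<^sub>R e i) \<bullet> (\<Sum>k\<in>L. d k *\<^sub>R e k) = (\<Sum>i\<in>L. c i * d i)" for c d :: "'a \<Rightarrow> real"
  proof -
    have "(\<Sum>i\<in>L. c i *\<^sub>R e i) \<bullet> (\<Sum>k\<in>L. d k *\<^sub>R e k) = (\<Sum>i\<in>L. \<Sum>k\<in>L. if k = i then c i * d k else 0)"
      unfolding inner_sum_left inner_sum_right by (intro sum.cong refl) (simp add: o)
    then show ?thesis using L(1) by simp
  qed
  then show ?thesis
    by (simp add: herm_prod_def from_coords_def herm_def complex_eq_iff sum.distrib sum_subtractf)
qed

lemma power_tensor_from_coords: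
  assumes "orthonormal_basis e K" "finite L" "L \<subseteq> K" "\<And>k. k \<notin> L \<Longrightarrow> y k = 0"
  shows "power_tensor e K m n (from_coords e L y) = pow_tensor K m n y"
proof (intro ext)
  fix ks ls
  have "(\<Prod>k\<leftarrow>ks. f (coord e (from_coords e L y) k)) = (\<Prod>k\<leftarrow>ks. f (y k))"
    if "set ks \<subseteq> K" for ks and f :: "complex \<Rightarrow> complex"
    using that coord_from_coords[OF assms] by (intro arg_cong[of _ _ prod_list] map_cong) auto
  from this[of ks "\<lambda>z. z"] this[of ls cnj]
  show "power_tensor e K m n (from_coords e L y) ks ls = pow_tensor K m n y ks ls"
    by (auto simp: power_tensor_def pow_tensor_def tuples_def)
qed

lemma pow_tensor_subset:
  assumes L: "L \<subseteq> K" and y: "\<And>k. k \<notin> L \<Longrightarrow> y k = 0"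
  shows "pow_tensor L m n y = pow_tensor K m n y"
proof (intro ext)
  fix ks ls
  have zero: "(\<Prod>k\<leftarrow>ks. f (y k)) = 0" if "\<not> set ks \<subseteq> L" "f 0 = 0" for ks and f :: "complex \<Rightarrow> complex"
    using that y by (induction ks) auto
  show "pow_tensor L m n y ks ls = pow_tensor K m n y ks ls"
  proof (cases "set ks \<subseteq> L \<and> set ls \<subseteq> L")
    case True
    then have "set ks \<subseteq> K" "set ls \<subseteq> K" using L by auto
    with True show ?thesis by (simp add: pow_tensor_def tuples_def)
  next
    case False
    then have "(\<Prod>k\<leftarrow>ks. y k) * (\<Prod>l\<leftarrow>ls. cnj (y l)) = 0"
      using zero[of ks "\<lambda>x. x"] zero[of ls cnj] by auto
    moreover have "\<not> (ks \<in> tuples L m \<and> ls \<in> tuples L n)" using False by (auto simp: tuples_def)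
    ultimately show ?thesis by (simp add: pow_tensor_def)
  qed
qed

text \<open>
Tensors are extended by zero, so enlarging the index set does not change them.
\<close>

lemma sym_tensor_space_subset:
  assumes L: "L \<subseteq> K" and f: "f \<in> sym_tensor_space L m n"
  shows "f \<in> sym_tensor_space K m n"
proof -
  have zero: "f ks ls = 0" if "ks \<notin> tuples L m \<or> ls \<notin> tuples L n" for ks ls
    using f that by (auto simp: sym_tensor_space_def tensor_space_def)
  have sub: "index_pairs L m n \<subseteq> index_pairs K m n" using L by (auto simp: tuples_def)
  have "square_summable (index_pairs K m n) (case_prod f) \<longleftrightarrow> square_summable (index_pairs L m n) (case_prod f)"
    unfolding square_summable_def
  proof (rule summable_on_cong_neutral)
    fix x assume x: "x \<in> index_pairs K m n - index_pairs L m n"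
    then show "(cmod (case_prod f x))\<^sup>2 = 0" using zero[of "fst x" "snd x"] by (cases x) auto
  qed (use sub in auto)
  then have "f \<in> tensor_space K m n"
    using f zero sub by (auto simp: sym_tensor_space_def tensor_space_iff)
  moreover have "f (permute_list \<sigma> ks) (permute_list \<tau> ls) = f ks ls"
    if p: "\<sigma> permutes {..<m}" "\<tau> permutes {..<n}" for \<sigma> \<tau> ks ls
  proof (cases "ks \<in> tuples L m \<and> ls \<in> tuples L n")
    case True
    then show ?thesis using f p by (simp add: sym_tensor_space_def)
  next
    case False
    then have "permute_list \<sigma> ks \<notin> tuples L m \<or> permute_list \<tau> ls \<notin> tuples L n"
      using p by (simp add: permute_list_in_tuples)
    then show ?thesis using False zero by metis
  qed
  ultimately show ?thesis by (simp add: sym_tensor_space_def)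
qed

lemma prod_list_permute:
  assumes "\<sigma> permutes {..<length ks}"
  shows "(\<Prod>k\<leftarrow>permute_list \<sigma> ks. f k) = (\<Prod>k\<leftarrow>ks. f k :: complex)"
  using mset_permute_list[OF assms] by (metis mset_map prod_mset_prod_list)

lemma pow_tensor_in_sym_tensor_space:
  assumes "finite L" "L \<subseteq> K" "\<And>k. k \<notin> L \<Longrightarrow> y k = 0"
  shows "pow_tensor K m n y \<in> sym_tensor_space K m n"
proof -
  have "pow_tensor L m n y \<in> tensor_space L m n"
    using assms(1) by (auto simp: tensor_space_iff square_summable_finite finite_tuples pow_tensor_def)
  moreover have "pow_tensor L m n y (permute_list \<sigma> ks) (permute_list \<tau> ls) = pow_tensor L m n y ks ls"
    if "\<sigma> permutes {..<m}" "\<tau> permutes {..<n}" "ks \<in> tuples L m" "ls \<in> tuples L n" for \<sigma> \<tau> ks ls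
  proof -
    have "length ks = m" "length ls = n" using that by (auto simp: tuples_def)
    then show ?thesis using that by (simp add: pow_tensor_def permute_list_in_tuples prod_list_permute)
  qed
  ultimately have "pow_tensor L m n y \<in> sym_tensor_space L m n" by (simp add: sym_tensor_space_def)
  then have "pow_tensor L m n y \<in> sym_tensor_space K m n" by (rule sym_tensor_space_subset[OF assms(2)])
  then show ?thesis by (simp add: pow_tensor_subset[OF assms(2,3)])
qed

lemma tensor_norm_subset_le:
  assumes "L \<subseteq> K" "f \<in> tensor_space K m n"
  shows "tensor_norm L m n f \<le> tensor_norm K m n f"
proof -
  have sub: "index_pairs L m n \<subseteq> index_pairs K m n" using assms by (auto simp: tuples_def)
  have s: "(\<lambda>x. (cmod (case_prod f x))\<^sup>2) summable_on index_pairs K m n"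
    using assms by (simp add: tensor_space_iff square_summable_def)
  have "(\<Sum>\<^sub>\<infinity>x\<in>index_pairs L m n. (cmod (case_prod f x))\<^sup>2) \<le> (\<Sum>\<^sub>\<infinity>x\<in>index_pairs K m n. (cmod (case_prod f x))\<^sup>2)"
    by (rule infsum_mono2[OF _ s sub]) (auto intro: summable_on_subset_banach[OF s sub])
  then show ?thesis by (simp add: tensor_norm_eq_l2_norm l2_norm_def)
qed

lemma tensor_inner_pow_tensors:
  assumes L: "finite L" "L \<subseteq> K"
  shows "tensor_inner L m n (pow_tensor K m n x) (pow_tensor L m n y) = herm L x y ^ m * cnj (herm L x y) ^ n"
proof -
  have K: "ks \<in> tuples L r \<Longrightarrow> ks \<in> tuples K r" for ks r using L by (auto simp: tuples_def)
  have "tensor_inner L m n (pow_tensor K m n x) (pow_tensor L m n y) =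
     (\<Sum>ks\<in>tuples L m. \<Sum>ls\<in>tuples L n. (\<Prod>k\<leftarrow>ks. x k * cnj (y k)) * (\<Prod>k\<leftarrow>ls. y k * cnj (x k)))"
    unfolding tensor_inner_def
    by (intro sum.cong refl) (simp add: pow_tensor_def K prod_list_mult_distrib cnj_prod_list mult_ac)
  also have "\<dots> = herm L x y ^ m * herm L y x ^ n"
    by (simp add: sum_product[symmetric] sum_tuples_prod[OF L(1)] herm_def)
  finally show ?thesis by (simp add: cnj_herm)
qed

lemma tensor_inner_add_left:
  "tensor_inner L m n (\<lambda>ks ls. f ks ls + g ks ls) u = tensor_inner L m n f u + tensor_inner L m n g u"
  by (simp add: tensor_inner_def distrib_right sum.distrib)

lemma tensor_inner_scale_left:
  "tensor_inner L m n (\<lambda>ks ls. c * f ks ls) u = c * tensor_inner L m n f u"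
  by (simp add: tensor_inner_def sum_distrib_left mult.assoc)

lemma sym_tensor_space_linear:
  shows "f \<in> sym_tensor_space K m n \<Longrightarrow> g \<in> sym_tensor_space K m n \<Longrightarrow> (\<lambda>ks ls. f ks ls + g ks ls) \<in> sym_tensor_space K m n"
    and "f \<in> sym_tensor_space K m n \<Longrightarrow> (\<lambda>ks ls. c * f ks ls) \<in> sym_tensor_space K m n"
  using tensor_add(1)[of f K m n g] tensor_scale(1)[of f K m n c] by (auto simp: sym_tensor_space_def)

lemma (in prob_space) expectation_squared_le:
  assumes "integrable M Y" "integrable M (\<lambda>\<omega>. (Y \<omega>)\<^sup>2)"
  shows "(\<integral>\<omega>. Y \<omega> \<partial>M)\<^sup>2 \<le> (\<integral>\<omega>. (Y \<omega>)\<^sup>2 \<partial>M :: real)"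
  using variance_positive[of Y] variance_eq[OF assms] by simp

context complex_gaussian_process
begin

lemma generated_by_measurable:
  assumes "f \<in> borel_measurable (generated_by M Z)"
  shows "f \<in> borel_measurable M"
proof -
  have "(\<lambda>\<omega>. \<omega>) \<in> measurable M (generated_by M Z)"
    unfolding generated_by_def by (rule measurable_vimage_algebra2) (auto intro!: measurable_PiM_single')
  from measurable_compose[OF this assms] show ?thesis .
qed

context
  fixes e :: "'k \<Rightarrow> 'h" and K :: "'k set" and m n :: nat and I :: "'k tensor \<Rightarrow> 'w \<Rightarrow> complex"
  assumes e: "orthonormal_basis e K" and I: "wiener_ito_integral M Z e K m n I"
begin

lemma integral_measurable: "f \<in> sym_tensor_space K m n \<Longrightarrow> I f \<in> borel_measurable M"
  using I unfolding wiener_ito_integral_def by (intro generated_by_measurable) blast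

lemma integral_square_integrable: "f \<in> sym_tensor_space K m n \<Longrightarrow> integrable M (\<lambda>\<omega>. (cmod (I f \<omega>))\<^sup>2)"
  using I by (simp add: wiener_ito_integral_def)

lemma integral_integrable:
  assumes "f \<in> sym_tensor_space K m n"
  shows "integrable M (I f)"
proof (rule Bochner_Integration.integrable_bound)
  show "integrable M (\<lambda>\<omega>. 1 + (cmod (I f \<omega>))\<^sup>2)"
    using integral_square_integrable[OF assms] by simp
  have "x \<le> 1 + x\<^sup>2" for x :: real
    using zero_le_power2[of "x - 1 / 2"] by (simp add: power2_eq_square algebra_simps)
  then show "AE \<omega> in M. norm (I f \<omega>) \<le> norm (1 + (cmod (I f \<omega>))\<^sup>2)" by simp
qed (rule integral_measurable[OF assms])

definition char_functional :: "'h complexified \<Rightarrow> 'k tensor \<Rightarrow> complex" where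
  "char_functional w f = (\<integral>\<omega>. I f \<omega> * iexp (Re (Z w \<omega>)) \<partial>M)"

lemma char_functional_integrable:
  "f \<in> sym_tensor_space K m n \<Longrightarrow> integrable M (\<lambda>\<omega>. I f \<omega> * iexp (Re (Z w \<omega>)))"
proof (rule Bochner_Integration.integrable_bound[OF integral_integrable])
  assume f: "f \<in> sym_tensor_space K m n"
  note [measurable] = integral_measurable[OF f]
  show "(\<lambda>\<omega>. I f \<omega> * iexp (Re (Z w \<omega>))) \<in> borel_measurable M" by measurable
qed (auto simp: norm_mult)

lemma char_functional_add:
  assumes f: "f \<in> sym_tensor_space K m n" and g: "g \<in> sym_tensor_space K m n"
  shows "char_functional w (\<lambda>ks ls. f ks ls + g ks ls) = char_functional w f + char_functional w g"
proof -
  note [measurable] = integral_measurable[OF f] integral_measurable[OF g] integral_measurable[OF sym_tensor_space_linear(1)[OF f g]]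
  have ae: "AE \<omega> in M. I (\<lambda>ks ls. f ks ls + g ks ls) \<omega> = I f \<omega> + I g \<omega>"
    using I f g by (simp add: wiener_ito_integral_def)
  have "char_functional w (\<lambda>ks ls. f ks ls + g ks ls) = (\<integral>\<omega>. I f \<omega> * iexp (Re (Z w \<omega>)) + I g \<omega> * iexp (Re (Z w \<omega>)) \<partial>M)"
    unfolding char_functional_def
  proof (rule integral_cong_AE)
    show "AE \<omega> in M. I (\<lambda>ks ls. f ks ls + g ks ls) \<omega> * iexp (Re (Z w \<omega>)) = I f \<omega> * iexp (Re (Z w \<omega>)) + I g \<omega> * iexp (Re (Z w \<omega>))"
      using ae by eventually_elim (simp add: distrib_right)
  qed measurable
  also have "\<dots> = char_functional w f + char_functional w g"
    unfolding char_functional_def by (rule Bochner_Integration.integral_add) (intro char_functional_integrable f g)+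
  finally show ?thesis .
qed

lemma char_functional_scale:
  assumes f: "f \<in> sym_tensor_space K m n"
  shows "char_functional w (\<lambda>ks ls. c * f ks ls) = c * char_functional w f"
proof -
  note [measurable] = integral_measurable[OF f] integral_measurable[OF sym_tensor_space_linear(2)[OF f, of c]]
  have ae: "AE \<omega> in M. I (\<lambda>ks ls. c * f ks ls) \<omega> = c * I f \<omega>"
    using I f by (simp add: wiener_ito_integral_def)
  have "char_functional w (\<lambda>ks ls. c * f ks ls) = (\<integral>\<omega>. c * (I f \<omega> * iexp (Re (Z w \<omega>))) \<partial>M)"
    unfolding char_functional_def
  proof (rule integral_cong_AE)
    show "AE \<omega> in M. I (\<lambda>ks ls. c * f ks ls) \<omega> * iexp (Re (Z w \<omega>)) = c * (I f \<omega> * iexp (Re (Z w \<omega>)))"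
      using ae by eventually_elim simp
  qed measurable
  then show ?thesis by (simp add: char_functional_def)
qed

lemma char_functional_bounded:
  obtains C where "0 \<le> C" "\<And>f. f \<in> sym_tensor_space K m n \<Longrightarrow> cmod (char_functional w f) \<le> C * tensor_norm K m n f"
proof -
  obtain C where C: "\<And>f. f \<in> sym_tensor_space K m n \<Longrightarrow> (\<integral>\<omega>. (cmod (I f \<omega>))\<^sup>2 \<partial>M) \<le> C * (tensor_norm K m n f)\<^sup>2"
    using I unfolding wiener_ito_integral_def by blast
  have "cmod (char_functional w f) \<le> sqrt \<bar>C\<bar> * tensor_norm K m n f" if f: "f \<in> sym_tensor_space K m n" for f
  proof -
    have "cmod (char_functional w f) \<le> (\<integral>\<omega>. cmod (I f \<omega> * iexp (Re (Z w \<omega>))) \<partial>M)"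
      unfolding char_functional_def by (rule integral_norm_bound)
    also have "\<dots> = (\<integral>\<omega>. cmod (I f \<omega>) \<partial>M)" by (simp add: norm_mult)
    also have "\<dots> \<le> sqrt ((tensor_norm K m n f)\<^sup>2 * \<bar>C\<bar>)"
    proof (rule real_le_rsqrt)
      have "(\<integral>\<omega>. cmod (I f \<omega>) \<partial>M)\<^sup>2 \<le> (\<integral>\<omega>. (cmod (I f \<omega>))\<^sup>2 \<partial>M)"
        by (rule expectation_squared_le) (use integral_integrable[OF f] integral_square_integrable[OF f] in auto)
      also have "\<dots> \<le> C * (tensor_norm K m n f)\<^sup>2" by (rule C[OF f])
      also have "\<dots> \<le> (tensor_norm K m n f)\<^sup>2 * \<bar>C\<bar>" by (subst mult.commute) (intro mult_left_mono, auto)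
      finally show "(\<integral>\<omega>. cmod (I f \<omega>) \<partial>M)\<^sup>2 \<le> (tensor_norm K m n f)\<^sup>2 * \<bar>C\<bar>" .
    qed
    also have "\<dots> = sqrt \<bar>C\<bar> * tensor_norm K m n f" by (simp add: real_sqrt_mult)
    finally show ?thesis .
  qed
  then show thesis using that[of "sqrt \<bar>C\<bar>"] by simp
qed

text \<open>
The difference \<open>D\<close> of the two sides is linear in \<open>f\<close>, bounded, and zero on tensor powers, hence zero on truncations by
polarization, and therefore zero.
\<close>

theorem char_functional_eq:
  assumes f: "f \<in> sym_tensor_space K m n" and L: "finite L" "L \<subseteq> K" and y: "\<And>k. k \<notin> L \<Longrightarrow> y k = 0"
  shows "char_functional (from_coords e L y) f =
    (\<i> / 2) ^ (m + n) * of_real (exp (- (norm (from_coords e L y))\<^sup>2 / 4)) * tensor_inner L m n f (pow_tensor L m n y)"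
proof -
  let ?w = "from_coords e L y" and ?S = "sym_tensor_space K m n"
  define c where "c = (\<i> / 2) ^ (m + n) * of_real (exp (- (norm ?w)\<^sup>2 / 4))"
  define D where "D = (\<lambda>f. char_functional ?w f - c * tensor_inner L m n f (pow_tensor L m n y))"
  have D_add: "D (\<lambda>ks ls. f ks ls + g ks ls) = D f + D g" if "f \<in> ?S" "g \<in> ?S" for f g
    by (simp add: D_def char_functional_add[OF that] tensor_inner_add_left algebra_simps)
  have D_scale: "D (\<lambda>ks ls. a * f ks ls) = a * D f" if "f \<in> ?S" for f a
    by (simp add: D_def char_functional_scale[OF that] tensor_inner_scale_left algebra_simps)
  have D_pow: "D (pow_tensor K m n x) = 0" if L': "finite L'" "L' \<subseteq> K" and x: "\<And>k. k \<notin> L' \<Longrightarrow> x k = 0" for L' x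
  proof -
    \<comment> \<open>Both vectors have to be expanded over the same basis indices.\<close>
    let ?U = "L \<union> L'"
    have U: "finite ?U" "?U \<subseteq> K" "\<And>k. k \<notin> ?U \<Longrightarrow> x k = 0" using L L' x by auto
    have w: "?w = from_coords e ?U y"
      unfolding from_coords_def using L U y by (auto intro!: sum.mono_neutral_left)
    have h: "herm_prod (from_coords e ?U x) ?w = herm L x y"
      unfolding w herm_prod_from_coords[OF e U(1,2)] herm_def
      using L U y by (auto intro!: sum.mono_neutral_right)
    have ae: "AE \<omega> in M. I (pow_tensor K m n x) \<omega> = complex_hermite m n (Z (from_coords e ?U x) \<omega>) ((norm (from_coords e ?U x))\<^sup>2)"
    proof -
      have "\<forall>h. AE \<omega> in M. I (power_tensor e K m n h) \<omega> = complex_hermite m n (Z h \<omega>) ((norm h)\<^sup>2)"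
        using I unfolding wiener_ito_integral_def by (elim conjE)
      moreover have "power_tensor e K m n (from_coords e ?U x) = pow_tensor K m n x"
        by (rule power_tensor_from_coords[OF e U(1,2)]) (rule U(3))
      ultimately show ?thesis by metis
    qed
    note [measurable] = integral_measurable[OF pow_tensor_in_sym_tensor_space[OF L' x]]
    have "char_functional ?w (pow_tensor K m n x) =
        (\<integral>\<omega>. complex_hermite m n (Z (from_coords e ?U x) \<omega>) ((norm (from_coords e ?U x))\<^sup>2) * iexp (Re (Z ?w \<omega>)) \<partial>M)"
      unfolding char_functional_def
    proof (rule integral_cong_AE)
      show "(\<lambda>\<omega>. complex_hermite m n (Z (from_coords e ?U x) \<omega>) ((norm (from_coords e ?U x))\<^sup>2) * iexp (Re (Z ?w \<omega>))) \<in> borel_measurable M"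
        unfolding complex_hermite_def by measurable
    qed (use ae in \<open>measurable, eventually_elim, simp\<close>)
    also have "\<dots> = c * (herm L x y ^ m * cnj (herm L x y) ^ n)"
      unfolding expectation_complex_hermite_iexp h c_def by (simp only: power_mult_distrib power_add mult_ac)
    finally show ?thesis by (simp add: D_def tensor_inner_pow_tensors[OF L])
  qed
  have D_restrict: "D (restrict_tensor L' f) = 0" if L': "finite L'" "L' \<subseteq> K" for L'
  proof -
    obtain T :: "('k list \<times> 'k list \<times> (nat \<Rightarrow> nat)) set" and a x where T: "finite T"
      and x: "\<And>\<alpha> k. \<alpha> \<in> T \<Longrightarrow> k \<notin> L' \<Longrightarrow> x \<alpha> k = 0"
      and eq: "restrict_tensor L' f = (\<lambda>ks ls. \<Sum>\<alpha>\<in>T. a \<alpha> * pow_tensor L' m n (x \<alpha>) ks ls)"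
      by (rule sym_tensor_eq_sum_of_powers[OF L'(1) restrict_tensor_sym(1)[OF L'(2,1) f]]) (rule that, assumption+)
    have mem: "pow_tensor K m n (x \<alpha>) \<in> ?S" if "\<alpha> \<in> T" for \<alpha>
      by (rule pow_tensor_in_sym_tensor_space[OF L']) (rule x[OF that])
    have "(\<lambda>ks ls. \<Sum>\<alpha>\<in>A. a \<alpha> * pow_tensor K m n (x \<alpha>) ks ls) \<in> ?S \<and>
        D (\<lambda>ks ls. \<Sum>\<alpha>\<in>A. a \<alpha> * pow_tensor K m n (x \<alpha>) ks ls) = 0" if "A \<subseteq> T" for A
      using finite_subset[OF that T] that
    proof (induction A)
      case empty
      have "(\<lambda>ks ls. 0 * f ks ls) \<in> ?S" "D (\<lambda>ks ls. 0 * f ks ls) = 0 * D f"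
        using sym_tensor_space_linear(2)[OF f] D_scale[OF f] by blast+
      then show ?case by simp
    next
      case (insert \<alpha> A)
      then have "\<alpha> \<in> T" by auto
      then have p: "(\<lambda>ks ls. a \<alpha> * pow_tensor K m n (x \<alpha>) ks ls) \<in> ?S" "D (\<lambda>ks ls. a \<alpha> * pow_tensor K m n (x \<alpha>) ks ls) = 0"
        using sym_tensor_space_linear(2)[OF mem] D_scale[OF mem] D_pow[OF L' x] by auto
      show ?case using insert sym_tensor_space_linear(1)[OF p(1)] D_add[OF p(1)] p(2) by simp
    qed
    from this[OF subset_refl] have "D (\<lambda>ks ls. \<Sum>\<alpha>\<in>T. a \<alpha> * pow_tensor K m n (x \<alpha>) ks ls) = 0" by blast
    moreover have "restrict_tensor L' f = (\<lambda>ks ls. \<Sum>\<alpha>\<in>T. a \<alpha> * pow_tensor K m n (x \<alpha>) ks ls)"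
      unfolding eq by (intro ext sum.cong refl) (simp add: pow_tensor_subset[OF L'(2) x])
    ultimately show ?thesis by simp
  qed
  obtain C1 where C1: "0 \<le> C1" "\<And>f. f \<in> ?S \<Longrightarrow> cmod (char_functional ?w f) \<le> C1 * tensor_norm K m n f"
    using char_functional_bounded by blast
  define C where "C = C1 + cmod c * tensor_norm L m n (pow_tensor L m n y)"
  have D_bound: "cmod (D g) \<le> C * tensor_norm K m n g" if g: "g \<in> ?S" for g
  proof -
    have "cmod (D g) \<le> cmod (char_functional ?w g) + cmod c * cmod (tensor_inner L m n g (pow_tensor L m n y))"
      unfolding D_def norm_mult[symmetric] by (rule norm_triangle_ineq4)
    also have "\<dots> \<le> C1 * tensor_norm K m n g + cmod c * (tensor_norm K m n g * tensor_norm L m n (pow_tensor L m n y))"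
    proof (intro add_mono C1(2)[OF g] mult_left_mono norm_ge_zero)
      have "cmod (tensor_inner L m n g (pow_tensor L m n y)) \<le> tensor_norm L m n g * tensor_norm L m n (pow_tensor L m n y)"
        by (rule tensor_inner_bound[OF L(1)])
      also have "\<dots> \<le> tensor_norm K m n g * tensor_norm L m n (pow_tensor L m n y)"
        using g by (intro mult_right_mono tensor_norm_subset_le[OF L(2)]) (auto simp: sym_tensor_space_def)
      finally show "cmod (tensor_inner L m n g (pow_tensor L m n y)) \<le> tensor_norm K m n g * tensor_norm L m n (pow_tensor L m n y)" .
    qed
    finally show ?thesis by (simp add: C_def algebra_simps)
  qed
  have "((\<lambda>L'. C * tensor_norm K m n (\<lambda>ks ls. f ks ls - restrict_tensor L' f ks ls)) \<longlongrightarrow> C * 0) (finite_subsets_at_top K)"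
    using f by (intro tendsto_intros restrict_tensor_remainder_tendsto) (simp add: sym_tensor_space_def)
  moreover have "\<forall>\<^sub>F L' in finite_subsets_at_top K. cmod (D f) \<le> C * tensor_norm K m n (\<lambda>ks ls. f ks ls - restrict_tensor L' f ks ls)"
  proof (rule eventually_finite_subsets_at_top_weakI)
    fix L' assume L': "finite L'" "L' \<subseteq> K"
    note r = restrict_tensor_sym(2)[OF L'(2,1) f]
    let ?g = "\<lambda>ks ls. f ks ls - restrict_tensor L' f ks ls"
    have g: "?g \<in> ?S" using sym_tensor_space_linear(1)[OF f sym_tensor_space_linear(2)[OF r, of "- 1"]] by simp
    have "D (\<lambda>ks ls. restrict_tensor L' f ks ls + ?g ks ls) = D (restrict_tensor L' f) + D ?g"
      by (rule D_add[OF r g])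
    then have "D f = D ?g" by (simp add: D_restrict[OF L'])
    then show "cmod (D f) \<le> C * tensor_norm K m n ?g" using D_bound[OF g] by simp
  qed
  ultimately have "cmod (D f) \<le> C * 0"
    by (rule tendsto_lowerbound) simp
  then show ?thesis by (simp add: D_def c_def)
qed

end

text \<open>
Conjugating \<open>I f\<close> replaces \<open>w\<close> by \<open>-w\<close> in the exponential, which cancels the conjugation of the powers of \<open>\<i>\<close>. So
the difference of \<open>h\<close> and the conjugate kernel is orthogonal to all powers of finitely supported vectors, hence by
polarization to its own truncations.
\<close>

theorem kernel_of_conjugate:
  fixes e :: "'k \<Rightarrow> 'h"
  assumes e: "orthonormal_basis e K"
    and I: "wiener_ito_integral M Z e K m n I" and J: "wiener_ito_integral M Z e K n m J"
    and f: "f \<in> sym_tensor_space K m n" and h: "h \<in> sym_tensor_space K n m"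
    and conj: "AE \<omega> in M. cnj (I f \<omega>) = J h \<omega>"
  shows "h = conj_kernel f"
proof -
  define d where "d = (\<lambda>ks ls. h ks ls + (- 1) * conj_kernel f ks ls)"
  have d: "d \<in> sym_tensor_space K n m"
    unfolding d_def by (intro sym_tensor_space_linear h conj_kernel_in_sym_tensor_space f)
  have orth: "tensor_inner L n m d (pow_tensor L n m y) = 0"
    if L: "finite L" "L \<subseteq> K" and y: "\<And>k. k \<notin> L \<Longrightarrow> y k = 0" for L y
  proof -
    let ?w = "from_coords e L y"
    let ?c = "(\<i> / 2) ^ (m + n) * of_real (exp (- (norm ?w)\<^sup>2 / 4)) :: complex"
    note [measurable] = integral_measurable[OF e I f] integral_measurable[OF e J h]
    have minus: "AE \<omega> in M. Re (Z (- ?w) \<omega>) = - Re (Z ?w \<omega>)"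
      using Z_linear[of ?w "- 2" ?w] by (simp add: scaleR_2)
    have "char_functional J ?w h = (\<integral>\<omega>. cnj (I f \<omega> * iexp (Re (Z (- ?w) \<omega>))) \<partial>M)"
      unfolding char_functional_def[OF e J]
    proof (rule integral_cong_AE)
      show "AE \<omega> in M. J h \<omega> * iexp (Re (Z ?w \<omega>)) = cnj (I f \<omega> * iexp (Re (Z (- ?w) \<omega>)))"
        using conj minus by eventually_elim (simp add: exp_cnj)
    qed measurable
    also have "\<dots> = cnj (char_functional I (- ?w) f)"
      unfolding char_functional_def[OF e I] by (simp del: complex_cnj_mult)
    also have "- ?w = from_coords e L (\<lambda>k. - y k)" by (simp only: from_coords_uminus)
    also have "char_functional I \<dots> f = (\<i> / 2) ^ (m + n) * of_real (exp (- (norm (from_coords e L (\<lambda>k. - y k)))\<^sup>2 / 4)) *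
        tensor_inner L m n f (pow_tensor L m n (\<lambda>k. - y k))"
      by (rule char_functional_eq[OF e I f L]) (simp add: y)
    also have "pow_tensor L m n (\<lambda>k. - y k) = (\<lambda>ks ls. (- 1) ^ (m + n) * pow_tensor L m n y ks ls)"
    proof -
      have neg: "(\<Prod>k\<leftarrow>ks. - g k) = (- 1) ^ length ks * (\<Prod>k\<leftarrow>ks. g k :: complex)" for ks :: "'k list" and g
        by (induction ks) auto
      show ?thesis by (intro ext) (simp add: pow_tensor_def neg tuples_def power_add)
    qed
    also have "cnj ((\<i> / 2) ^ (m + n) * of_real (exp (- (norm (from_coords e L (\<lambda>k. - y k)))\<^sup>2 / 4)) *
        tensor_inner L m n f (\<lambda>ks ls. (- 1) ^ (m + n) * pow_tensor L m n y ks ls)) =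
        ?c * tensor_inner L n m (conj_kernel f) (pow_tensor L n m y)"
    proof -
      have "tensor_inner L n m (conj_kernel f) (pow_tensor L n m y) = cnj (tensor_inner L m n f (pow_tensor L m n y))"
        unfolding tensor_inner_def
        by (subst sum.swap) (simp add: conj_kernel_def pow_tensor_def cnj_prod_list mult_ac)
      moreover have "tensor_inner L m n f (\<lambda>ks ls. (- 1) ^ (m + n) * pow_tensor L m n y ks ls) =
          (- 1) ^ (m + n) * tensor_inner L m n f (pow_tensor L m n y)"
        by (simp add: tensor_inner_def sum_distrib_left mult_ac)
      moreover have "cnj ((\<i> / 2) ^ (m + n)) * (- 1) ^ (m + n) = (\<i> / 2) ^ (m + n)"
        by (simp add: power_mult_distrib[symmetric])
      ultimately show ?thesis by (simp add: from_coords_uminus mult_ac)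
    qed
    finally have "char_functional J ?w h = ?c * tensor_inner L n m (conj_kernel f) (pow_tensor L n m y)" .
    moreover have "char_functional J ?w h = ?c * tensor_inner L n m h (pow_tensor L n m y)"
      using char_functional_eq[OF e J h L y] by (simp add: add.commute)
    ultimately have "tensor_inner L n m h (pow_tensor L n m y) = tensor_inner L n m (conj_kernel f) (pow_tensor L n m y)" by simp
    then show ?thesis unfolding d_def tensor_inner_add_left tensor_inner_scale_left by simp
  qed
  have "d ks ls = 0" for ks ls
  proof (cases "ks \<in> tuples K n \<and> ls \<in> tuples K m")
    case False
    then show ?thesis using d by (auto simp: sym_tensor_space_def tensor_space_def)
  next
    case True
    \<comment> \<open>The smallest truncation that still contains the entry.\<close>
    define L where "L = set ks \<union> set ls"
    have L: "finite L" "L \<subseteq> K" using True by (auto simp: L_def tuples_def)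
    obtain T :: "('k list \<times> 'k list \<times> (nat \<Rightarrow> nat)) set" and a x where T: "finite T"
      and x: "\<And>\<alpha> k. \<alpha> \<in> T \<Longrightarrow> k \<notin> L \<Longrightarrow> x \<alpha> k = 0"
      and eq: "restrict_tensor L d = (\<lambda>ks ls. \<Sum>\<alpha>\<in>T. a \<alpha> * pow_tensor L n m (x \<alpha>) ks ls)"
      by (rule sym_tensor_eq_sum_of_powers[OF L(1) restrict_tensor_sym(1)[OF L(2,1) d]]) (rule that, assumption+)
    have "tensor_inner L n m d (restrict_tensor L d) = (\<Sum>\<alpha>\<in>T. cnj (a \<alpha>) * tensor_inner L n m d (pow_tensor L n m (x \<alpha>)))"
    proof -
      have "tensor_inner L n m d (restrict_tensor L d) = (\<Sum>z\<in>index_pairs L n m. \<Sum>\<alpha>\<in>T. cnj (a \<alpha>) * (d (fst z) (snd z) * cnj (pow_tensor L n m (x \<alpha>) (fst z) (snd z))))"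
      proof -
        have "tensor_inner L n m d (restrict_tensor L d) = (\<Sum>ks\<in>tuples L n. \<Sum>ls\<in>tuples L m. \<Sum>\<alpha>\<in>T.
            cnj (a \<alpha>) * (d ks ls * cnj (pow_tensor L n m (x \<alpha>) ks ls)))"
          by (simp add: tensor_inner_def eq sum_distrib_left mult_ac)
        then show ?thesis by (subst (asm) sum.cartesian_product) (simp only: case_prod_unfold)
      qed
      also have "\<dots> = (\<Sum>\<alpha>\<in>T. \<Sum>z\<in>index_pairs L n m. cnj (a \<alpha>) * (d (fst z) (snd z) * cnj (pow_tensor L n m (x \<alpha>) (fst z) (snd z))))"
        by (rule sum.swap)
      finally show ?thesis by (simp add: tensor_inner_def sum.cartesian_product case_prod_unfold sum_distrib_left)
    qed
    also have "\<dots> = 0" using orth[OF L x] by simp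
    also have "tensor_inner L n m d (restrict_tensor L d) = (\<Sum>z\<in>index_pairs L n m. of_real ((cmod (d (fst z) (snd z)))\<^sup>2))"
      unfolding tensor_inner_def sum.cartesian_product case_prod_unfold
      by (intro sum.cong refl) (auto simp: restrict_tensor_def tuples_def complex_norm_square simp del: of_real_power)
    finally have "(\<Sum>z\<in>index_pairs L n m. (cmod (d (fst z) (snd z)))\<^sup>2) = 0"
      unfolding of_real_sum[symmetric] of_real_eq_0_iff .
    then have "\<forall>z\<in>index_pairs L n m. (cmod (d (fst z) (snd z)))\<^sup>2 = 0"
      using finite_tuples[OF L(1)] by (subst (asm) sum_nonneg_eq_0_iff) auto
    moreover have "(ks, ls) \<in> index_pairs L n m" using True by (auto simp: L_def tuples_def)
    ultimately show ?thesis by fastforce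
  qed
  then show ?thesis by (auto simp: d_def fun_eq_iff)
qed

end

section \<open>The equivalence\<close>

text \<open>
The kernel of the conjugate is the conjugate kernel, so both conditions are statements about \<open>f\<close> alone.
\<close>

theorem theorem1p1:
  fixes M :: "'w measure"
    and e :: "'k \<Rightarrow> 'h::{real_inner, polish_space}" and K :: "'k set"
    and Z :: "'h complexified \<Rightarrow> 'w \<Rightarrow> complex"
    and I :: "nat \<Rightarrow> nat \<Rightarrow> 'k tensor \<Rightarrow> 'w \<Rightarrow> complex"
    and m n l :: nat
    and F :: "nat \<Rightarrow> 'w \<Rightarrow> complex"
    and f h :: "nat \<Rightarrow> 'k tensor"
  assumes "prob_space M"
    and "complex_isonormal M Z"
    and "orthonormal_basis e K"
    and "\<And>p q. wiener_ito_integral M Z e K p q (I p q)"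
    and "m + n \<ge> 2" and "l = m + n"
    and "\<And>k. f k \<in> sym_tensor_space K m n"
    and "\<And>k. AE \<omega> in M. F k \<omega> = I m n (f k) \<omega>"
    and "\<And>k. h k \<in> sym_tensor_space K n m"
    and "\<And>k. AE \<omega> in M. cnj (F k \<omega>) = I n m (h k) \<omega>"
  shows "((\<forall>i j. 0 < i + j \<longrightarrow> i + j \<le> l - 1 \<longrightarrow> i \<le> min m n \<longrightarrow> j \<le> min m n \<longrightarrow>
             (\<lambda>k. contraction_norm K m n m n i j (f k) (f k)) \<longlonglongrightarrow> 0) \<and>
          (\<forall>i j. 0 < i + j \<longrightarrow> i + j \<le> l - 1 \<longrightarrow> i \<le> m \<longrightarrow> j \<le> n \<longrightarrow>
             (\<lambda>k. contraction_norm K m n n m i j (f k) (h k)) \<longlonglongrightarrow> 0))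
     \<longleftrightarrow>
         ((\<forall>i j. 0 < i + j \<longrightarrow> i + j \<le> l - 1 \<longrightarrow> i \<le> min m n \<longrightarrow> j \<le> min m n \<longrightarrow>
             (\<lambda>k. sym_contraction_norm K m n m n i j (f k) (f k)) \<longlonglongrightarrow> 0) \<and>
          (\<forall>i j. 0 < i + j \<longrightarrow> i + j \<le> l - 1 \<longrightarrow> i \<le> m \<longrightarrow> j \<le> n \<longrightarrow>
             (\<lambda>k. sym_contraction_norm K m n n m i j (f k) (h k)) \<longlonglongrightarrow> 0))"
proof -
  interpret complex_gaussian_process M Z
    by (rule complex_isonormal_imp_process) fact+
  have h: "h k = conj_kernel (f k)" for k
  proof (rule kernel_of_conjugate)
    show "AE \<omega> in M. cnj (I m n (f k) \<omega>) = I n m (h k) \<omega>"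
      using assms(8)[of k] assms(10)[of k] by eventually_elim simp
  qed (fact assms)+
  have proper: "(i, j) \<in> proper_indices m n p q \<longleftrightarrow> 0 < i + j \<and> i + j \<le> l - 1 \<and> i \<le> min m q \<and> j \<le> min n p"
    for i j p q
    using assms(5,6) by (auto simp: proper_indices_def)
  have bounds: "i \<le> min m m \<longleftrightarrow> i \<le> m" "j \<le> min n n \<longleftrightarrow> j \<le> n" "j \<le> min n m \<longleftrightarrow> j \<le> min m n" for i j
    by auto
  have "0 < m + n" using assms(5) by linarith
  from contraction_norms_tendsto_zero_iff[where f=f and K=K, OF this assms(7)]
  show ?thesis
    unfolding h Ball_def split_paired_All prod.case proper bounds by (simp only: imp_conjL)
qed

end
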